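(* Let $d\ge 1$, let $p=\{p_\beta\}_{\beta\in\mathbb{Z}^d}$ be a probability distribution on $\mathbb{Z}^d$, and let $(\mathcal{M},\mathscr{A},\mu,T)$ be the random-walk dynamical system associated with $p$, with the exhaustive family $\mathscr{V}$ and the observable classes $\mathcal{G}_m,\mathcal{G},\mathcal{L}_m,\mathcal{L}$ ($m\in\mathbb{N}$), all as defined in the context. Set $\nu:=\max\{2,[d/2]+1\}$, where $[\cdot]$ is the integer part, and suppose that (i) $\sum_{\beta\in\mathbb{Z}^d}|\beta|^\nu p_\beta<\infty$; (ii) for a given $j'\in\mathbb{Z}_N$, $\mathrm{span}_{\mathbb{Z}}\{\beta^{(j)}-\beta^{(j')}\}_{j\in\mathbb{Z}_N}=\mathbb{Z}^d$. Then: (a) for every $m\in\mathbb{N}$ and every $F\in\mathcal{G}_m$, $$\lim_{n\to\infty}\ \sup_{g\in\mathcal{L}_m\setminus 0}\ \frac{1}{\mu(|g|)}\left|\mu((F\circ T^n)g)-\overline{\mu}(F)\mu(g)\right|=0;$$ (b) for every $F\in\mathcal{G}$ and $g\in\mathcal{L}$, $\lim_{n\to\infty}\mu((F\circ T^n)g)=\overline{\mu}(F)\mu(g)$ (and in particular, if $\mu(g)=0$, $\lim_{n\to\infty}\mu((F\circ T^n)g)=0$); (c) for all $F,G\in\mathcal{G}$, $$\lim_{n\to\infty,\ V\nearrow\mathcal{M}}\mu_V((F\circ T^n)G)=\overline{\mu}(F)\,\overline{\mu}(G),$$ i.e. for every $\varepsilon>0$ there is $M>0$ such that $|\mu_V((F\circ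 T^n)G)-\overline{\mu}(F)\overline{\mu}(G)|<\varepsilon$ for all $n\ge M$ and all $V\in\mathscr{V}$ with $\mu(V)\ge M$; (d) for every $m\in\mathbb{N}$ and all $F,G\in\mathcal{G}_m$ such that $F$ is $\mathbb{Z}^d$-periodic (that is, $F(\alpha,y)=F(0,y)$ for all $\alpha\in\mathbb{Z}^d$, $y\in[0,1)^2$), the average $\overline{\mu}((F\circ T^n)G)$ exists for all sufficiently large $n$ and $\lim_{n\to\infty}\overline{\mu}((F\circ T^n)G)=\overline{\mu}(F)\,\overline{\mu}(G)$.
   Context: Random-walk data. $p_\beta\ge 0$, $\sum_\beta p_\beta=1$. $\mathbb{D}:=\{\beta\in\mathbb{Z}^d : p_\beta>0\}=\{\beta^{(j)}\}_{j\in\mathbb{Z}_N}$ is enumerated without repetition, where $N=\#\mathbb{D}$; if $N<\infty$, $\mathbb{Z}_N=\{1,\dots,N\}$, and if $N=\infty$, $\mathbb{Z}_N=\mathbb{Z}^+$. $\mathrm{span}_{\mathbb{Z}}$ denotes the subgroup of finite $\mathbb{Z}$-linear combinations (the span in (ii) does not depend on $j'$). $\mathbb{N}$ includes $0$. Dynamical system. $\mathcal{M}:=\mathbb{Z}^d\times[0,1)^2$; $S_\alpha:=\{\alpha\}\times[0,1)^2$; $\mathscr{A}$ is the $\sigma$-algebra generated by the Lebesgue-measurable subsets of the squares $S_\alpha$; $\mu$ restricts to Lebesgue measure on each $S_\alpha\simeq[0,1)^2$. Put $q_0=0$, $q_k:=\sum_{j=1}^k p_{\beta^{(j)}}$ for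 $k\in\mathbb{Z}_N$. For $x=(\alpha;y_1,y_2)\in\mathcal{M}$ let $k\in\mathbb{Z}_N$ be the unique index with $q_{k-1}\le y_1<q_k$ and define $$Tx:=\left(\alpha+\beta^{(k)};\ p_{\beta^{(k)}}^{-1}(y_1-q_{k-1}),\ p_{\beta^{(k)}}y_2+q_{k-1}\right).$$ $T$ is an invertible map preserving $\mu$. Exhaustive family and averages. For $\gamma\in\mathbb{Z}^d$, $r\in\mathbb{Z}^+$, $B_{\gamma,r}:=\{\alpha\in\mathbb{Z}^d:\gamma_i-r\le\alpha_i\le\gamma_i+r,\ i=1,\dots,d\}$, and $\mathscr{V}:=\{B_{\gamma,r}\times[0,1)^2:\gamma\in\mathbb{Z}^d,\ r\in\mathbb{Z}^+\}$. For a function $\phi$ of $V\in\mathscr V$, $\lim_{V\nearrow\mathcal{M}}\phi(V)=L$ means: for each neighborhood $\mathcal{U}$ of $L$ there is $M>0$ such that $\phi(V)\in\mathcal{U}$ for all $V\in\mathscr{V}$ with $\mu(V)\ge M$. Notation: $\mu(g):=\int_{\mathcal{M}}g\,d\mu$, $\mu_V(F):=\frac{1}{\mu(V)}\int_V F\,d\mu$, $\overline{\mu}(F):=\lim_{V\nearrow\mathcal{M}}\mu_V(F)$ when the limit exists (in $\mathbb R$). Observables (real-valued). Let $\mathscr{B}\subset\mathscr{A}$ be the $\sigma$-algebra generated by the partition $\{S_\alpha\}_{\alpha\in\mathbb{Z}^d}$; for $k\in\mathbb{Z}$, $T^k\mathscr{B}:=\{T^{-k}A:A\in\mathscr{B}\}$;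 for integers $\ell\le m$, $\mathscr{B}_{\ell,m}:=T^\ell\mathscr{B}\vee T^{\ell+1}\mathscr{B}\vee\cdots\vee T^{m}\mathscr{B}$ (the $\sigma$-algebra generated by the union). Then $\mathcal{G}_m:=\{F\in L^\infty(\mathcal{M},\mathscr{B}_{-m,m},\mu):\overline{\mu}(F)\text{ exists}\}$; $\mathcal{G}$ is the $L^\infty$-norm closure of $\bigcup_{m\in\mathbb{N}}\mathcal{G}_m$; $\mathcal{L}_m:=L^1(\mathcal{M},\mathscr{B}_{-m,m},\mu)$; $\mathcal{L}:=L^1(\mathcal{M},\mathscr{A},\mu)$. For every $F\in\mathcal{G}$ the average $\overline{\mu}(F)$ exists. *)

theory Defs
  imports "HOL-Probability.Probability"
begin

section \<open>The lattice and the phase space\<close>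

text \<open>The lattice is \<^typ>\<open>int ^ 'd\<close> with \<open>d = CARD('d)\<close>; a phase point
  \<open>(\<alpha>; y\<^sub>1, y\<^sub>2)\<close> is \<open>(\<alpha>, (y\<^sub>1, y\<^sub>2))\<close>. All maps and observables are total functions
  on \<open>'d phase\<close>; their values outside \<open>rw_space\<close> play no role.\<close>

type_synonym 'd phase = "(int ^ 'd) \<times> real \<times> real"

definition unit_square :: "(real \<times> real) set" where
  "unit_square = {0..<1} \<times> {0..<1}"

definition rw_space :: "('d::finite) phase set" where
  "rw_space = UNIV \<times> unit_square"

definition cell :: "int ^ 'd \<Rightarrow> ('d::finite) phase set" where
  "cell \<alpha> = {\<alpha>} \<times> unit_square"

text \<open>Since the lattice is countable, the product of the discrete \<open>\<sigma>\<close>-algebra with the Lebesgue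
  \<open>\<sigma>\<close>-algebra of the square is the \<open>\<sigma>\<close>-algebra generated by the Lebesgue measurable
  subsets of the cells; see \<open>sets_rw_measure\<close> and \<open>emeasure_rw_measure_cell\<close> below.\<close>

definition rw_measure :: "('d::finite) phase measure" where
  "rw_measure = count_space UNIV \<Otimes>\<^sub>M restrict_space lebesgue unit_square"

section \<open>Random-walk data\<close>

definition index_set :: "'a pmf \<Rightarrow> nat set" where
  "index_set p = (if finite (set_pmf p) then {1..card (set_pmf p)} else {1..})"

definition lattice_norm :: "int ^ ('d::finite) \<Rightarrow> real" where
  "lattice_norm \<beta> = norm ((\<chi> i. real_of_int (\<beta> $ i)) :: real ^ 'd)"

definition int_span :: "(int ^ ('d::finite)) set \<Rightarrow> (int ^ 'd) set" where
  "int_span S = module.span (*s) S"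

lemma module_int_vec: "module ((*s) :: int \<Rightarrow> int ^ 'd \<Rightarrow> int ^ ('d::finite))"
  by unfold_locales (simp_all add: vec_eq_iff algebra_simps)

lemma int_span_explicit: "int_span S = {\<Sum>a\<in>t. r a *s a | t r. finite t \<and> t \<subseteq> S}"
  unfolding int_span_def by (rule module.span_explicit[OF module_int_vec])

section \<open>The dynamical system\<close>

text \<open>Throughout, \<open>b\<close> is an enumeration of the support of \<open>p\<close> by \<open>index_set p\<close>.\<close>

definition cum_prob :: "'a pmf \<Rightarrow> (nat \<Rightarrow> 'a) \<Rightarrow> nat \<Rightarrow> real" where
  "cum_prob p b k = (\<Sum>j=1..k. pmf p (b j))"

definition slot :: "'a pmf \<Rightarrow> (nat \<Rightarrow> 'a) \<Rightarrow> real \<Rightarrow> nat" where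
  "slot p b y = (THE k. k \<in> index_set p \<and> cum_prob p b (k - 1) \<le> y \<and> y < cum_prob p b k)"

definition rw_map :: "(int ^ 'd) pmf \<Rightarrow> (nat \<Rightarrow> int ^ 'd) \<Rightarrow> ('d::finite) phase \<Rightarrow> 'd phase" where
  "rw_map p b = (\<lambda>(\<alpha>, y1, y2). let k = slot p b y1 in
     (\<alpha> + b k,
      inverse (pmf p (b k)) * (y1 - cum_prob p b (k - 1)),
      pmf p (b k) * y2 + cum_prob p b (k - 1)))"

text \<open>Integer powers of the map, as a bijection of \<open>rw_space\<close>.\<close>

definition rw_iter ::
    "(int ^ 'd) pmf \<Rightarrow> (nat \<Rightarrow> int ^ 'd) \<Rightarrow> int \<Rightarrow> ('d::finite) phase \<Rightarrow> 'd phase" where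
  "rw_iter p b k = (if k \<ge> 0 then rw_map p b ^^ nat k
                    else inv_into rw_space (rw_map p b) ^^ nat (- k))"

section \<open>The exhaustive family and infinite-volume averages\<close>

definition lattice_box :: "int ^ 'd \<Rightarrow> nat \<Rightarrow> (int ^ ('d::finite)) set" where
  "lattice_box \<gamma> r = {\<alpha>. \<forall>i. \<gamma> $ i - int r \<le> \<alpha> $ i \<and> \<alpha> $ i \<le> \<gamma> $ i + int r}"

definition exh_family :: "('d::finite) phase set set" where
  "exh_family = {lattice_box \<gamma> r \<times> unit_square | \<gamma> r. r \<ge> 1}"

definition exh_filter :: "('d::finite) phase set filter" where
  "exh_filter = inf (filtercomap (measure rw_measure) at_top) (principal exh_family)"

lemma eventually_exh_filter:
  "eventually P exh_filter \<longleftrightarrow> (\<exists>M>0. \<forall>V\<in>exh_family. measure rw_measure V \<ge> M \<longrightarrow> P V)"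
proof
  assume "eventually P exh_filter"
  then obtain N where "\<forall>V. measure rw_measure V \<ge> N \<longrightarrow> V \<in> exh_family \<longrightarrow> P V"
    by (auto simp: exh_filter_def eventually_inf_principal eventually_filtercomap_at_top_linorder)
  then show "\<exists>M>0. \<forall>V\<in>exh_family. measure rw_measure V \<ge> M \<longrightarrow> P V"
    by (intro exI[of _ "max N 1"]) auto
qed (auto simp: exh_filter_def eventually_inf_principal eventually_filtercomap_at_top_linorder)

definition vol_avg :: "('d::finite) phase set \<Rightarrow> ('d phase \<Rightarrow> real) \<Rightarrow> real" where
  "vol_avg V F = (LINT x:V|rw_measure. F x) / measure rw_measure V"

definition inf_avg_exists :: "(('d::finite) phase \<Rightarrow> real) \<Rightarrow> bool" where
  "inf_avg_exists F \<longleftrightarrow> (\<exists>L. ((\<lambda>V. vol_avg V F) \<longlongrightarrow> L) exh_filter)"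

definition inf_avg :: "(('d::finite) phase \<Rightarrow> real) \<Rightarrow> real" where
  "inf_avg F = Lim exh_filter (\<lambda>V. vol_avg V F)"

section \<open>Observables\<close>

definition cell_sets :: "('d::finite) phase set set" where
  "cell_sets = sigma_sets rw_space (range cell)"

definition pulled_cell_sets ::
    "(int ^ 'd) pmf \<Rightarrow> (nat \<Rightarrow> int ^ 'd) \<Rightarrow> int \<Rightarrow> ('d::finite) phase set set" where
  "pulled_cell_sets p b k = {rw_iter p b (- k) ` A | A. A \<in> cell_sets}"

text \<open>Only the \<open>\<sigma>\<close>-algebra of this measure space is used (its measure is the zero measure):
  integrals and essential suprema are taken with respect to \<open>rw_measure\<close>.\<close>

definition cyl_algebra ::
    "(int ^ 'd) pmf \<Rightarrow> (nat \<Rightarrow> int ^ 'd) \<Rightarrow> int \<Rightarrow> int \<Rightarrow> ('d::finite) phase measure" where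
  "cyl_algebra p b l m = sigma rw_space (\<Union>k\<in>{l..m}. pulled_cell_sets p b k)"

definition Linf_norm :: "(('d::finite) phase \<Rightarrow> real) \<Rightarrow> ereal" where
  "Linf_norm F = esssup rw_measure (\<lambda>x. ereal \<bar>F x\<bar>)"

text \<open>Elements of \<open>L\<^sup>\<infinity>\<close> and \<open>L\<^sup>1\<close> over a sub-\<open>\<sigma>\<close>-algebra are given by their representatives.\<close>

definition Linf_class :: "('d::finite) phase measure \<Rightarrow> ('d phase \<Rightarrow> real) set" where
  "Linf_class A = {F \<in> borel_measurable A. Linf_norm F < \<infinity>}"

definition L1_class :: "('d::finite) phase measure \<Rightarrow> ('d phase \<Rightarrow> real) set" where
  "L1_class A = {g \<in> borel_measurable A. integrable rw_measure g}"

definition global_obs_m ::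
    "(int ^ 'd) pmf \<Rightarrow> (nat \<Rightarrow> int ^ 'd) \<Rightarrow> nat \<Rightarrow> (('d::finite) phase \<Rightarrow> real) set" where
  "global_obs_m p b m =
     {F \<in> Linf_class (cyl_algebra p b (- int m) (int m)). inf_avg_exists F}"

definition global_obs ::
    "(int ^ 'd) pmf \<Rightarrow> (nat \<Rightarrow> int ^ 'd) \<Rightarrow> (('d::finite) phase \<Rightarrow> real) set" where
  "global_obs p b = {F \<in> Linf_class rw_measure.
     \<forall>\<epsilon>>0. \<exists>H \<in> (\<Union>m. global_obs_m p b m). Linf_norm (\<lambda>x. F x - H x) < ereal \<epsilon>}"

definition local_obs_m ::
    "(int ^ 'd) pmf \<Rightarrow> (nat \<Rightarrow> int ^ 'd) \<Rightarrow> nat \<Rightarrow> (('d::finite) phase \<Rightarrow> real) set" where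
  "local_obs_m p b m = L1_class (cyl_algebra p b (- int m) (int m))"

definition local_obs :: "(('d::finite) phase \<Rightarrow> real) set" where
  "local_obs = L1_class rw_measure"

definition ae_zero :: "(('d::finite) phase \<Rightarrow> real) \<Rightarrow> bool" where
  "ae_zero g \<longleftrightarrow> (AE x in rw_measure. g x = 0)"

definition lattice_periodic :: "(('d::finite) phase \<Rightarrow> real) \<Rightarrow> bool" where
  "lattice_periodic F \<longleftrightarrow> (\<forall>\<alpha>. \<forall>y\<in>unit_square. F (\<alpha>, y) = F (0, y))"

section \<open>The measure in terms of cells\<close>

lemma unit_square_lebesgue: "unit_square \<in> sets lebesgue"
  unfolding unit_square_def by (intro sets_completionI_sets) (simp add: borel_Times)

lemma sets_restrict_unit_square:
  "sets (restrict_space lebesgue unit_square) = {E \<in> sets lebesgue. E \<subseteq> unit_square}"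
  using unit_square_lebesgue by (auto simp: sets_restrict_space_iff)

lemma space_rw_measure: "space rw_measure = rw_space"
  by (auto simp: rw_measure_def space_pair_measure rw_space_def space_restrict_space)

lemma sets_rw_measure:
  "sets (rw_measure :: ('d::finite) phase measure) =
     sigma_sets rw_space {{\<alpha>} \<times> E | \<alpha> E. E \<in> sets lebesgue \<and> E \<subseteq> unit_square}"
  (is "_ = sigma_sets _ ?G")
proof (rule antisym)
  have "?G \<subseteq> sets (rw_measure :: 'd phase measure)"
    by (auto simp: rw_measure_def sets_restrict_unit_square intro!: pair_measureI)
  then show "sigma_sets rw_space ?G \<subseteq> sets (rw_measure :: 'd phase measure)"
    unfolding space_rw_measure[symmetric] by (rule sets.sigma_sets_subset)
  have "A \<times> E \<in> sigma_sets rw_space ?G"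
    if "E \<in> sets lebesgue" "E \<subseteq> unit_square" for A :: "(int ^ 'd) set" and E
  proof -
    have "(\<Union>\<alpha>\<in>A. {\<alpha>} \<times> E) \<in> sigma_sets rw_space ?G"
      using that by (intro sigma_sets_UNION) (auto intro!: countable_image sigma_sets.Basic)
    moreover have "(\<Union>\<alpha>\<in>A. {\<alpha>} \<times> E) = A \<times> E" by auto
    ultimately show ?thesis by simp
  qed
  then have "{A \<times> E | A E. A \<in> sets (count_space (UNIV :: (int ^ 'd) set))
      \<and> E \<in> sets (restrict_space lebesgue unit_square)} \<subseteq> sigma_sets rw_space ?G"
    unfolding sets_restrict_unit_square by blast
  moreover have "space (count_space (UNIV :: (int ^ 'd) set)) \<times> space (restrict_space lebesgue unit_square)
      = rw_space"
    by (simp add: rw_space_def space_restrict_space)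
  ultimately show "sets (rw_measure :: 'd phase measure) \<subseteq> sigma_sets rw_space ?G"
    unfolding rw_measure_def sets_pair_measure by (simp only: sigma_sets_mono)
qed

lemma emeasure_rw_measure_cell:
  assumes "E \<in> sets lebesgue" "E \<subseteq> unit_square"
  shows "emeasure rw_measure ({\<alpha> :: int ^ ('d::finite)} \<times> E) = emeasure lebesgue E"
proof -
  have "emeasure lebesgue unit_square < \<infinity>"
  proof -
    have "unit_square \<subseteq> cbox (0, 0) (1, 1)"
      by (auto simp: unit_square_def)
    then have "emeasure lebesgue unit_square \<le> emeasure lebesgue (cbox (0::real, 0::real) (1, 1))"
      by (intro emeasure_mono) auto
    also have "\<dots> < \<infinity>" by (simp add: emeasure_lborel_cbox_eq)
    finally show ?thesis .
  qed
  then interpret finite_measure "restrict_space lebesgue unit_square"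
    using unit_square_lebesgue
    by (intro finite_measureI) (simp add: space_restrict_space emeasure_restrict_space)
  show ?thesis
    unfolding rw_measure_def using assms unit_square_lebesgue
    by (subst emeasure_pair_measure_Times)
       (auto simp: sets_restrict_unit_square emeasure_restrict_space)
qed

end

theory Submission
  imports Defs
begin

text \<open>The map \<open>T\<close> is a baker map that drives a random walk: in \<open>(\<alpha>; y\<^sub>1, y\<^sub>2)\<close> the coordinate
\<open>y\<^sub>1\<close> encodes the future increments and \<open>y\<^sub>2\<close> the past ones, and under \<open>\<mu>\<close> the two are independent on
every cell. A function \<open>F\<close> that is measurable for \<open>\<B>\<^bsub>-m,m\<^esub>\<close> looks at the positions at times
\<open>-m, \<dots>, m\<close>; hence \<open>F \<circ> T\<^sup>m\<close> is a function of \<open>(\<alpha>, y\<^sub>1)\<close> and \<open>F \<circ> T\<^bsup>-m\<^esup>\<close> is a function of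
\<open>(\<alpha>, y\<^sub>2)\<close>. Moving both factors by \<open>m\<close> steps and using independence cell by cell gives, for
\<open>n \<ge> 2m\<close>, \<open>\<mu>((F \<circ> T\<^sup>n) g) = (\<Sum>\<alpha>. (P\<^bsup>n-2m\<^esup> \<Phi>)(\<alpha>) \<Gamma>(\<alpha>))\<close>, where \<open>P\<close> averages a function on the lattice over
one step of the walk and \<open>\<Phi>\<close>, \<open>\<Gamma>\<close> are the integrals of \<open>F \<circ> T\<^sup>m\<close> and \<open>g \<circ> T\<^bsup>-m\<^esup>\<close> over the
cells. As \<open>(\<Sum>\<alpha>. \<bar>\<Gamma>(\<alpha>)\<bar>) \<le> \<mu>(\<bar>g\<bar>)\<close>, everything about cylinder functions reduces to the uniform
convergence of \<open>P\<^sup>n \<Phi>\<close> to the average of \<open>F\<close> (lemma \<open>cyl_correlation\<close>).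

That convergence rests on two facts. First, \<open>P\<^sup>n \<Phi>\<close> becomes invariant under translations: for steps
\<open>a\<close>, \<open>b\<close> of the walk, \<open>P\<^sup>n \<Phi>(x + a) - P\<^sup>n \<Phi>(x + b)\<close> tends to \<open>0\<close> uniformly in \<open>x\<close>. If its supremum
stayed above some \<open>s > 0\<close>, then a near-maximum at time \<open>n + K\<close> would force near-maxima at time \<open>n\<close>
at all the points \<open>x + j a + (K - j) b\<close>; there the differences telescope, so a bounded function would have
an increment of order \<open>K s\<close>, which is absurd for large \<open>K\<close>
(lemma \<open>step_mean_increment_tendsto_zero\<close>). The differences of steps span the lattice, so \<open>P\<^sup>n \<Phi>\<close>
is close to its own mean over a box, which is \<open>P\<^sup>n\<close> applied to the box means of \<open>\<Phi>\<close>. Second, the box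
means of \<open>\<Phi>\<close> over a large box are uniformly close to the average of \<open>F\<close>, because in \<open>m\<close> steps
only a small proportion of the mass crosses the boundary of the box (lemmas \<open>vol_avg_rw_map\<close> and
\<open>box_mean_leak\<close>).

This gives (a). For (c) and cylinder functions take \<open>g = 1\<^sub>V G\<close> in (a): its \<open>L\<^sup>1\<close> norm is at most
\<open>\<mu>(V)\<close> times the bound of \<open>G\<close>. For (d) the function \<open>\<Phi>\<close> is constant, and the factorization is an exact
identity once \<open>n \<ge> 2m\<close>. For (b) the function \<open>g\<close> need not be a cylinder function, and after integrating
out \<open>y\<^sub>2\<close> one needs the integrals of \<open>F \<circ> T\<^sup>n\<close> against arbitrary integrable functions of \<open>y\<^sub>1\<close>. On an
initial segment \<open>y\<^sub>1 < s\<close> one step of the map turns the deviation from equidistribution into the error for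
whole cells plus the same quantity for at most one shorter segment, of relative weight at most some
\<open>\<rho> < 1\<close>; so it tends to \<open>0\<close> (lemma \<open>part_mean_contraction\<close>), and a Dynkin argument and dominated
convergence give all integrable functions. Finally, elements of the uniform closure \<open>\<G>\<close> are replaced by
cylinder observables, the error being bounded by their \<open>L\<^sup>\<infinity>\<close> distance.\<close>

section \<open>Asymptotic translation invariance of the transition operator\<close>

definition step_mean :: "'a::ab_group_add pmf \<Rightarrow> ('a \<Rightarrow> real) \<Rightarrow> 'a \<Rightarrow> real" where
  "step_mean p f x = measure_pmf.expectation p (\<lambda>\<beta>. f (x + \<beta>))"

lemma integrable_pmf_bounded:
  fixes f :: "'a \<Rightarrow> real"
  assumes "\<And>x. \<bar>f x\<bar> \<le> C"
  shows "integrable (measure_pmf p) f"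
  using assms by (intro measure_pmf.integrable_const_bound[where B = C]) auto

lemma abs_expectation_le:
  fixes f :: "'a \<Rightarrow> real"
  assumes "\<And>x. \<bar>f x\<bar> \<le> C"
  shows "\<bar>measure_pmf.expectation p f\<bar> \<le> C"
proof -
  have "f x \<le> C" "- C \<le> f x" for x using assms[of x] by auto
  then have "measure_pmf.expectation p f \<le> C" "- C \<le> measure_pmf.expectation p f"
    using integrable_pmf_bounded[OF assms]
    by (auto intro!: measure_pmf.integral_le_const measure_pmf.integral_ge_const)
  then show ?thesis by auto
qed

lemma step_mean_bounded:
  assumes "\<And>x. \<bar>f x\<bar> \<le> C" shows "\<bar>step_mean p f x\<bar> \<le> C"
  unfolding step_mean_def using assms by (rule abs_expectation_le)

lemma step_mean_iter_bounded:
  assumes "\<And>x. \<bar>f x\<bar> \<le> C" shows "\<bar>(step_mean p ^^ n) f x\<bar> \<le> C"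
  by (induction n arbitrary: x) (auto intro: step_mean_bounded assms)

lemma step_mean_translate: "step_mean p (\<lambda>x. f (x + v)) = (\<lambda>x. step_mean p f (x + v))"
  by (simp add: step_mean_def fun_eq_iff algebra_simps)

lemma step_mean_iter_translate:
  "(step_mean p ^^ n) (\<lambda>x. f (x + v)) = (\<lambda>x. (step_mean p ^^ n) f (x + v))"
  by (induction n) (auto simp: step_mean_translate)

lemma step_mean_diff:
  assumes "\<And>x. \<bar>f x\<bar> \<le> C" "\<And>x. \<bar>g x\<bar> \<le> D"
  shows "step_mean p (\<lambda>x. f x - g x) = (\<lambda>x. step_mean p f x - step_mean p g x)"
  unfolding step_mean_def fun_eq_iff
  using assms by (auto intro!: Bochner_Integration.integral_diff integrable_pmf_bounded)

lemma step_mean_iter_diff: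
  assumes "\<And>x. \<bar>f x\<bar> \<le> C" "\<And>x. \<bar>g x\<bar> \<le> D"
  shows "(step_mean p ^^ n) (\<lambda>x. f x - g x) = (\<lambda>x. (step_mean p ^^ n) f x - (step_mean p ^^ n) g x)"
proof (induction n)
  case (Suc n)
  show ?case using Suc step_mean_diff[of "(step_mean p ^^ n) f" C "(step_mean p ^^ n) g" D p]
      step_mean_iter_bounded[of f C n p] step_mean_iter_bounded[of g D n p] assms by simp
qed simp

lemma step_mean_iter_const: "(step_mean p ^^ n) (\<lambda>x. c) = (\<lambda>x. c)"
  by (induction n) (auto simp: step_mean_def)

lemma step_mean_sum:
  assumes "\<And>i x. i \<in> I \<Longrightarrow> \<bar>f i x\<bar> \<le> C"
  shows "step_mean p (\<lambda>x. \<Sum>i\<in>I. f i x) = (\<lambda>x. \<Sum>i\<in>I. step_mean p (f i) x)"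
  unfolding step_mean_def fun_eq_iff
  using assms by (auto intro!: Bochner_Integration.integral_sum integrable_pmf_bounded)

lemma step_mean_iter_sum:
  assumes "\<And>i x. i \<in> I \<Longrightarrow> \<bar>f i x\<bar> \<le> C"
  shows "(step_mean p ^^ n) (\<lambda>x. \<Sum>i\<in>I. f i x) = (\<lambda>x. \<Sum>i\<in>I. (step_mean p ^^ n) (f i) x)"
proof (induction n)
  case (Suc n)
  show ?case using Suc step_mean_sum[of I "\<lambda>i. (step_mean p ^^ n) (f i)" C p]
      step_mean_iter_bounded[of "f _" C n p] assms by simp
qed simp

lemma step_mean_cmult: "step_mean p (\<lambda>x. c * f x) = (\<lambda>x. c * step_mean p f x)"
  unfolding step_mean_def by simp

lemma step_mean_iter_cmult: "(step_mean p ^^ n) (\<lambda>x. c * f x) = (\<lambda>x. c * (step_mean p ^^ n) f x)"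
  by (induction n) (auto simp: step_mean_cmult)

text \<open>A mean that is within \<open>\<eta>\<close> of the upper bound \<open>s\<close> leaves no room for a value far below
\<open>s\<close> at a point that carries weight: the deficit there, times its weight, is at most \<open>\<eta>\<close>.\<close>

lemma step_mean_near_max:
  assumes bd: "\<And>x. \<bar>g x\<bar> \<le> s" and near: "step_mean p g x \<ge> s - \<eta>" and a: "a \<in> set_pmf p"
  shows "g (x + a) \<ge> s - \<eta> / pmf p a"
proof -
  have "pmf p a * (s - g (x + a)) = measure_pmf.expectation p (\<lambda>\<beta>. indicator {a} \<beta> * (s - g (x + a)))"
    by (simp add: measure_pmf_single)
  also have "\<dots> \<le> measure_pmf.expectation p (\<lambda>\<beta>. s - g (x + \<beta>))"
  proof (rule integral_mono)
    show "integrable (measure_pmf p) (\<lambda>\<beta>. s - g (x + \<beta>))"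
      using bd by (intro Bochner_Integration.integrable_diff integrable_pmf_bounded[of g s] integrable_pmf_bounded[of "\<lambda>\<beta>. g (x + \<beta>)" s]; simp)
    show "integrable (measure_pmf p) (\<lambda>\<beta>. indicat_real {a} \<beta> * (s - g (x + a)))"
      by (rule integrable_pmf_bounded[where C = "\<bar>s - g (x + a)\<bar>"]) (simp add: indicator_def)
    show "indicator {a} \<beta> * (s - g (x + a)) \<le> s - g (x + \<beta>)" for \<beta>
      using bd[of "x + \<beta>"] by (auto simp: indicator_def)
  qed
  also have "\<dots> = s - step_mean p g x"
    unfolding step_mean_def
    using bd by (subst Bochner_Integration.integral_diff) (auto intro!: integrable_pmf_bounded[of _ s])
  also have "\<dots> \<le> \<eta>" using near by simp
  finally have "pmf p a * (s - g (x + a)) \<le> \<eta>" .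
  moreover have "pmf p a > 0" using a by (simp add: pmf_positive)
  ultimately have "s - g (x + a) \<le> \<eta> / pmf p a"
    by (simp add: field_simps)
  then show ?thesis by simp
qed

text \<open>Choosing at each of the \<open>K\<close> steps either \<open>a\<close> or \<open>b\<close> carries a near-maximum
down to time \<open>0\<close>, and the order of the choices is irrelevant in a commutative group. The points
are written as iterated sums since the group need not have a scalar multiplication.\<close>

lemma step_mean_iter_near_max:
  assumes bd: "\<And>x i. \<bar>(step_mean p ^^ i) g x\<bar> \<le> s"
    and near: "(step_mean p ^^ K) g x \<ge> s - \<eta>" and K: "j \<le> K"
    and a: "a \<in> set_pmf p" and b: "b \<in> set_pmf p"
    and c: "c > 0" "c \<le> pmf p a" "c \<le> pmf p b"
  shows "g (x + (\<Sum>i<j. a) + (\<Sum>i<K - j. b)) \<ge> s - \<eta> / c ^ K"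
  using near K
proof (induction K arbitrary: x j \<eta>)
  case 0
  then show ?case by simp
next
  case (Suc K)
  have \<eta>: "\<eta> \<ge> 0" using Suc.prems(1) bd[of "Suc K" x] by auto
  have near': "(step_mean p ^^ K) g (x + e) \<ge> s - \<eta> / c" if "e \<in> set_pmf p" "c \<le> pmf p e" for e
  proof -
    have "(step_mean p ^^ K) g (x + e) \<ge> s - \<eta> / pmf p e"
      using step_mean_near_max[where g = "(step_mean p ^^ K) g" and s = s and p = p and x = x and \<eta> = \<eta> and a = e] bd Suc.prems that by auto
    moreover have "\<eta> / pmf p e \<le> \<eta> / c" using \<eta> c that by (auto intro!: divide_left_mono mult_pos_pos)
    ultimately show ?thesis by simp
  qed
  show ?case
  proof (cases j)
    case 0
    have "g ((x + b) + (\<Sum>i<0::nat. a) + (\<Sum>i<K - 0. b)) \<ge> s - (\<eta> / c) / c ^ K"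
      using b c near' by (intro Suc.IH) auto
    then show ?thesis using 0 by (simp add: algebra_simps)
  next
    case (Suc j')
    have "g ((x + a) + (\<Sum>i<j'. a) + (\<Sum>i<K - j'. b)) \<ge> s - (\<eta> / c) / c ^ K"
      using a c near' Suc Suc.prems by (intro Suc.IH) auto
    then show ?thesis using Suc by (simp add: algebra_simps)
  qed
qed

text \<open>The suprema \<open>S n\<close> of the increments decrease, since averaging does not increase the
supremum. If their infimum \<open>s\<close> were positive, then \<open>K + 1\<close> increments of size at least \<open>s / 2\<close> would
lie in a row on the path from \<open>x + (K + 1) b\<close> to \<open>x + (K + 1) a\<close>, and their sum would exceed the
oscillation \<open>2 C\<close> of the averaged function.\<close>

lemma step_mean_increment_tendsto_zero:
  fixes f :: "'a::ab_group_add \<Rightarrow> real"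
  assumes bd: "\<And>x. \<bar>f x\<bar> \<le> C" and a: "a \<in> set_pmf p" and b: "b \<in> set_pmf p" and "\<epsilon> > 0"
  shows "\<exists>N. \<forall>n\<ge>N. \<forall>x. \<bar>(step_mean p ^^ n) f (x + a) - (step_mean p ^^ n) f (x + b)\<bar> \<le> \<epsilon>"
proof -
  let ?A = "\<lambda>n. (step_mean p ^^ n) f"
  define h where "h = (\<lambda>x. f (x + a) - f (x + b))"
  define A where "A = (\<lambda>n. (step_mean p ^^ n) h)"
  have A_eq: "A n x = ?A n (x + a) - ?A n (x + b)" for n x
    unfolding A_def h_def using bd
    by (subst step_mean_iter_diff[of _ C _ C]) (auto simp: step_mean_iter_translate)
  have A_add: "A (i + n) = (step_mean p ^^ i) (A n)" for i n
    by (simp add: A_def funpow_add)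
  define S where "S = (\<lambda>n. SUP x. \<bar>A n x\<bar>)"
  have hb: "\<bar>h x\<bar> \<le> 2 * C" for x
    using bd[of "x + a"] bd[of "x + b"] by (auto simp: h_def)
  then have Ab: "\<bar>A n x\<bar> \<le> 2 * C" for n x unfolding A_def by (rule step_mean_iter_bounded)
  then have bdd: "bdd_above (range (\<lambda>x. \<bar>A n x\<bar>))" for n by (auto intro!: bdd_aboveI)
  have S_ge: "\<bar>A n x\<bar> \<le> S n" for n x unfolding S_def using bdd by (auto intro: cSUP_upper)
  have dec: "S (i + n) \<le> S n" for i n
  proof -
    have "S (i + n) = (SUP x. \<bar>A (i + n) x\<bar>)" by (simp add: S_def)
    also have "\<dots> \<le> S n"
      unfolding A_add by (rule cSUP_least) (auto intro!: step_mean_iter_bounded S_ge)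
    finally show ?thesis .
  qed
  have S0: "0 \<le> S n" for n using S_ge[of n 0] by auto
  define s where "s = Inf (range S)"
  have bddS: "bdd_below (range S)" using S0 by (auto intro!: bdd_belowI)
  have s_le: "s \<le> S n" for n unfolding s_def using bddS by (auto intro: cINF_lower)
  have "s \<le> 0"
  proof (rule ccontr)
    assume "\<not> s \<le> 0"
    then have s: "s > 0" by simp
    \<comment> \<open>\<open>Suc K\<close> increments of size \<open>s / 2\<close> exceed the largest possible total increment.\<close>
    obtain K :: nat where "2 * C < real K * (s / 2)"
      using reals_Archimedean3[of "s / 2"] s half_gt_zero by blast
    then have K: "real (Suc K) * (s / 2) > 2 * C" using s by (simp add: algebra_simps)
    define c where "c = min (pmf p a) (pmf p b)"
    have c: "c > 0" "c \<le> pmf p a" "c \<le> pmf p b" using a b by (auto simp: c_def pmf_positive)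
    \<comment> \<open>After \<open>K\<close> steps the defect \<open>2 * \<eta>\<close> is magnified to \<open>2 * \<eta> / c ^ K = s / 2\<close>.\<close>
    define \<eta> where "\<eta> = s / 4 * c ^ K"
    have \<eta>: "\<eta> > 0" using s c by (simp add: \<eta>_def)
    obtain n where n: "S n < s + \<eta>"
      using cInf_lessD[of "range S" "s + \<eta>"] \<eta> by (auto simp: s_def)
    have "s - \<eta> < S (K + n)" using s_le[of "K + n"] \<eta> by simp
    then obtain x where x: "s - \<eta> < \<bar>A (K + n) x\<bar>"
      unfolding S_def using less_cSUP_iff[OF _ bdd] by auto
    \<comment> \<open>The sign is normalised so that the near-extremal value is a near-maximum.\<close>
    define \<sigma> where "\<sigma> = sgn (A (K + n) x)"
    have "\<sigma> * A (K + n) x = \<bar>A (K + n) x\<bar>" by (simp add: \<sigma>_def sgn_if)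
    then have near: "(step_mean p ^^ K) (\<lambda>x. \<sigma> * A n x) x \<ge> S n - 2 * \<eta>"
      using x n by (simp add: step_mean_iter_cmult A_add)
    have \<sigma>1: "\<bar>\<sigma>\<bar> \<le> 1" by (simp add: \<sigma>_def sgn_if)
    have \<sigma>b: "\<bar>(step_mean p ^^ i) (\<lambda>x. \<sigma> * A n x) x\<bar> \<le> S n" for i x
    proof (rule step_mean_iter_bounded)
      show "\<bar>\<sigma> * A n x\<bar> \<le> S n" for x
        using mult_left_le_one_le[of "\<bar>A n x\<bar>" "\<bar>\<sigma>\<bar>"] \<sigma>1 S_ge[of n x] by (simp add: abs_mult)
    qed
    \<comment> \<open>Consecutive points differ by \<open>a - b\<close>, so the increments at the near-maxima telescope along \<open>z\<close>.\<close>
    define z where "z = (\<lambda>j. x + (\<Sum>i<j. a) + (\<Sum>i<Suc K - j. b))"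
    have incr: "\<sigma> * (?A n (z (Suc j)) - ?A n (z j)) \<ge> s / 2" if "j \<le> K" for j
    proof -
      have "\<sigma> * A n (x + (\<Sum>i<j. a) + (\<Sum>i<K - j. b)) \<ge> S n - 2 * \<eta> / c ^ K"
        using step_mean_iter_near_max[OF \<sigma>b near that a b c] by simp
      moreover have "S n - 2 * \<eta> / c ^ K \<ge> s / 2" using c s_le[of n] by (simp add: \<eta>_def field_simps)
      moreover have "x + (\<Sum>i<j. a) + (\<Sum>i<K - j. b) + a = z (Suc j)"
        by (simp add: z_def algebra_simps)
      moreover have "x + (\<Sum>i<j. a) + (\<Sum>i<K - j. b) + b = z j"
        using that by (simp add: z_def algebra_simps Suc_diff_le)
      ultimately show ?thesis using A_eq[of n "x + (\<Sum>i<j. a) + (\<Sum>i<K - j. b)"] by simp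
    qed
    have "real (Suc K) * (s / 2) = (\<Sum>j<Suc K. s / 2)" by simp
    also have "\<dots> \<le> (\<Sum>j<Suc K. \<sigma> * (?A n (z (Suc j)) - ?A n (z j)))"
      using incr by (intro sum_mono) auto
    also have "\<dots> = \<sigma> * (?A n (z (Suc K)) - ?A n (z 0))"
      unfolding sum_distrib_left[symmetric]
      by (subst sum_lessThan_telescope[where f = "\<lambda>j. ?A n (z j)"]) (rule refl)
    also have "\<dots> \<le> \<bar>\<sigma>\<bar> * \<bar>?A n (z (Suc K)) - ?A n (z 0)\<bar>"
      by (metis abs_ge_self abs_mult)
    also have "\<dots> \<le> 1 * (2 * C)"
      using \<sigma>1 step_mean_iter_bounded[of f C n p "z (Suc K)"] step_mean_iter_bounded[of f C n p "z 0"] bd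
      by (intro mult_mono) auto
    finally show False using K by simp
  qed
  then obtain N where N: "S N < \<epsilon>"
    using cInf_lessD[of "range S" \<epsilon>] \<open>\<epsilon> > 0\<close> by (auto simp: s_def)
  have "\<bar>A n x\<bar> \<le> \<epsilon>" if "n \<ge> N" for n x
    using S_ge[of n x] dec[of "n - N" N] N that by simp
  then show ?thesis using A_eq by auto
qed


section \<open>Box means and the uniform limit\<close>

lemma lattice_box_eq_translate: "lattice_box \<gamma> r = (\<lambda>v. \<gamma> + v) ` lattice_box 0 r"
proof -
  have "\<alpha> \<in> (\<lambda>v. \<gamma> + v) ` lattice_box 0 r" if "\<alpha> \<in> lattice_box \<gamma> r" for \<alpha>
    using that by (intro image_eqI[of _ _ "\<alpha> - \<gamma>"]) (auto simp: lattice_box_def algebra_simps)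
  moreover have "\<gamma> + v \<in> lattice_box \<gamma> r" if "v \<in> lattice_box 0 r" for v
    using that unfolding lattice_box_def by (simp add: minus_le_iff)
  ultimately show ?thesis by blast
qed

lemma lattice_box_eq_vec_lambda:
  "lattice_box \<gamma> r = vec_lambda ` (PiE UNIV (\<lambda>i. {\<gamma> $ i - int r..\<gamma> $ i + int r}))"
proof -
  have "\<alpha> \<in> vec_lambda ` (PiE UNIV (\<lambda>i. {\<gamma> $ i - int r..\<gamma> $ i + int r}))" if "\<alpha> \<in> lattice_box \<gamma> r" for \<alpha>
    using that by (intro image_eqI[of _ _ "vec_nth \<alpha>"]) (auto simp: lattice_box_def PiE_iff)
  then show ?thesis by (auto simp: lattice_box_def PiE_iff)
qed

lemma lattice_box_mono:
  assumes "m \<le> n" shows "lattice_box \<gamma> m \<subseteq> lattice_box \<gamma> n"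
proof
  fix v assume "v \<in> lattice_box \<gamma> m"
  then have v: "\<gamma> $ i - int m \<le> v $ i" "v $ i \<le> \<gamma> $ i + int m" for i
    by (auto simp only: lattice_box_def mem_Collect_eq)
  have "int m \<le> int n" using assms by simp
  then have "\<gamma> $ i - int n \<le> v $ i" "v $ i \<le> \<gamma> $ i + int n" for i
    using v[of i] by linarith+
  then show "v \<in> lattice_box \<gamma> n" by (simp only: lattice_box_def mem_Collect_eq simp_thms)
qed

lemma finite_lattice_box: "finite (lattice_box \<gamma> r)"
  unfolding lattice_box_eq_vec_lambda by (intro finite_imageI finite_PiE) auto

lemma card_lattice_box: "card (lattice_box (\<gamma> :: int ^ ('d::finite)) r) = (2 * r + 1) ^ CARD('d)"
proof -
  have "inj_on vec_lambda (PiE UNIV (\<lambda>i. {\<gamma> $ i - int r..\<gamma> $ i + int r}))"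
    by (auto intro!: inj_onI simp: vec_lambda_inject)
  then show ?thesis
    unfolding lattice_box_eq_vec_lambda
    by (simp add: card_image card_PiE nat_add_distrib nat_mult_distrib algebra_simps)
qed

lemma lattice_box_nonempty: "lattice_box \<gamma> r \<noteq> {}"
  by (auto simp: lattice_box_def intro!: exI[of _ \<gamma>])

definition box_mean :: "int ^ ('d::finite) \<Rightarrow> nat \<Rightarrow> (int ^ 'd \<Rightarrow> real) \<Rightarrow> real" where
  "box_mean \<gamma> r f = (\<Sum>\<alpha>\<in>lattice_box \<gamma> r. f \<alpha>) / real (card (lattice_box \<gamma> r))"

lemma box_mean_eq_translate: "box_mean \<gamma> r f = (\<Sum>v\<in>lattice_box 0 r. f (\<gamma> + v)) / real (card (lattice_box (0 :: int ^ ('d::finite)) r))"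
  for \<gamma> :: "int ^ 'd"
  unfolding box_mean_def card_lattice_box
  by (subst lattice_box_eq_translate) (simp add: sum.reindex)

text \<open>The translations for which the claim holds form a subgroup, and it contains every
difference \<open>c - a\<close> of two steps by the previous lemma.\<close>

lemma step_mean_translation_invariant:
  fixes f :: "int ^ ('d::finite) \<Rightarrow> real"
  assumes bd: "\<And>x. \<bar>f x\<bar> \<le> C" and a: "a \<in> set_pmf p"
    and span: "int_span {c - a | c. c \<in> set_pmf p} = UNIV" and "\<epsilon> > 0"
  shows "\<exists>N. \<forall>n\<ge>N. \<forall>x. \<bar>(step_mean p ^^ n) f (x + v) - (step_mean p ^^ n) f x\<bar> \<le> \<epsilon>"
proof -
  let ?A = "\<lambda>n. (step_mean p ^^ n) f"
  define H where "H = {v. \<forall>\<epsilon>>0. \<exists>N. \<forall>n\<ge>N. \<forall>x. \<bar>?A n (x + v) - ?A n x\<bar> \<le> \<epsilon>}"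
  have zero: "0 \<in> H" by (auto simp: H_def)
  have add: "u + v \<in> H" if u: "u \<in> H" and v: "v \<in> H" for u v
    unfolding H_def
  proof safe
    fix \<epsilon> :: real assume "\<epsilon> > 0"
    then have half: "\<epsilon> / 2 > 0" by simp
    obtain N where N: "\<And>n x. n \<ge> N \<Longrightarrow> \<bar>?A n (x + u) - ?A n x\<bar> \<le> \<epsilon> / 2"
      using u half unfolding H_def by blast
    obtain M where M: "\<And>n x. n \<ge> M \<Longrightarrow> \<bar>?A n (x + v) - ?A n x\<bar> \<le> \<epsilon> / 2"
      using v half unfolding H_def by blast
    show "\<exists>N. \<forall>n\<ge>N. \<forall>x. \<bar>?A n (x + (u + v)) - ?A n x\<bar> \<le> \<epsilon>"
    proof (intro exI[of _ "max N M"] allI impI)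
      fix n x assume "max N M \<le> n"
      then show "\<bar>?A n (x + (u + v)) - ?A n x\<bar> \<le> \<epsilon>"
        using N[of n x] M[of n "x + u"] unfolding add.assoc max.bounded_iff by linarith
    qed
  qed
  have neg: "- v \<in> H" if v: "v \<in> H" for v
    unfolding H_def
  proof safe
    fix \<epsilon> :: real assume "\<epsilon> > 0"
    then obtain N where N: "\<And>n x. n \<ge> N \<Longrightarrow> \<bar>?A n (x + v) - ?A n x\<bar> \<le> \<epsilon>"
      using v unfolding H_def by blast
    show "\<exists>N. \<forall>n\<ge>N. \<forall>x. \<bar>?A n (x + (- v)) - ?A n x\<bar> \<le> \<epsilon>"
    proof (intro exI[of _ N] allI impI)
      fix n x assume "N \<le> n"
      then show "\<bar>?A n (x + (- v)) - ?A n x\<bar> \<le> \<epsilon>"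
        using N[of n "x - v"] by (simp add: abs_minus_commute)
    qed
  qed
  have nat_mult: "int k *s v \<in> H" if "v \<in> H" for k v
  proof (induction k)
    case (Suc k)
    have "int (Suc k) *s v = v + int k *s v" by (simp add: vec_eq_iff algebra_simps)
    then show ?case using add[OF that Suc] by simp
  qed (simp add: zero)
  have mult: "k *s v \<in> H" if "v \<in> H" for k :: int and v
  proof (cases k)
    case (neg n)
    have "k *s v = - (int (Suc n) *s v)" using neg by (simp add: vec_eq_iff)
    then show ?thesis using nat_mult[OF that, of "Suc n"] neg \<open>\<And>v. v \<in> H \<Longrightarrow> - v \<in> H\<close> by metis
  qed (use nat_mult that in auto)
  have sub: "module.subspace (*s) H"
    using zero add mult by (simp add: module.subspace_def[OF module_int_vec])
  have "{c - a | c. c \<in> set_pmf p} \<subseteq> H"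
  proof safe
    fix c assume c: "c \<in> set_pmf p"
    show "c - a \<in> H"
      unfolding H_def
    proof safe
      fix \<epsilon> :: real assume "\<epsilon> > 0"
      then obtain N where N: "\<And>n x. n \<ge> N \<Longrightarrow> \<bar>?A n (x + c) - ?A n (x + a)\<bar> \<le> \<epsilon>"
        using step_mean_increment_tendsto_zero[of f C c p a, OF bd c a] by blast
      show "\<exists>N. \<forall>n\<ge>N. \<forall>x. \<bar>?A n (x + (c - a)) - ?A n x\<bar> \<le> \<epsilon>"
      proof (intro exI[of _ N] allI impI)
        fix n x assume "N \<le> n"
        then show "\<bar>?A n (x + (c - a)) - ?A n x\<bar> \<le> \<epsilon>"
          using N[of n "x - a"] by (simp add: algebra_simps)
      qed
    qed
  qed
  then have "int_span {c - a | c. c \<in> set_pmf p} \<subseteq> H"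
    unfolding int_span_def by (rule module.span_minimal[OF module_int_vec _ sub])
  then show ?thesis using span \<open>\<epsilon> > 0\<close> unfolding H_def by auto
qed

text \<open>By asymptotic translation invariance, the iterate at \<open>x\<close> is close to the mean of its
values over a box around \<open>x\<close>. Averaging over a box commutes with the step operator, so this mean is
an iterate of the box means of \<open>f\<close>, which are uniformly close to \<open>L\<close>.\<close>

lemma step_mean_iter_uniform_limit:
  fixes f :: "int ^ ('d::finite) \<Rightarrow> real"
  assumes bd: "\<And>x. \<bar>f x\<bar> \<le> C" and a: "a \<in> set_pmf p"
    and span: "int_span {c - a | c. c \<in> set_pmf p} = UNIV"
    and mean: "\<And>\<epsilon>. \<epsilon> > 0 \<Longrightarrow> \<exists>r. \<forall>\<gamma>. \<bar>box_mean \<gamma> r f - L\<bar> \<le> \<epsilon>"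
    and "\<epsilon> > 0"
  shows "\<exists>N. \<forall>n\<ge>N. \<forall>x. \<bar>(step_mean p ^^ n) f x - L\<bar> \<le> \<epsilon>"
proof -
  let ?A = "\<lambda>n. (step_mean p ^^ n) f"
  obtain r where r: "\<And>\<gamma>. \<bar>box_mean \<gamma> r f - L\<bar> \<le> \<epsilon> / 2"
    using mean[of "\<epsilon> / 2"] \<open>\<epsilon> > 0\<close> by auto
  define B where "B = (lattice_box 0 r :: (int ^ 'd) set)"
  have B: "finite B" "B \<noteq> {}" "card B > 0"
    by (auto simp: B_def finite_lattice_box lattice_box_nonempty card_gt_0_iff)
  have "\<forall>v. \<exists>N. \<forall>n\<ge>N. \<forall>x. \<bar>?A n (x + v) - ?A n x\<bar> \<le> \<epsilon> / 2"
    using step_mean_translation_invariant[OF bd a span, of "\<epsilon> / 2"] \<open>\<epsilon> > 0\<close> by simp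
  then obtain N where N: "\<And>v n x. n \<ge> N v \<Longrightarrow> \<bar>?A n (x + v) - ?A n x\<bar> \<le> \<epsilon> / 2"
    by metis
  have "\<bar>?A n x - L\<bar> \<le> \<epsilon>" if n: "n \<ge> Max (N ` B)" for n x
  proof -
    define u where "u = (\<lambda>x. 1 / real (card B) * (\<Sum>v\<in>B. f (x + v)))"
    have u_eq: "u y = box_mean y r f" for y
      by (simp add: u_def box_mean_eq_translate B_def)
    have ub: "\<bar>u y - L\<bar> \<le> \<epsilon> / 2" for y unfolding u_eq by (rule r)
    have uC: "\<bar>u y\<bar> \<le> \<epsilon> / 2 + \<bar>L\<bar>" for y using ub[of y] by linarith
    have "(step_mean p ^^ n) u x - L = (step_mean p ^^ n) (\<lambda>x. u x - L) x"
      using step_mean_iter_diff[where f = u and g = "\<lambda>_. L" and D = "\<bar>L\<bar>", OF uC] by (simp add: step_mean_iter_const)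
    then have 1: "\<bar>(step_mean p ^^ n) u x - L\<bar> \<le> \<epsilon> / 2"
      using step_mean_iter_bounded[of "\<lambda>x. u x - L", OF ub] by simp
    have "(step_mean p ^^ n) u x = 1 / real (card B) * (\<Sum>v\<in>B. ?A n (x + v))"
      unfolding u_def step_mean_iter_cmult using bd
      by (subst step_mean_iter_sum[of B _ C]) (auto simp: step_mean_iter_translate)
    then have "(step_mean p ^^ n) u x - ?A n x
        = 1 / real (card B) * (\<Sum>v\<in>B. ?A n (x + v) - ?A n x)"
      using B by (simp add: sum_subtractf field_simps)
    then have "\<bar>(step_mean p ^^ n) u x - ?A n x\<bar>
        = 1 / real (card B) * \<bar>\<Sum>v\<in>B. ?A n (x + v) - ?A n x\<bar>"
      by (simp add: abs_mult)
    also have "\<dots> \<le> 1 / real (card B) * (\<Sum>v\<in>B. \<epsilon> / 2)"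
    proof (intro mult_left_mono order.trans[OF sum_abs] sum_mono)
      fix v assume "v \<in> B"
      then have "N v \<le> Max (N ` B)" using B(1) by (intro Max_ge) auto
      with n have "N v \<le> n" by (rule order.trans[rotated])
      then show "\<bar>?A n (x + v) - ?A n x\<bar> \<le> \<epsilon> / 2" by (rule N)
    qed simp
    also have "\<dots> = \<epsilon> / 2" using B by simp
    finally show ?thesis using 1 by linarith
  qed
  then show ?thesis by blast
qed

section \<open>The inverse branches of the expanding interval map\<close>

abbreviation unit_interval :: "real measure" where
  "unit_interval \<equiv> restrict_space lborel {0..<1}"

lemma prob_space_unit_interval: "prob_space unit_interval"
  by (rule prob_spaceI) (simp add: space_restrict_space emeasure_restrict_space)

interpretation unit_interval: prob_space unit_interval
  by (rule prob_space_unit_interval)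

lemma space_unit_interval [simp]: "space unit_interval = {0..<1}"
  by (simp add: space_restrict_space)

lemma measurable_unit_interval_borel [measurable]: "(\<lambda>x. x) \<in> borel_measurable unit_interval"
  by (rule measurable_restrict_space1) simp

text \<open>The coordinate \<open>y\<^sub>1\<close> evolves under an expanding interval map whose \<open>k\<close>-th branch maps
\<open>[q (k - 1), q k)\<close> affinely onto \<open>[0, 1)\<close>; below, \<open>expand\<close> is this map and \<open>branch k\<close> is the inverse of
its \<open>k\<close>-th branch.\<close>

locale rw_data =
  fixes p :: "(int ^ ('d::finite)) pmf" and b :: "nat \<Rightarrow> int ^ 'd"
  assumes enum: "bij_betw b (index_set p) (set_pmf p)"
begin

abbreviation q :: "nat \<Rightarrow> real" where "q \<equiv> cum_prob p b"
abbreviation w :: "nat \<Rightarrow> real" where "w k \<equiv> pmf p (b k)"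

text \<open>The distribution of the steps, transported to the indices; unlike \<open>w\<close> it is a probability
distribution on all of \<open>nat\<close>, with value \<open>0\<close> off \<open>index_set p\<close>.\<close>

definition index_pmf :: "nat pmf" where
  "index_pmf = map_pmf (inv_into (index_set p) b) p"

lemma inj_on_b: "inj_on b (index_set p)" using enum by (simp add: bij_betw_def)

lemma b_image: "b ` index_set p = set_pmf p" using enum by (simp add: bij_betw_def)

lemma set_index_pmf: "set_pmf index_pmf = index_set p"
  using bij_betw_imp_surj_on[OF bij_betw_inv_into[OF enum]] by (simp add: index_pmf_def)

lemma map_index_pmf: "map_pmf b index_pmf = p"
proof -
  have "map_pmf b index_pmf = map_pmf (\<lambda>x. x) p"
    unfolding index_pmf_def map_pmf_comp
    using b_image by (intro map_pmf_cong) (auto simp: f_inv_into_f)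
  then show ?thesis by simp
qed

lemma pmf_index: assumes "k \<in> index_set p" shows "pmf index_pmf k = w k"
proof -
  have "pmf p (b k) = measure (measure_pmf index_pmf) (b -` {b k})"
    by (subst map_index_pmf[symmetric]) (rule pmf_map)
  also have "\<dots> = measure (measure_pmf index_pmf) {k}"
    using assms inj_on_b by (intro measure_pmf.finite_measure_eq_AE) (auto simp: AE_measure_pmf_iff set_index_pmf inj_on_def)
  finally show ?thesis by (simp add: measure_pmf_single)
qed

lemma w_pos: "k \<in> index_set p \<Longrightarrow> w k > 0"
  using b_image by (metis imageI pmf_positive)

lemma index_set_initial: "k \<in> index_set p \<Longrightarrow> 1 \<le> j \<Longrightarrow> j \<le> k \<Longrightarrow> j \<in> index_set p"
  by (auto simp: index_set_def split: if_splits)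

lemma index_ge_1: "k \<in> index_set p \<Longrightarrow> 1 \<le> k"
  by (auto simp: index_set_def split: if_splits)

lemma q_step: assumes "k \<in> index_set p" shows "q k = q (k - 1) + w k"
  using index_ge_1[OF assms] by (cases k) (auto simp: cum_prob_def)

lemma q_mono: "j \<le> k \<Longrightarrow> q j \<le> q k"
  unfolding cum_prob_def by (rule sum_mono2) auto

lemma q_nonneg: "0 \<le> q k" unfolding cum_prob_def by (rule sum_nonneg) simp

lemma q_eq_prob: assumes "k \<in> index_set p" "j \<le> k"
  shows "q j = measure (measure_pmf index_pmf) {1..j}"
  using assms index_set_initial[OF assms(1)]
  by (auto simp: cum_prob_def measure_measure_pmf_finite pmf_index intro!: sum.cong)

lemma q_le_1: "k \<in> index_set p \<Longrightarrow> q k \<le> 1"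
  by (simp add: q_eq_prob measure_pmf.prob_le_1)

lemma slot_unique:
  assumes "k \<in> index_set p" "q (k - 1) \<le> y" "y < q k" "j \<in> index_set p" "q (j - 1) \<le> y" "y < q j"
  shows "j = k"
proof (rule ccontr)
  assume "j \<noteq> k"
  then have "j \<le> k - 1 \<or> k \<le> j - 1" by auto
  then show False using q_mono assms by (metis leD order.trans)
qed

lemma slot_eqI: "k \<in> index_set p \<Longrightarrow> q (k - 1) \<le> y \<Longrightarrow> y < q k \<Longrightarrow> slot p b y = k"
  unfolding slot_def using slot_unique by (intro the_equality) auto

text \<open>The partial sums of the weights increase to \<open>1\<close>, so some of them exceed \<open>y\<close>. At the first
one that does, the weight is positive, which places that index in \<open>index_set p\<close>.\<close>

lemma slot_exists:
  assumes "0 \<le> y" "y < 1"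
  shows "\<exists>k \<in> index_set p. q (k - 1) \<le> y \<and> y < q k"
proof -
  define Q where "Q = (\<lambda>n. measure (measure_pmf index_pmf) {1..n})"
  have "Q \<longlonglongrightarrow> measure (measure_pmf index_pmf) (\<Union>n. {1..n})"
    unfolding Q_def by (intro measure_pmf.finite_Lim_measure_incseq) (auto simp: incseq_def)
  also have "measure (measure_pmf index_pmf) (\<Union>n. {1..n}) = 1"
    using index_ge_1 by (intro measure_pmf.prob_eq_1[THEN iffD2]) (auto simp: AE_measure_pmf_iff set_index_pmf)
  finally have "\<forall>\<^sub>F n in sequentially. y < Q n" using assms by (intro order_tendstoD)
  then have ex: "\<exists>n. y < Q n" by (auto simp: eventually_sequentially)
  define k where "k = (LEAST n. y < Q n)"
  have k: "y < Q k" unfolding k_def by (rule LeastI_ex[OF ex])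
  have "k \<noteq> 0" using k assms by (intro notI) (simp add: Q_def)
  then have "k - 1 < k" by simp
  then have k1: "Q (k - 1) \<le> y" unfolding k_def using not_less_Least leI by blast
  have "{1..k} = insert k {1..k - 1}" using \<open>k \<noteq> 0\<close> by auto
  then have "Q k \<le> Q (k - 1) + pmf index_pmf k"
    unfolding Q_def using \<open>k \<noteq> 0\<close> by (simp add: measure_measure_pmf_finite)
  then have "pmf index_pmf k > 0" using k k1 by simp
  then have "k \<in> index_set p" by (simp add: set_index_pmf[symmetric] pmf_positive_iff)
  then show ?thesis using k k1 q_eq_prob[of k k] q_eq_prob[of k "k - 1"] by (intro bexI[of _ k]) (auto simp: Q_def)
qed

lemma slot_props:
  assumes "0 \<le> y" "y < 1"
  shows "slot p b y \<in> index_set p" "q (slot p b y - 1) \<le> y" "y < q (slot p b y)"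
  using slot_exists[OF assms] slot_eqI by auto

definition branch :: "nat \<Rightarrow> real \<Rightarrow> real" where
  "branch k u = w k * u + q (k - 1)"

definition expand :: "real \<Rightarrow> real" where
  "expand y = inverse (w (slot p b y)) * (y - q (slot p b y - 1))"

lemma branch_bounds:
  assumes "k \<in> index_set p" "0 \<le> u" "u < 1"
  shows "q (k - 1) \<le> branch k u" "branch k u < q k"
  using assms w_pos[of k] by (auto simp: branch_def q_step)

lemma branch_in_unit:
  assumes "k \<in> index_set p" "0 \<le> u" "u < 1"
  shows "0 \<le> branch k u" "branch k u < 1"
  using branch_bounds[OF assms] q_nonneg[of "k - 1"] q_le_1[OF assms(1)] by linarith+

lemma slot_branch: "k \<in> index_set p \<Longrightarrow> 0 \<le> u \<Longrightarrow> u < 1 \<Longrightarrow> slot p b (branch k u) = k"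
  by (intro slot_eqI branch_bounds)

lemma expand_branch: "k \<in> index_set p \<Longrightarrow> 0 \<le> u \<Longrightarrow> u < 1 \<Longrightarrow> expand (branch k u) = u"
  using w_pos[of k] by (simp add: expand_def slot_branch) (simp add: branch_def)

lemma branch_expand: "0 \<le> y \<Longrightarrow> y < 1 \<Longrightarrow> branch (slot p b y) (expand y) = y"
  using w_pos[OF slot_props(1)[of y]] by (simp add: branch_def expand_def field_simps)

lemma expand_in_unit:
  assumes "0 \<le> y" "y < 1" shows "0 \<le> expand y" "expand y < 1"
  using slot_props[OF assms] w_pos[OF slot_props(1)[OF assms]]
  by (auto simp: expand_def q_step field_simps)

lemma measurable_slot [measurable]: "slot p b \<in> unit_interval \<rightarrow>\<^sub>M count_space UNIV"
proof (rule measurable_count_space_eq2_countable[THEN iffD2])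
  show "slot p b \<in> space unit_interval \<rightarrow> UNIV \<and> (\<forall>k\<in>UNIV. slot p b -` {k} \<inter> space unit_interval \<in> sets unit_interval)"
  proof safe
    fix k
    have "slot p b -` {k} \<inter> space unit_interval = (if k \<in> index_set p then {q (k - 1)..<q k} \<inter> {0..<1} else {})"
    proof (cases "k \<in> index_set p")
      case True
      have iff: "slot p b y = k \<longleftrightarrow> q (k - 1) \<le> y \<and> y < q k" if "0 \<le> y" "y < 1" for y
        using slot_props[OF that] slot_eqI[OF True] by blast
      have "y \<in> slot p b -` {k} \<inter> space unit_interval \<longleftrightarrow> y \<in> {q (k - 1)..<q k} \<inter> {0..<1}" for y
        using iff[of y] by (cases "0 \<le> y \<and> y < 1") auto
      then have "slot p b -` {k} \<inter> space unit_interval = {q (k - 1)..<q k} \<inter> {0..<1}"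
        by (rule set_eqI)
      then show ?thesis using True by (simp only: if_True)
    next
      case False
      have "y \<notin> slot p b -` {k} \<inter> space unit_interval" for y
        using slot_props(1)[of y] False by (cases "0 \<le> y \<and> y < 1") auto
      then show ?thesis using False by (simp only: if_False) blast
    qed
    also have "\<dots> \<in> sets unit_interval" by (auto simp: sets_restrict_space)
    finally show "slot p b -` {k} \<inter> space unit_interval \<in> sets unit_interval" .
  qed simp
qed

lemma measurable_expand [measurable]: "expand \<in> unit_interval \<rightarrow>\<^sub>M unit_interval"
proof (rule measurable_restrict_space2)
  have "expand \<in> borel_measurable unit_interval"
    unfolding expand_def by (rule measurable_compose_countable[OF _ measurable_slot]) measurable
  then show "expand \<in> unit_interval \<rightarrow>\<^sub>M lborel" by simp
qed (auto simp: expand_in_unit)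

lemma measurable_branch: "k \<in> index_set p \<Longrightarrow> branch k \<in> unit_interval \<rightarrow>\<^sub>M unit_interval"
proof (rule measurable_restrict_space2)
  have "branch k \<in> borel_measurable unit_interval"
    unfolding branch_def by measurable
  then show "branch k \<in> unit_interval \<rightarrow>\<^sub>M lborel" by simp
qed (auto simp: branch_in_unit)

text \<open>Lebesgue measure on the unit interval is self-similar: choosing a branch according to its
weight and then a uniform point of the branch gives a uniform point.\<close>

lemma nn_integral_branch:
  assumes f: "f \<in> borel_measurable unit_interval"
  shows "(\<integral>\<^sup>+k. (\<integral>\<^sup>+u. f (branch k u) \<partial>unit_interval) \<partial>measure_pmf index_pmf) = (\<integral>\<^sup>+y. f y \<partial>unit_interval)"
proof -
  define g where "g = (\<lambda>y. f y * indicator {0..<1} y)"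
  have [measurable]: "g \<in> borel_measurable borel"
    using f unfolding g_def by (subst (asm) borel_measurable_restrict_space_iff_ennreal) auto
  define J where "J = (\<lambda>k. if k \<in> index_set p then {q (k - 1)..<q k} else {})"
  have [measurable]: "J k \<in> sets borel" for k by (simp add: J_def)
  have J01: "J k \<subseteq> {0..<1}" for k
    using q_nonneg[of "k - 1"] q_le_1[of k] by (auto simp: J_def)
  have disj: "disjoint_family J"
  proof -
    have "m = n" if "y \<in> J m" "y \<in> J n" for m n y
      using that slot_unique[of n y m] by (auto simp: J_def split: if_splits)
    then show ?thesis unfolding disjoint_family_on_def by blast
  qed
  have branch_int: "ennreal (pmf index_pmf k) * (\<integral>\<^sup>+u. f (branch k u) \<partial>unit_interval) = (\<integral>\<^sup>+y. g y * indicator (J k) y \<partial>lborel)" for k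
  proof (cases "k \<in> index_set p")
    case True
    have "(\<integral>\<^sup>+y. g y * indicator (J k) y \<partial>lborel) = \<bar>w k\<bar> * (\<integral>\<^sup>+u. g (q (k - 1) + w k * u) * indicator (J k) (q (k - 1) + w k * u) \<partial>lborel)"
      using w_pos[OF True] by (intro nn_integral_real_affine) auto
    also have "(\<lambda>u. g (q (k - 1) + w k * u) * indicator (J k) (q (k - 1) + w k * u)) = (\<lambda>u. f (branch k u) * indicator {0..<1} u)"
    proof
      fix u
      have "q (k - 1) + w k * u \<in> J k \<longleftrightarrow> u \<in> {0..<1}"
        using w_pos[OF True] True by (auto simp: J_def q_step zero_le_mult_iff)
      then show "g (q (k - 1) + w k * u) * indicator (J k) (q (k - 1) + w k * u) = f (branch k u) * indicator {0..<1} u"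
        using J01[of k] by (auto simp: indicator_def g_def branch_def add.commute)
    qed
    finally show ?thesis
      using True w_pos[OF True] by (simp add: pmf_index nn_integral_restrict_space)
  next
    case False
    then show ?thesis by (simp add: J_def set_pmf_iff set_index_pmf[symmetric])
  qed
  have "(\<integral>\<^sup>+k. (\<integral>\<^sup>+u. f (branch k u) \<partial>unit_interval) \<partial>measure_pmf index_pmf) = (\<Sum>k. \<integral>\<^sup>+y. g y * indicator (J k) y \<partial>lborel)"
    by (simp add: nn_integral_measure_pmf branch_int nn_integral_count_space_nat)
  also have "\<dots> = (\<integral>\<^sup>+y. (\<Sum>k. g y * indicator (J k) y) \<partial>lborel)"
    by (intro nn_integral_suminf[symmetric]) auto
  also have "\<dots> = (\<integral>\<^sup>+y. g y \<partial>lborel)"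
  proof (intro nn_integral_cong)
    fix y
    show "(\<Sum>k. g y * indicator (J k) y) = g y"
    proof (cases "y \<in> {0..<1}")
      case True
      then have "y \<in> J (slot p b y)" using slot_props[of y] by (simp add: J_def)
      then show ?thesis using suminf_cmult_indicator[OF disj, of y _ "\<lambda>_. g y"] by simp
    next
      case False
      then show ?thesis by (simp add: g_def)
    qed
  qed
  also have "\<dots> = (\<integral>\<^sup>+y. f y \<partial>unit_interval)"
    by (simp add: g_def nn_integral_restrict_space)
  finally show ?thesis .
qed

text \<open>The real-valued form follows from the nonnegative one after adding the constant \<open>C\<close>.\<close>

lemma integral_branch:
  fixes f :: "real \<Rightarrow> real"
  assumes f: "f \<in> borel_measurable unit_interval" and bd: "\<And>y. y \<in> {0..<1} \<Longrightarrow> \<bar>f y\<bar> \<le> C"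
  shows "(\<integral>y. f y \<partial>unit_interval) = (\<integral>k. (\<integral>u. f (branch k u) \<partial>unit_interval) \<partial>measure_pmf index_pmf)"
proof -
  define g where "g = (\<lambda>y. f y + C)"
  have C: "0 \<le> C" using bd[of 0] by auto
  have g[measurable]: "g \<in> borel_measurable unit_interval" using f by (simp add: g_def)
  have g0: "0 \<le> g y" "\<bar>g y\<bar> \<le> 2 * C" if "y \<in> {0..<1}" for y using bd[OF that] by (auto simp: g_def)
  have br: "AE k in measure_pmf index_pmf. branch k \<in> unit_interval \<rightarrow>\<^sub>M unit_interval"
    by (auto simp: AE_measure_pmf_iff set_index_pmf measurable_branch)
  have ik: "integrable unit_interval (\<lambda>u. h (branch k u))" 
    if "k \<in> index_set p" and h: "h \<in> borel_measurable unit_interval" "\<And>y. y \<in> {0..<1} \<Longrightarrow> \<bar>h y\<bar> \<le> D" for k D and h :: "real \<Rightarrow> real"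
    using that by (intro unit_interval.integrable_const_bound[where B = D])
      (auto simp: branch_in_unit intro!: measurable_compose[OF measurable_branch h(1)])
  have "(\<integral>y. g y \<partial>unit_interval) = enn2real (\<integral>\<^sup>+y. ennreal (g y) \<partial>unit_interval)"
    using g0 by (intro integral_eq_nn_integral) auto
  also have "\<dots> = enn2real (\<integral>\<^sup>+k. (\<integral>\<^sup>+u. ennreal (g (branch k u)) \<partial>unit_interval) \<partial>measure_pmf index_pmf)"
    by (subst nn_integral_branch) auto
  also have "(\<integral>\<^sup>+k. (\<integral>\<^sup>+u. ennreal (g (branch k u)) \<partial>unit_interval) \<partial>measure_pmf index_pmf)
      = (\<integral>\<^sup>+k. ennreal (\<integral>u. g (branch k u) \<partial>unit_interval) \<partial>measure_pmf index_pmf)"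
    using ik[OF _ g g0(2)] g0(1)
    by (intro nn_integral_cong_AE) (auto simp: AE_measure_pmf_iff set_index_pmf branch_in_unit intro!: nn_integral_eq_integral AE_I2)
  also have "enn2real \<dots> = (\<integral>k. (\<integral>u. g (branch k u) \<partial>unit_interval) \<partial>measure_pmf index_pmf)"
    using g0(1) by (intro integral_eq_nn_integral[symmetric])
      (auto simp: AE_measure_pmf_iff set_index_pmf branch_in_unit intro!: integral_nonneg_AE AE_I2)
  also have "\<dots> = (\<integral>k. (\<integral>u. f (branch k u) \<partial>unit_interval) + C \<partial>measure_pmf index_pmf)"
    using ik[OF _ f bd] 
    by (intro integral_cong_AE) (auto simp: AE_measure_pmf_iff set_index_pmf g_def unit_interval.prob_space[simplified])
  also have "\<dots> = (\<integral>k. (\<integral>u. f (branch k u) \<partial>unit_interval) \<partial>measure_pmf index_pmf) + C"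
  proof (subst Bochner_Integration.integral_add)
    show "integrable (measure_pmf index_pmf) (\<lambda>k. \<integral>u. f (branch k u) \<partial>unit_interval)"
    proof (rule measure_pmf.integrable_const_bound[where B = C])
      show "AE k in measure_pmf index_pmf. norm (\<integral>u. f (branch k u) \<partial>unit_interval) \<le> C"
        unfolding AE_measure_pmf_iff set_index_pmf
      proof
        fix k assume k: "k \<in> index_set p"
        have "\<bar>\<integral>u. f (branch k u) \<partial>unit_interval\<bar> \<le> (\<integral>u. \<bar>f (branch k u)\<bar> \<partial>unit_interval)"
          by (rule integral_abs_bound)
        also have "\<dots> \<le> C"
          using ik[OF k f bd] bd branch_in_unit[OF k] by (intro unit_interval.integral_le_const) (auto intro!: AE_I2)
        finally show "norm (\<integral>u. f (branch k u) \<partial>unit_interval) \<le> C" by simp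
      qed
    qed simp
  qed auto
  finally have "(\<integral>y. g y \<partial>unit_interval) = (\<integral>k. (\<integral>u. f (branch k u) \<partial>unit_interval) \<partial>measure_pmf index_pmf) + C" .
  moreover have "(\<integral>y. g y \<partial>unit_interval) = (\<integral>y. f y \<partial>unit_interval) + C"
    unfolding g_def using f bd
    by (subst Bochner_Integration.integral_add)
      (auto intro!: unit_interval.integrable_const_bound[where B = C] AE_I2 simp: unit_interval.prob_space[simplified])
  ultimately show ?thesis by simp
qed

end

section \<open>The phase space as a completed product measure\<close>

text \<open>Borel sets suffice for cylinder functions, and for them Fubini's theorem holds without exceptional
sets; the measure of the phase space is the completion of this one.\<close>

definition borel_phase :: "('d::finite) phase measure" where
  "borel_phase = count_space UNIV \<Otimes>\<^sub>M (unit_interval \<Otimes>\<^sub>M unit_interval)"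

text \<open>Relates iterated one-dimensional integrals to planar Lebesgue measure.\<close>

lemma unit_interval_pair: "unit_interval \<Otimes>\<^sub>M unit_interval = restrict_space lborel unit_square"
proof (rule pair_measure_eqI)
  have us: "unit_square \<in> sets borel" unfolding unit_square_def by (simp add: borel_Times)
  show "sets (unit_interval \<Otimes>\<^sub>M unit_interval) = sets (restrict_space lborel unit_square)"
  proof (intro equalityI subsetI)
    fix S assume "S \<in> sets (restrict_space lborel unit_square)"
    then obtain S' where "S' \<in> sets (lborel :: (real \<times> real) measure)" "S = unit_square \<inter> S'"
      by (auto simp: sets_restrict_space)
    then have S': "S' \<in> sets (lborel \<Otimes>\<^sub>M lborel)" "S = unit_square \<inter> S'"
      by (simp_all only: lborel_prod)
    have "(\<lambda>x. (fst x, snd x)) \<in> unit_interval \<Otimes>\<^sub>M unit_interval \<rightarrow>\<^sub>M lborel \<Otimes>\<^sub>M lborel"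
      by (intro measurable_Pair measurable_compose[OF measurable_fst] measurable_compose[OF measurable_snd]) simp_all
    from measurable_sets[OF this S'(1)] show "S \<in> sets (unit_interval \<Otimes>\<^sub>M unit_interval)"
      using S'(2) by (simp add: space_pair_measure unit_square_def Int_commute)
  next
    have "sets (unit_interval \<Otimes>\<^sub>M unit_interval) \<subseteq> sets (restrict_space lborel unit_square)"
      unfolding sets_pair_measure
    proof -
      have sp: "space unit_interval \<times> space unit_interval = space (restrict_space lborel unit_square)"
        by (simp add: space_restrict_space unit_square_def)
      show "sigma_sets (space unit_interval \<times> space unit_interval) {A \<times> B |A B. A \<in> sets unit_interval \<and> B \<in> sets unit_interval}
          \<subseteq> sets (restrict_space lborel unit_square)"
        unfolding sp by (rule sets.sigma_sets_subset)
          (use us in \<open>auto simp: sets_restrict_space_iff unit_square_def intro!: borel_Times\<close>)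
    qed
    then show "S \<in> sets (unit_interval \<Otimes>\<^sub>M unit_interval) \<Longrightarrow> S \<in> sets (restrict_space lborel unit_square)" for S
      by blast
  qed
  fix A B assume "A \<in> sets unit_interval" "B \<in> sets unit_interval"
  then have AB: "A \<in> sets borel" "B \<in> sets borel" "A \<subseteq> {0..<1}" "B \<subseteq> {0..<1}"
    by (auto simp: sets_restrict_space_iff)
  then have "emeasure (restrict_space lborel unit_square) (A \<times> B) = emeasure (lborel \<Otimes>\<^sub>M lborel) (A \<times> B)"
    using us by (subst emeasure_restrict_space) (auto simp: lborel_prod unit_square_def)
  also have "\<dots> = emeasure lborel A * emeasure lborel B"
    using AB by (intro lborel.emeasure_pair_measure_Times) auto
  finally show "emeasure unit_interval A * emeasure unit_interval B = emeasure (restrict_space lborel unit_square) (A \<times> B)"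
    using AB by (simp add: emeasure_restrict_space)
qed unfold_locales


lemma sigma_finite_count_lattice: "sigma_finite_measure (count_space (UNIV :: (int ^ ('d::finite)) set))"
  by (rule sigma_finite_measure_count_space_countable) simp

interpretation lattice: sigma_finite_measure "count_space (UNIV :: (int ^ ('d::finite)) set)"
  by (rule sigma_finite_count_lattice)

interpretation unit_square: pair_prob_space unit_interval unit_interval ..

lemma space_borel_phase [simp]: "space borel_phase = rw_space"
  by (auto simp: borel_phase_def space_pair_measure rw_space_def unit_square_def)

lemma in_rw_space: "(\<alpha>, y1, y2) \<in> rw_space \<longleftrightarrow> 0 \<le> y1 \<and> y1 < 1 \<and> 0 \<le> y2 \<and> y2 < 1"
  by (auto simp: rw_space_def unit_square_def)

interpretation borel_phase: pair_sigma_finite "count_space (UNIV :: (int ^ ('d::finite)) set)"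
  "unit_interval \<Otimes>\<^sub>M unit_interval" ..

lemma sets_count_space_pair_iff:
  fixes S :: "('a::countable \<times> 'b) set"
  shows "S \<in> sets (count_space UNIV \<Otimes>\<^sub>M M) \<longleftrightarrow> (\<forall>\<alpha>. Pair \<alpha> -` S \<in> sets M)"
proof
  assume *: "\<forall>\<alpha>. Pair \<alpha> -` S \<in> sets M"
  have "S = (\<Union>\<alpha>. {\<alpha>} \<times> (Pair \<alpha> -` S))" by auto
  also have "\<dots> \<in> sets (count_space UNIV \<Otimes>\<^sub>M M)"
    using * by (intro sets.countable_UN') auto
  finally show "S \<in> sets (count_space UNIV \<Otimes>\<^sub>M M)" .
qed (auto intro: sets_Pair1)

lemma emeasure_borel_phase:
  "S \<in> sets borel_phase \<Longrightarrow>
    emeasure borel_phase S = (\<integral>\<^sup>+\<alpha>. emeasure (unit_interval \<Otimes>\<^sub>M unit_interval) (Pair \<alpha> -` S) \<partial>count_space UNIV)"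
  unfolding borel_phase_def by (rule unit_square.emeasure_pair_measure_alt)

lemma finite_measure_lebesgue_square: "finite_measure (restrict_space lebesgue unit_square)"
proof
  have "emeasure lebesgue unit_square = emeasure lborel unit_square"
    unfolding unit_square_def by (simp add: borel_Times)
  also have "\<dots> = emeasure (unit_interval \<Otimes>\<^sub>M unit_interval) unit_square"
    unfolding unit_interval_pair by (subst emeasure_restrict_space) (auto simp: unit_square_def borel_Times)
  also have "\<dots> \<noteq> \<infinity>" by simp
  finally show "emeasure (restrict_space lebesgue unit_square) (space (restrict_space lebesgue unit_square)) \<noteq> \<infinity>"
    using unit_square_lebesgue by (simp add: space_restrict_space emeasure_restrict_space)
qed

lemma completion_unit_square:
  "restrict_space lebesgue unit_square = completion (unit_interval \<Otimes>\<^sub>M unit_interval)"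
proof (rule measure_eqI)
  have us: "unit_square \<in> sets borel" unfolding unit_square_def by (simp add: borel_Times)
  show sets_eq: "sets (restrict_space lebesgue unit_square) = sets (completion (unit_interval \<Otimes>\<^sub>M unit_interval))"
  proof (intro equalityI subsetI)
    fix E assume "E \<in> sets (restrict_space lebesgue unit_square)"
    then have E: "E \<in> sets lebesgue" "E \<subseteq> unit_square" by (auto simp: sets_restrict_unit_square)
    obtain S N N' where "E = S \<union> N" "N \<subseteq> N'" "N' \<in> null_sets lborel" "S \<in> sets lborel"
      using E(1) by (rule sets_completionE) (rule that)
    then show "E \<in> sets (completion (unit_interval \<Otimes>\<^sub>M unit_interval))"
      unfolding unit_interval_pair using E(2) us
      by (intro sets_completionI[of E "S \<inter> unit_square" N "N' \<inter> unit_square"])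
        (auto simp: null_sets_restrict_space sets_restrict_space_iff null_set_Int2)
  next
    fix E assume "E \<in> sets (completion (unit_interval \<Otimes>\<^sub>M unit_interval))"
    then obtain S N N' where "E = S \<union> N" "N \<subseteq> N'" "N' \<in> null_sets (restrict_space lborel unit_square)" "S \<in> sets (restrict_space lborel unit_square)"
      unfolding unit_interval_pair by (rule sets_completionE) (rule that)
    then have "E \<in> sets lebesgue" "E \<subseteq> unit_square"
      using us by (auto simp: null_sets_restrict_space sets_restrict_space_iff intro!: sets_completionI[of "S \<union> N" S N N' lborel])
    then show "E \<in> sets (restrict_space lebesgue unit_square)"
      by (simp add: sets_restrict_unit_square)
  qed
  fix E assume E: "E \<in> sets (restrict_space lebesgue unit_square)"
  then have E': "E \<in> sets lebesgue" "E \<subseteq> unit_square" by (auto simp: sets_restrict_unit_square)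
  have "E \<in> sets (completion (unit_interval \<Otimes>\<^sub>M unit_interval))" using E sets_eq by simp
  then obtain S N N' where SN: "E = S \<union> N" "N \<subseteq> N'" "N' \<in> null_sets (restrict_space lborel unit_square)" "S \<in> sets (restrict_space lborel unit_square)"
    unfolding unit_interval_pair by (rule sets_completionE) (rule that)
  have N1: "N' \<in> null_sets lborel" "N' \<in> null_sets (restrict_space lborel unit_square)" and S: "S \<in> sets lborel" "S \<subseteq> unit_square"
    using SN us by (auto simp: null_sets_restrict_space sets_restrict_space_iff)
  have "emeasure (restrict_space lebesgue unit_square) E = emeasure lebesgue (S \<union> N)"
    using E' unit_square_lebesgue SN by (simp add: emeasure_restrict_space)
  also have "\<dots> = emeasure lebesgue S"
    using N1 S SN(2) by (intro emeasure_Un_null_set) (auto simp: null_sets_completion_iff2)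
  also have "\<dots> = emeasure (restrict_space lborel unit_square) S"
    using S us by (simp add: emeasure_restrict_space)
  also have "\<dots> = emeasure (completion (restrict_space lborel unit_square)) S"
    using SN(4) by simp
  also have "\<dots> = emeasure (completion (restrict_space lborel unit_square)) (S \<union> N)"
    using N1 SN by (intro emeasure_Un_null_set[symmetric]) (auto simp: null_sets_completion_iff2)
  finally show "emeasure (restrict_space lebesgue unit_square) E = emeasure (completion (unit_interval \<Otimes>\<^sub>M unit_interval)) E"
    by (simp add: unit_interval_pair SN(1))
qed


text \<open>The lattice is countable, so null sets, and decompositions into a Borel set and a negligible
set, can be chosen cell by cell and glued together.\<close>

lemma rw_measure_eq_completion: "(rw_measure :: ('d::finite) phase measure) = completion borel_phase"
proof (rule measure_eqI)
  let ?U = "unit_interval \<Otimes>\<^sub>M unit_interval"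
  let ?R = "completion ?U"
  let ?rw = "rw_measure :: 'd phase measure" and ?B = "borel_phase :: 'd phase measure"
  have rw: "?rw = count_space UNIV \<Otimes>\<^sub>M ?R"
    by (simp add: rw_measure_def completion_unit_square)
  have "finite_measure ?R"
    using finite_measure_lebesgue_square by (simp add: completion_unit_square)
  then interpret R: finite_measure ?R .
  have sets_rw: "S \<in> sets ?rw \<longleftrightarrow> (\<forall>\<alpha>. Pair \<alpha> -` S \<in> sets ?R)" for S
    unfolding rw by (rule sets_count_space_pair_iff)
  have sets_B: "S \<in> sets ?B \<longleftrightarrow> (\<forall>\<alpha>. Pair \<alpha> -` S \<in> sets ?U)" for S
    unfolding borel_phase_def by (rule sets_count_space_pair_iff)
  have null_slice: "Pair \<alpha> -` N \<in> null_sets ?U" if "N \<in> null_sets ?B" for N \<alpha>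
  proof -
    have "N \<in> sets ?B" "emeasure ?B N = 0" using that by auto
    then have "AE \<alpha> in count_space (UNIV :: (int ^ 'd) set). emeasure ?U (Pair \<alpha> -` N) = 0"
      by (simp add: emeasure_borel_phase nn_integral_0_iff_AE)
    then show ?thesis using \<open>N \<in> sets ?B\<close> sets_B by (auto simp: AE_count_space)
  qed
  have decomp: "S \<in> sets ?rw \<and> emeasure ?rw S = emeasure (completion ?B) S"
    if S: "S \<in> sets (completion ?B)" for S
  proof -
    obtain A N N' where AN: "S = A \<union> N" "N \<subseteq> N'" "N' \<in> null_sets ?B" "A \<in> sets ?B"
      using S by (rule sets_completionE) (rule that)
    have Nn: "Pair \<alpha> -` N \<in> null_sets ?R" for \<alpha>
      unfolding null_sets_completion_iff2 using null_slice[OF AN(3)] AN(2) by blast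
    have A: "Pair \<alpha> -` A \<in> sets ?U" for \<alpha> using AN(4) sets_B by blast
    have S_eq: "Pair \<alpha> -` S = Pair \<alpha> -` A \<union> Pair \<alpha> -` N" for \<alpha> using AN(1) by auto
    have S_rw: "S \<in> sets ?rw"
      unfolding sets_rw S_eq using A Nn by (auto intro!: sets.Un)
    have "emeasure ?rw S = (\<integral>\<^sup>+\<alpha>. emeasure ?R (Pair \<alpha> -` S) \<partial>count_space UNIV)"
      using S_rw unfolding rw by (rule R.emeasure_pair_measure_alt)
    also have "\<dots> = (\<integral>\<^sup>+\<alpha>. emeasure ?U (Pair \<alpha> -` A) \<partial>count_space UNIV)"
      unfolding S_eq using A Nn by (intro nn_integral_cong) (simp add: emeasure_Un_null_set)
    also have "\<dots> = emeasure ?B A" using AN(4) by (rule emeasure_borel_phase[symmetric])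
    also have "\<dots> = emeasure (completion ?B) A" using AN(4) by simp
    also have "\<dots> = emeasure (completion ?B) S"
      unfolding AN(1) using AN by (intro emeasure_Un_null_set[symmetric]) (auto simp: null_sets_completion_iff2)
    finally show ?thesis using S_rw by simp
  qed
  show "sets ?rw = sets (completion ?B)"
  proof (intro equalityI subsetI)
    fix S assume "S \<in> sets ?rw"
    then have "Pair \<alpha> -` S \<in> sets ?R" for \<alpha> unfolding sets_rw by blast
    then have "\<exists>A N N'. Pair \<alpha> -` S = A \<union> N \<and> N \<subseteq> N' \<and> N' \<in> null_sets ?U \<and> A \<in> sets ?U" for \<alpha>
      by (rule sets_completionE) (intro exI conjI)
    then obtain A N N' where AN: "\<And>\<alpha>. Pair \<alpha> -` S = A \<alpha> \<union> N \<alpha>" "\<And>\<alpha>. N \<alpha> \<subseteq> N' \<alpha>"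
      "\<And>\<alpha>. N' \<alpha> \<in> null_sets ?U" "\<And>\<alpha>. A \<alpha> \<in> sets ?U"
      by (metis (no_types))
    have slice: "Pair \<beta> -` (SIGMA \<alpha>:UNIV. C \<alpha>) = C \<beta>" for C :: "int ^ 'd \<Rightarrow> (real \<times> real) set" and \<beta> by auto
    have "S \<subseteq> (SIGMA \<alpha>:UNIV. A \<alpha>) \<union> (SIGMA \<alpha>:UNIV. N \<alpha>)" using AN(1) by fastforce
    moreover have "(SIGMA \<alpha>:UNIV. A \<alpha>) \<union> (SIGMA \<alpha>:UNIV. N \<alpha>) \<subseteq> S" using AN(1) by fastforce
    ultimately have 1: "S = (SIGMA \<alpha>:UNIV. A \<alpha>) \<union> (SIGMA \<alpha>:UNIV. N \<alpha>)" by blast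
    have 2: "(SIGMA \<alpha>:UNIV. N \<alpha>) \<subseteq> (SIGMA \<alpha>:UNIV. N' \<alpha>)" using AN(2) by auto
    have "(SIGMA \<alpha>:UNIV. N' \<alpha>) \<in> sets ?B" using AN(3) by (simp add: sets_B slice null_setsD2)
    then have 3: "(SIGMA \<alpha>:UNIV. N' \<alpha>) \<in> null_sets ?B"
      using AN(3) by (intro null_setsI) (simp_all add: emeasure_borel_phase slice null_setsD1)
    have 4: "(SIGMA \<alpha>:UNIV. A \<alpha>) \<in> sets ?B" using AN(4) by (simp add: sets_B slice)
    show "S \<in> sets (completion ?B)" by (rule sets_completionI[OF 1 2 3 4])
  next
    fix S assume "S \<in> sets (completion ?B)"
    then show "S \<in> sets ?rw" using decomp by blast
  qed
  then show "S \<in> sets ?rw \<Longrightarrow> emeasure ?rw S = emeasure (completion ?B) S" for S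
    using decomp by simp
qed

section \<open>The map preserves the measure\<close>

context rw_data
begin

abbreviation T :: "'d phase \<Rightarrow> 'd phase" where "T \<equiv> rw_map p b"

definition rw_inv :: "'d phase \<Rightarrow> 'd phase" where
  "rw_inv = (\<lambda>(\<alpha>, y1, y2). (\<alpha> - b (slot p b y2), branch (slot p b y2) y1, expand y2))"

lemma rw_map_eq: "T (\<alpha>, y1, y2) = (\<alpha> + b (slot p b y1), expand y1, branch (slot p b y1) y2)"
  by (simp add: rw_map_def expand_def branch_def Let_def)

lemma rw_inv_eq: "rw_inv (\<alpha>, y1, y2) = (\<alpha> - b (slot p b y2), branch (slot p b y2) y1, expand y2)"
  by (simp add: rw_inv_def)

lemma rw_map_in: "x \<in> rw_space \<Longrightarrow> T x \<in> rw_space"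
  by (cases x) (auto simp: rw_map_eq in_rw_space branch_in_unit expand_in_unit slot_props)

lemma rw_inv_in: "x \<in> rw_space \<Longrightarrow> rw_inv x \<in> rw_space"
  by (cases x) (auto simp: rw_inv_eq in_rw_space branch_in_unit expand_in_unit slot_props)

lemma rw_inv_rw_map: "x \<in> rw_space \<Longrightarrow> rw_inv (T x) = x"
  by (cases x) (auto simp: rw_map_eq rw_inv_eq in_rw_space slot_branch slot_props expand_branch branch_expand)

lemma rw_map_rw_inv: "x \<in> rw_space \<Longrightarrow> T (rw_inv x) = x"
  by (cases x) (auto simp: rw_map_eq rw_inv_eq in_rw_space slot_branch slot_props expand_branch branch_expand)

lemma rw_map_iter_in: "x \<in> rw_space \<Longrightarrow> (T ^^ n) x \<in> rw_space"
  by (induction n) (auto simp: rw_map_in)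

lemma rw_inv_iter_in: "x \<in> rw_space \<Longrightarrow> (rw_inv ^^ n) x \<in> rw_space"
  by (induction n) (auto simp: rw_inv_in)

lemma rw_inv_iter_rw_map_iter: "x \<in> rw_space \<Longrightarrow> (rw_inv ^^ n) ((T ^^ n) x) = x"
proof (induction n arbitrary: x)
  case (Suc n)
  have "(rw_inv ^^ Suc n) ((T ^^ Suc n) x) = (rw_inv ^^ n) (rw_inv (T ((T ^^ n) x)))"
    unfolding funpow_Suc_right[of n rw_inv] by simp
  then show ?case using Suc by (simp add: rw_inv_rw_map rw_map_iter_in)
qed simp

lemma rw_map_iter_rw_inv_iter: "x \<in> rw_space \<Longrightarrow> (T ^^ n) ((rw_inv ^^ n) x) = x"
proof (induction n arbitrary: x)
  case (Suc n)
  have "(T ^^ Suc n) ((rw_inv ^^ Suc n) x) = (T ^^ n) (T (rw_inv ((rw_inv ^^ n) x)))"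
    unfolding funpow_Suc_right[of n T] by simp
  then show ?case using Suc by (simp add: rw_map_rw_inv rw_inv_iter_in)
qed simp

lemma inv_into_rw_map: "x \<in> rw_space \<Longrightarrow> inv_into rw_space T x = rw_inv x"
  by (intro inv_into_f_eq inj_onI) (metis rw_inv_rw_map, auto simp: rw_inv_in rw_map_rw_inv)

lemma inv_into_iter: "x \<in> rw_space \<Longrightarrow> (inv_into rw_space T ^^ n) x = (rw_inv ^^ n) x"
  by (induction n) (auto simp: inv_into_rw_map rw_inv_iter_in)

lemma measurable_coords:
  "(fst :: 'd phase \<Rightarrow> _) \<in> borel_phase \<rightarrow>\<^sub>M count_space UNIV"
  "(\<lambda>x :: 'd phase. fst (snd x)) \<in> borel_phase \<rightarrow>\<^sub>M unit_interval"
  "(\<lambda>x :: 'd phase. snd (snd x)) \<in> borel_phase \<rightarrow>\<^sub>M unit_interval"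
  unfolding borel_phase_def by measurable

lemma measurable_to_borel_phase:
  fixes f :: "'a \<Rightarrow> 'd phase"
  assumes "(\<lambda>x. fst (f x)) \<in> M \<rightarrow>\<^sub>M count_space UNIV" "(\<lambda>x. fst (snd (f x))) \<in> M \<rightarrow>\<^sub>M unit_interval"
    "(\<lambda>x. snd (snd (f x))) \<in> M \<rightarrow>\<^sub>M unit_interval"
  shows "f \<in> M \<rightarrow>\<^sub>M borel_phase"
proof -
  have "(\<lambda>x. (fst (f x), fst (snd (f x)), snd (snd (f x)))) \<in> M \<rightarrow>\<^sub>M borel_phase"
    unfolding borel_phase_def using assms by (intro measurable_Pair)
  then show ?thesis by simp
qed

lemma measurable_translate_slot:
  assumes "a \<in> M \<rightarrow>\<^sub>M count_space UNIV" "y \<in> M \<rightarrow>\<^sub>M unit_interval"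
  shows "(\<lambda>x. (a x :: int ^ 'd) + b (slot p b (y x))) \<in> M \<rightarrow>\<^sub>M count_space UNIV"
    "(\<lambda>x. (a x :: int ^ 'd) - b (slot p b (y x))) \<in> M \<rightarrow>\<^sub>M count_space UNIV"
  using assms
  by (auto intro!: measurable_compose_countable[OF _ measurable_compose[OF assms(2) measurable_slot]] 
      intro: measurable_compose[OF assms(1)])

lemma measurable_branch_slot:
  assumes y: "y \<in> M \<rightarrow>\<^sub>M unit_interval" and z: "z \<in> M \<rightarrow>\<^sub>M unit_interval"
  shows "(\<lambda>x. branch (slot p b (y x)) (z x)) \<in> M \<rightarrow>\<^sub>M unit_interval"
proof (rule measurable_restrict_space2)
  have z': "z \<in> borel_measurable M" using measurable_compose[OF z measurable_unit_interval_borel] .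
  have "(\<lambda>x. branch (slot p b (y x)) (z x)) \<in> borel_measurable M"
    by (rule measurable_compose_countable[OF _ measurable_compose[OF y measurable_slot]])
      (use z' in \<open>simp add: branch_def\<close>)
  then show "(\<lambda>x. branch (slot p b (y x)) (z x)) \<in> M \<rightarrow>\<^sub>M lborel" by simp
  show "(\<lambda>x. branch (slot p b (y x)) (z x)) \<in> space M \<rightarrow> {0..<1}"
    using measurable_space[OF y] measurable_space[OF z] by (auto intro!: branch_in_unit slot_props)
qed

lemma rw_map_coords:
  "fst (T x) = fst x + b (slot p b (fst (snd x)))"
  "fst (snd (T x)) = expand (fst (snd x))"
  "snd (snd (T x)) = branch (slot p b (fst (snd x))) (snd (snd x))"
  by (cases x; simp add: rw_map_eq)+

lemma rw_inv_coords:
  "fst (rw_inv x) = fst x - b (slot p b (snd (snd x)))"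
  "fst (snd (rw_inv x)) = branch (slot p b (snd (snd x))) (fst (snd x))"
  "snd (snd (rw_inv x)) = expand (snd (snd x))"
  by (cases x; simp add: rw_inv_eq)+

lemma measurable_rw_map: "T \<in> borel_phase \<rightarrow>\<^sub>M borel_phase"
  by (rule measurable_to_borel_phase; unfold rw_map_coords)
    (intro measurable_translate_slot measurable_branch_slot measurable_coords
      measurable_compose[OF measurable_coords(2) measurable_expand])+

lemma measurable_rw_inv: "rw_inv \<in> borel_phase \<rightarrow>\<^sub>M borel_phase"
  by (rule measurable_to_borel_phase; unfold rw_inv_coords)
    (intro measurable_translate_slot measurable_branch_slot measurable_coords
      measurable_compose[OF measurable_coords(3) measurable_expand])+

lemma nn_integral_borel_phase:
  assumes "f \<in> borel_measurable (borel_phase :: 'd phase measure)"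
  shows "(\<integral>\<^sup>+x. f x \<partial>borel_phase) =
    (\<integral>\<^sup>+\<alpha>. \<integral>\<^sup>+y1. \<integral>\<^sup>+y2. f (\<alpha>, y1, y2) \<partial>unit_interval \<partial>unit_interval \<partial>count_space UNIV)"
proof -
  have f: "f \<in> borel_measurable (count_space UNIV \<Otimes>\<^sub>M (unit_interval \<Otimes>\<^sub>M unit_interval))"
    using assms by (simp add: borel_phase_def)
  have f\<alpha>: "(\<lambda>y. f (\<alpha>, y)) \<in> borel_measurable (unit_interval \<Otimes>\<^sub>M unit_interval)" for \<alpha>
    using f by (rule measurable_Pair2) simp
  show ?thesis
    unfolding borel_phase_def unit_square.nn_integral_fst[OF f, symmetric]
    by (intro nn_integral_cong) (simp add: unit_interval.nn_integral_fst[OF f\<alpha>, symmetric])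
qed

text \<open>On the cell over \<open>\<alpha>\<close>, split the integral over \<open>y\<^sub>1\<close> into its branches. The branch
\<open>k\<close> contributes its weight times an integral over the cell at \<open>\<alpha> + b k\<close>; a translation of the lattice
removes the displacement, and the weights are absorbed by the branches that now appear in the other coordinate.\<close>

lemma nn_integral_rw_map:
  assumes f: "f \<in> borel_measurable (borel_phase :: 'd phase measure)"
  shows "(\<integral>\<^sup>+x. f (T x) \<partial>borel_phase) = (\<integral>\<^sup>+x. f x \<partial>borel_phase)"
proof -
  let ?C = "count_space (UNIV :: (int ^ 'd) set)"
  have f3: "f \<in> borel_measurable (?C \<Otimes>\<^sub>M (unit_interval \<Otimes>\<^sub>M unit_interval))"
    using f by (simp add: borel_phase_def)
  have f2: "(\<lambda>y. f (\<alpha>, y)) \<in> borel_measurable (unit_interval \<Otimes>\<^sub>M unit_interval)" for \<alpha>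
    using f3 by (rule measurable_Pair2) simp
  have f1: "(\<lambda>y2. f (\<alpha>, u, y2)) \<in> borel_measurable unit_interval" if "0 \<le> u" "u < 1" for \<alpha> u
    using f2 by (rule measurable_Pair2) (use that in simp)
  \<comment> \<open>The value \<open>0\<close> off the index set only secures joint measurability: \<open>branch k\<close> need not map the unit
    interval to itself for other \<open>k\<close>.\<close>
  define G where "G = (\<lambda>k \<alpha> u. if k \<in> index_set p then \<integral>\<^sup>+y2. f (\<alpha>, u, branch k y2) \<partial>unit_interval else 0)"
  have G_meas: "G k \<alpha> \<in> borel_measurable unit_interval" for k \<alpha>
  proof (cases "k \<in> index_set p")
    case True
    have "(\<lambda>z. (fst z, branch k (snd z))) \<in> unit_interval \<Otimes>\<^sub>M unit_interval \<rightarrow>\<^sub>M unit_interval \<Otimes>\<^sub>M unit_interval"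
      by (intro measurable_Pair measurable_fst measurable_compose[OF measurable_snd measurable_branch[OF True]])
    from unit_interval.borel_measurable_nn_integral_fst[OF measurable_compose[OF this f2[of \<alpha>]]]
    show ?thesis using True by (simp add: G_def)
  qed (simp add: G_def)
  have G_meas2: "(\<lambda>(k, u). G k \<alpha> u) \<in> borel_measurable (measure_pmf index_pmf \<Otimes>\<^sub>M unit_interval)" for \<alpha>
  proof -
    have "(\<lambda>(k, u). G k \<alpha> u) \<in> borel_measurable (count_space UNIV \<Otimes>\<^sub>M unit_interval)"
      using G_meas by (intro measurable_pair_measure_countable1) auto
    moreover have "sets (count_space UNIV \<Otimes>\<^sub>M unit_interval) = sets (measure_pmf index_pmf \<Otimes>\<^sub>M unit_interval)"
      by (intro sets_pair_measure_cong) auto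
    ultimately show ?thesis by (simp cong: measurable_cong_sets)
  qed
  have pair_CI: "pair_sigma_finite ?C (measure_pmf index_pmf)" ..
  have pair_IU: "pair_sigma_finite (measure_pmf index_pmf) unit_interval" ..
  have CI_meas: "case_prod h \<in> borel_measurable (?C \<Otimes>\<^sub>M measure_pmf index_pmf)" for h :: "int ^ 'd \<Rightarrow> nat \<Rightarrow> ennreal"
    by (intro measurable_pair_measure_countable1) auto
  have slots: "AE k in measure_pmf index_pmf. k \<in> index_set p"
    by (simp add: AE_measure_pmf_iff set_index_pmf)
  have fT: "(\<lambda>x. f (T x)) \<in> borel_measurable borel_phase"
    by (rule measurable_compose[OF measurable_rw_map f])
  have inner_meas: "(\<lambda>y1. \<integral>\<^sup>+y2. f (T (\<alpha>, y1, y2)) \<partial>unit_interval) \<in> borel_measurable unit_interval" for \<alpha>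
  proof -
    have "(\<lambda>y. f (T (\<alpha>, y))) \<in> borel_measurable (unit_interval \<Otimes>\<^sub>M unit_interval)"
      using fT unfolding borel_phase_def by (rule measurable_Pair2) simp
    then show ?thesis by (rule unit_interval.borel_measurable_nn_integral_fst)
  qed
  have "(\<integral>\<^sup>+x. f (T x) \<partial>borel_phase)
      = (\<integral>\<^sup>+\<alpha>. \<integral>\<^sup>+y1. \<integral>\<^sup>+y2. f (T (\<alpha>, y1, y2)) \<partial>unit_interval \<partial>unit_interval \<partial>?C)"
    using fT by (rule nn_integral_borel_phase)
  also have "\<dots> = (\<integral>\<^sup>+\<alpha>. \<integral>\<^sup>+k. \<integral>\<^sup>+u. \<integral>\<^sup>+y2. f (T (\<alpha>, branch k u, y2)) \<partial>unit_interval \<partial>unit_interval \<partial>index_pmf \<partial>?C)"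
    by (subst nn_integral_branch[OF inner_meas]) (rule refl)
  also have "\<dots> = (\<integral>\<^sup>+\<alpha>. \<integral>\<^sup>+k. \<integral>\<^sup>+u. G k (\<alpha> + b k) u \<partial>unit_interval \<partial>index_pmf \<partial>?C)"
    using slots
    by (intro nn_integral_cong nn_integral_cong_AE, elim eventually_mono, intro nn_integral_cong)
      (auto simp: G_def rw_map_eq slot_branch expand_branch)
  also have "\<dots> = (\<integral>\<^sup>+k. \<integral>\<^sup>+\<alpha>. \<integral>\<^sup>+u. G k (\<alpha> + b k) u \<partial>unit_interval \<partial>?C \<partial>index_pmf)"
    by (rule pair_sigma_finite.Fubini'[OF pair_CI CI_meas, symmetric])
  also have "\<dots> = (\<integral>\<^sup>+k. \<integral>\<^sup>+\<alpha>. \<integral>\<^sup>+u. G k \<alpha> u \<partial>unit_interval \<partial>?C \<partial>index_pmf)"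
  proof (rule nn_integral_cong)
    fix k
    have "bij_betw (\<lambda>\<alpha>. \<alpha> + b k) UNIV UNIV" by (rule bij_plus_right)
    from nn_integral_bij_count_space[OF this, of "\<lambda>\<alpha>. \<integral>\<^sup>+u. G k \<alpha> u \<partial>unit_interval"]
    show "(\<integral>\<^sup>+\<alpha>. \<integral>\<^sup>+u. G k (\<alpha> + b k) u \<partial>unit_interval \<partial>?C) = (\<integral>\<^sup>+\<alpha>. \<integral>\<^sup>+u. G k \<alpha> u \<partial>unit_interval \<partial>?C)" .
  qed
  also have "\<dots> = (\<integral>\<^sup>+\<alpha>. \<integral>\<^sup>+k. \<integral>\<^sup>+u. G k \<alpha> u \<partial>unit_interval \<partial>index_pmf \<partial>?C)"
    by (rule pair_sigma_finite.Fubini'[OF pair_CI CI_meas])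
  also have "\<dots> = (\<integral>\<^sup>+\<alpha>. \<integral>\<^sup>+u. \<integral>\<^sup>+k. G k \<alpha> u \<partial>index_pmf \<partial>unit_interval \<partial>?C)"
    by (intro nn_integral_cong pair_sigma_finite.Fubini'[OF pair_IU G_meas2, symmetric])
  also have "\<dots> = (\<integral>\<^sup>+\<alpha>. \<integral>\<^sup>+u. \<integral>\<^sup>+y2. f (\<alpha>, u, y2) \<partial>unit_interval \<partial>unit_interval \<partial>?C)"
  proof (intro nn_integral_cong)
    fix \<alpha> :: "int ^ 'd" and u assume "u \<in> space unit_interval"
    then have u: "0 \<le> u" "u < 1" by auto
    have "(\<integral>\<^sup>+k. G k \<alpha> u \<partial>index_pmf) = (\<integral>\<^sup>+k. \<integral>\<^sup>+y2. f (\<alpha>, u, branch k y2) \<partial>unit_interval \<partial>index_pmf)"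
      using slots by (intro nn_integral_cong_AE, elim eventually_mono) (simp add: G_def)
    then show "(\<integral>\<^sup>+k. G k \<alpha> u \<partial>index_pmf) = (\<integral>\<^sup>+y2. f (\<alpha>, u, y2) \<partial>unit_interval)"
      using nn_integral_branch[OF f1[OF u]] by simp
  qed
  also have "\<dots> = (\<integral>\<^sup>+x. f x \<partial>borel_phase)"
    using f by (rule nn_integral_borel_phase[symmetric])
  finally show ?thesis .
qed

lemma distr_rw_map: "distr borel_phase borel_phase T = (borel_phase :: 'd phase measure)"
proof (rule measure_eqI)
  fix A :: "'d phase set" assume "A \<in> sets (distr borel_phase borel_phase T)"
  then have A: "A \<in> sets borel_phase" by simp
  have "emeasure (distr borel_phase borel_phase T) A = (\<integral>\<^sup>+x. indicator A x \<partial>distr borel_phase borel_phase T)"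
    using A by simp
  also have "\<dots> = (\<integral>\<^sup>+x. indicator A (T x) \<partial>borel_phase)"
    using A by (intro nn_integral_distr measurable_rw_map) simp
  also have "\<dots> = emeasure borel_phase A"
    using A by (subst nn_integral_rw_map) auto
  finally show "emeasure (distr borel_phase borel_phase T) A = emeasure borel_phase A" .
qed simp

text \<open>Preservation of Borel null sets is what lets measurability pass to the completion.\<close>

lemma measurable_rw_map_rw: "T \<in> rw_measure \<rightarrow>\<^sub>M rw_measure"
proof -
  interpret complete_measure "rw_measure :: 'd phase measure"
    unfolding rw_measure_eq_completion ..
  have T: "T \<in> rw_measure \<rightarrow>\<^sub>M borel_phase"
    unfolding rw_measure_eq_completion by (rule measurable_completion[OF measurable_rw_map])
  have "distr rw_measure borel_phase T = borel_phase"
    unfolding rw_measure_eq_completion by (simp add: distr_completion[OF measurable_rw_map] distr_rw_map)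
  then have "T \<in> rw_measure \<rightarrow>\<^sub>M completion borel_phase"
    by (intro measurable_completion2[OF T]) simp
  then show ?thesis by (simp add: rw_measure_eq_completion)
qed

lemma distr_rw_map_rw: "distr rw_measure rw_measure T = (rw_measure :: 'd phase measure)"
proof -
  interpret complete_measure "rw_measure :: 'd phase measure"
    unfolding rw_measure_eq_completion ..
  have T: "T \<in> rw_measure \<rightarrow>\<^sub>M borel_phase"
    unfolding rw_measure_eq_completion by (rule measurable_completion[OF measurable_rw_map])
  have D: "distr rw_measure borel_phase T = borel_phase"
    unfolding rw_measure_eq_completion by (simp add: distr_completion[OF measurable_rw_map] distr_rw_map)
  have "completion (distr rw_measure borel_phase T) = distr rw_measure (completion borel_phase) T"
    by (rule completion_distr_eq[OF T]) (simp add: D)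
  then show ?thesis by (simp add: D rw_measure_eq_completion[symmetric])
qed

lemma measurable_rw_map_iter: "T ^^ n \<in> borel_phase \<rightarrow>\<^sub>M borel_phase"
  by (induction n) (auto intro: measurable_comp measurable_rw_map simp del: o_apply)

lemma measurable_rw_inv_iter: "rw_inv ^^ n \<in> borel_phase \<rightarrow>\<^sub>M borel_phase"
  by (induction n) (auto intro: measurable_comp measurable_rw_inv simp del: o_apply)

lemma measurable_rw_map_iter_rw: "T ^^ n \<in> rw_measure \<rightarrow>\<^sub>M rw_measure"
  by (induction n) (auto intro: measurable_comp measurable_rw_map_rw simp del: o_apply)

lemma distr_rw_map_iter: "distr rw_measure rw_measure (T ^^ n) = (rw_measure :: 'd phase measure)"
proof (induction n)
  case 0
  then show ?case by (simp add: id_def distr_id)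
next
  case (Suc n)
  have "distr rw_measure rw_measure (T ^^ Suc n) = distr (distr rw_measure rw_measure (T ^^ n)) rw_measure T"
    using distr_distr[OF measurable_rw_map_rw measurable_rw_map_iter_rw, of n] by (simp only: funpow.simps)
  then show ?case by (simp only: Suc distr_rw_map_rw)
qed

lemma integral_rw_map_iter:
  assumes "f \<in> borel_measurable (rw_measure :: 'd phase measure)"
  shows "(\<integral>x. f ((T ^^ n) x) \<partial>rw_measure) = (\<integral>x. (f x :: real) \<partial>rw_measure)"
  using integral_distr[OF measurable_rw_map_iter_rw assms, of n] by (simp add: distr_rw_map_iter)

lemma integrable_rw_map_iter:
  assumes "integrable (rw_measure :: 'd phase measure) (f :: _ \<Rightarrow> real)"
  shows "integrable rw_measure (\<lambda>x. f ((T ^^ n) x))"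
  using integrable_distr_eq[OF measurable_rw_map_iter_rw, of f n] assms by (simp add: distr_rw_map_iter)

lemma AE_rw_map_iter:
  assumes "AE x in (rw_measure :: 'd phase measure). P x"
  shows "AE x in rw_measure. P ((T ^^ n) x)"
proof -
  have "AE x in distr rw_measure rw_measure (T ^^ n). P x" using assms unfolding distr_rw_map_iter .
  then show ?thesis by (rule AE_distrD[OF measurable_rw_map_iter_rw])
qed

end

section \<open>Cylinder functions\<close>

context rw_data
begin

text \<open>The action of \<open>T\<close> on \<open>(\<alpha>, y\<^sub>1)\<close>, which does not depend on \<open>y\<^sub>2\<close>.\<close>

definition skew :: "(int ^ 'd) \<times> real \<Rightarrow> (int ^ 'd) \<times> real" where
  "skew = (\<lambda>(\<alpha>, y). (\<alpha> + b (slot p b y), expand y))"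

text \<open>The action of \<open>rw_inv\<close> on \<open>(\<alpha>, y\<^sub>2)\<close>, which does not depend on \<open>y\<^sub>1\<close>.\<close>

definition skew_back :: "(int ^ 'd) \<times> real \<Rightarrow> (int ^ 'd) \<times> real" where
  "skew_back = (\<lambda>(\<alpha>, y). (\<alpha> - b (slot p b y), expand y))"

definition forward :: "'d phase \<Rightarrow> (int ^ 'd) \<times> real" where "forward x = (fst x, fst (snd x))"

definition backward :: "'d phase \<Rightarrow> (int ^ 'd) \<times> real" where "backward x = (fst x, snd (snd x))"

lemma forward_rw_map: "forward (T x) = skew (forward x)"
  by (simp add: forward_def rw_map_coords skew_def)

lemma backward_rw_inv: "backward (rw_inv x) = skew_back (backward x)"
  by (simp add: backward_def rw_inv_coords skew_back_def)

lemma forward_rw_map_iter: "forward ((T ^^ n) x) = (skew ^^ n) (forward x)"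
  by (induction n) (auto simp: forward_rw_map)

lemma backward_rw_inv_iter: "backward ((rw_inv ^^ n) x) = (skew_back ^^ n) (backward x)"
  by (induction n) (auto simp: backward_rw_inv)

lemma fst_rw_map_iter: "fst ((T ^^ n) x) = fst ((skew ^^ n) (forward x))"
  by (metis forward_rw_map_iter forward_def fst_conv)

lemma fst_rw_inv_iter: "fst ((rw_inv ^^ n) x) = fst ((skew_back ^^ n) (backward x))"
  by (metis backward_rw_inv_iter backward_def fst_conv)

lemma rw_inv_iter_cancel: "k \<le> m \<Longrightarrow> x \<in> rw_space \<Longrightarrow> (rw_inv ^^ k) ((T ^^ m) x) = (T ^^ (m - k)) x"
  using funpow_add[of k "m - k" T] by (simp add: rw_inv_iter_rw_map_iter rw_map_iter_in)

lemma rw_map_iter_cancel: "k \<le> m \<Longrightarrow> x \<in> rw_space \<Longrightarrow> (T ^^ k) ((rw_inv ^^ m) x) = (rw_inv ^^ (m - k)) x"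
  using funpow_add[of k "m - k" rw_inv] by (simp add: rw_map_iter_rw_inv_iter rw_inv_iter_in)

lemma cell_sets_cases:
  assumes "A \<in> cell_sets" obtains C where "A = (C :: (int ^ 'd) set) \<times> unit_square"
proof -
  have "\<exists>C :: (int ^ 'd) set. A = C \<times> unit_square"
    using assms unfolding cell_sets_def
  proof (induction rule: sigma_sets.induct)
    case (Basic a) then show ?case by (auto simp: cell_def)
  next
    case Empty then show ?case by auto
  next
    case (Compl a)
    then obtain C :: "(int ^ 'd) set" where "a = C \<times> unit_square" by auto
    then have "rw_space - a = (- C) \<times> unit_square" by (auto simp: rw_space_def)
    then show ?case by blast
  next
    case (Union a)
    then obtain C :: "nat \<Rightarrow> (int ^ 'd) set" where "\<And>i. a i = C i \<times> unit_square" by metis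
    then have "(\<Union>i. a i) = (\<Union>i. C i) \<times> unit_square" by auto
    then show ?case by blast
  qed
  then show ?thesis using that by blast
qed

lemma cell_sets_Times: "(C :: (int ^ 'd) set) \<times> unit_square \<in> cell_sets"
proof -
  have "(\<Union>\<alpha>\<in>C. cell \<alpha>) \<in> cell_sets"
    unfolding cell_sets_def by (intro sigma_sets_UNION) (auto intro!: sigma_sets.Basic countable_image)
  moreover have "(\<Union>\<alpha>\<in>C. cell \<alpha>) = C \<times> unit_square" by (auto simp: cell_def)
  ultimately show ?thesis by simp
qed

text \<open>Membership in a generator of the cylinder algebra is a condition on the position of the walk
at a single time: a future one in the first case, a past one in the second.\<close>

lemma pulled_cell_sets_cases:
  assumes "E \<in> pulled_cell_sets p b k"
  obtains C :: "(int ^ 'd) set" where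
    "0 \<le> k" "E = {x \<in> rw_space. fst ((T ^^ nat k) x) \<in> C}"
  | C :: "(int ^ 'd) set" where
    "k < 0" "E = {x \<in> rw_space. fst ((rw_inv ^^ nat (- k)) x) \<in> C}"
proof -
  obtain C :: "(int ^ 'd) set" where E: "E = rw_iter p b (- k) ` (C \<times> unit_square)"
    using assms by (auto simp: pulled_cell_sets_def elim: cell_sets_cases)
  have C: "x \<in> C \<times> unit_square \<longleftrightarrow> x \<in> rw_space \<and> fst x \<in> C" for x :: "'d phase"
    by (cases x) (auto simp: rw_space_def)
  show ?thesis
  proof (cases "0 \<le> k")
    case True
    have "E = (rw_inv ^^ nat k) ` (C \<times> unit_square)"
    proof (cases "k = 0")
      case False
      then show ?thesis unfolding E using True C by (intro image_cong) (auto simp: rw_iter_def inv_into_iter)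
    qed (simp add: E rw_iter_def)
    also have "\<dots> = {x \<in> rw_space. fst ((T ^^ nat k) x) \<in> C}"
    proof (intro equalityI subsetI)
      fix x assume "x \<in> {x \<in> rw_space. fst ((T ^^ nat k) x) \<in> C}"
      then show "x \<in> (rw_inv ^^ nat k) ` (C \<times> unit_square)"
        by (intro image_eqI[of _ _ "(T ^^ nat k) x"]) (auto simp: C rw_inv_iter_rw_map_iter rw_map_iter_in)
    next
      fix x assume "x \<in> (rw_inv ^^ nat k) ` (C \<times> unit_square)"
      then obtain z where "z \<in> C \<times> unit_square" and x: "x = (rw_inv ^^ nat k) z" by blast
      then have z: "z \<in> rw_space" "fst z \<in> C" using C by blast+
      show "x \<in> {x \<in> rw_space. fst ((T ^^ nat k) x) \<in> C}"
        by (simp add: x z rw_inv_iter_in rw_map_iter_rw_inv_iter)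
    qed
    finally show ?thesis using True that(1) by blast
  next
    case False
    have "E = (T ^^ nat (- k)) ` (C \<times> unit_square)" using False by (simp add: E rw_iter_def)
    also have "\<dots> = {x \<in> rw_space. fst ((rw_inv ^^ nat (- k)) x) \<in> C}"
    proof (intro equalityI subsetI)
      fix x assume "x \<in> {x \<in> rw_space. fst ((rw_inv ^^ nat (- k)) x) \<in> C}"
      then show "x \<in> (T ^^ nat (- k)) ` (C \<times> unit_square)"
        by (intro image_eqI[of _ _ "(rw_inv ^^ nat (- k)) x"]) (auto simp: C rw_map_iter_rw_inv_iter rw_inv_iter_in)
    next
      fix x assume "x \<in> (T ^^ nat (- k)) ` (C \<times> unit_square)"
      then obtain z where "z \<in> C \<times> unit_square" and x: "x = (T ^^ nat (- k)) z" by blast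
      then have z: "z \<in> rw_space" "fst z \<in> C" using C by blast+
      show "x \<in> {x \<in> rw_space. fst ((rw_inv ^^ nat (- k)) x) \<in> C}"
        by (simp add: x z rw_map_iter_in rw_inv_iter_rw_map_iter)
    qed
    finally show ?thesis using False that(2) by simp
  qed
qed

lemma pulled_cell_sets_subset: "pulled_cell_sets p b k \<subseteq> Pow rw_space"
  by (auto elim!: pulled_cell_sets_cases)

lemma cyl_generators_subset: "(\<Union>k\<in>K. pulled_cell_sets p b k) \<subseteq> Pow rw_space"
  using pulled_cell_sets_subset by blast

lemma sets_cyl_algebra:
  "sets (cyl_algebra p b l m) = sigma_sets rw_space (\<Union>k\<in>{l..m}. pulled_cell_sets p b k)"
  unfolding cyl_algebra_def by (rule sets_measure_of[OF cyl_generators_subset])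

lemma space_cyl_algebra: "space (cyl_algebra p b l m) = rw_space"
  unfolding cyl_algebra_def by (rule space_measure_of[OF cyl_generators_subset])

abbreviation cyl :: "nat \<Rightarrow> 'd phase measure" where
  "cyl m \<equiv> cyl_algebra p b (- int m) (int m)"

text \<open>The two halves say that, \<open>m\<close> steps ahead, membership depends on \<open>(\<alpha>, y\<^sub>1)\<close> only, and
\<open>m\<close> steps back, on \<open>(\<alpha>, y\<^sub>2)\<close> only.\<close>

definition coord_determined :: "nat \<Rightarrow> 'd phase set \<Rightarrow> bool" where
  "coord_determined m E \<longleftrightarrow>
    (\<forall>x\<in>rw_space. \<forall>x'\<in>rw_space. forward x = forward x' \<longrightarrow> ((T ^^ m) x \<in> E \<longleftrightarrow> (T ^^ m) x' \<in> E)) \<and>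
    (\<forall>x\<in>rw_space. \<forall>x'\<in>rw_space. backward x = backward x' \<longrightarrow> ((rw_inv ^^ m) x \<in> E \<longleftrightarrow> (rw_inv ^^ m) x' \<in> E))"

text \<open>The position of \<open>T\<^sup>m x\<close> at time \<open>k\<close> is that of \<open>x\<close> at the time \<open>k + m \<ge> 0\<close>, which is read off
\<open>(\<alpha>, y\<^sub>1)\<close>; the position of \<open>T\<^bsup>-m\<^esup> x\<close> at time \<open>k\<close> is that of \<open>x\<close> at the time \<open>k - m \<le> 0\<close>.\<close>

lemma coord_determined_pulled:
  assumes "E \<in> pulled_cell_sets p b k" "- int m \<le> k" "k \<le> int m"
  shows "coord_determined m E"
  using assms(1)
proof (cases rule: pulled_cell_sets_cases)
  case (1 C)
  have "nat k \<le> m" using assms(3) by simp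
  have "(T ^^ m) x \<in> E \<longleftrightarrow> fst ((skew ^^ (nat k + m)) (forward x)) \<in> C" if "x \<in> rw_space" for x
    using that by (simp add: 1(2) rw_map_iter_in fst_rw_map_iter forward_rw_map_iter funpow_add)
  moreover have "(rw_inv ^^ m) x \<in> E \<longleftrightarrow> fst ((skew_back ^^ (m - nat k)) (backward x)) \<in> C" if "x \<in> rw_space" for x
    using that by (simp add: 1(2) rw_inv_iter_in rw_map_iter_cancel[OF \<open>nat k \<le> m\<close>] fst_rw_inv_iter)
  ultimately show ?thesis unfolding coord_determined_def by simp
next
  case (2 C)
  have "nat (- k) \<le> m" using assms(2) by simp
  have "(rw_inv ^^ m) x \<in> E \<longleftrightarrow> fst ((skew_back ^^ (nat (- k) + m)) (backward x)) \<in> C" if "x \<in> rw_space" for x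
    using that by (simp add: 2(2) rw_inv_iter_in fst_rw_inv_iter backward_rw_inv_iter funpow_add)
  moreover have "(T ^^ m) x \<in> E \<longleftrightarrow> fst ((skew ^^ (m - nat (- k))) (forward x)) \<in> C" if "x \<in> rw_space" for x
    using that by (simp add: 2(2) rw_map_iter_in rw_inv_iter_cancel[OF \<open>nat (- k) \<le> m\<close>] fst_rw_map_iter)
  ultimately show ?thesis unfolding coord_determined_def by simp
qed

lemma borel_pulled:
  assumes "E \<in> pulled_cell_sets p b k" shows "E \<in> sets borel_phase"
  using assms
proof (cases rule: pulled_cell_sets_cases)
  case (1 C)
  have "(\<lambda>x. fst ((T ^^ nat k) x)) \<in> borel_phase \<rightarrow>\<^sub>M count_space UNIV"
    by (rule measurable_compose[OF measurable_rw_map_iter measurable_coords(1)])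
  from measurable_sets[OF this, of C] show ?thesis unfolding 1(2) by (simp add: vimage_def Int_def conj_commute)
next
  case (2 C)
  have "(\<lambda>x. fst ((rw_inv ^^ nat (- k)) x)) \<in> borel_phase \<rightarrow>\<^sub>M count_space UNIV"
    by (rule measurable_compose[OF measurable_rw_inv_iter measurable_coords(1)])
  from measurable_sets[OF this, of C] show ?thesis unfolding 2(2) by (simp add: vimage_def Int_def conj_commute)
qed

lemma cyl_algebra_subset_borel: "sets (cyl_algebra p b l m) \<subseteq> sets borel_phase"
  unfolding sets_cyl_algebra
  by (subst space_borel_phase[symmetric]) (rule sets.sigma_sets_subset, use borel_pulled in blast)

lemma coord_determined_cyl:
  assumes "E \<in> sets (cyl m)"
  shows "coord_determined m E"
  using assms unfolding sets_cyl_algebra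
proof (induction rule: sigma_sets.induct)
  case (Basic E)
  then obtain k where "k \<in> {- int m..int m}" "E \<in> pulled_cell_sets p b k" by blast
  then show ?case by (intro coord_determined_pulled[of E k]) auto
next
  case Empty
  then show ?case by (simp add: coord_determined_def)
next
  case (Compl E)
  then have fw: "forward x = forward x' \<Longrightarrow> (T ^^ m) x \<in> E \<longleftrightarrow> (T ^^ m) x' \<in> E"
    and bw: "backward x = backward x' \<Longrightarrow> (rw_inv ^^ m) x \<in> E \<longleftrightarrow> (rw_inv ^^ m) x' \<in> E"
    if "x \<in> rw_space" "x' \<in> rw_space" for x x'
    using that unfolding coord_determined_def by blast+
  show ?case
    unfolding coord_determined_def Diff_iff
    by (intro conjI ballI impI; simp only: rw_map_iter_in rw_inv_iter_in simp_thms; (drule (2) fw | drule (2) bw); simp)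
next
  case (Union E)
  then have fw: "forward x = forward x' \<Longrightarrow> (T ^^ m) x \<in> E i \<longleftrightarrow> (T ^^ m) x' \<in> E i"
    and bw: "backward x = backward x' \<Longrightarrow> (rw_inv ^^ m) x \<in> E i \<longleftrightarrow> (rw_inv ^^ m) x' \<in> E i"
    if "x \<in> rw_space" "x' \<in> rw_space" for x x' i
    using that unfolding coord_determined_def by blast+
  show ?case
    unfolding coord_determined_def UN_iff by (intro conjI ballI impI bex_cong refl) (rule fw bw; assumption)+
qed

lemma borel_measurable_cyl:
  assumes "F \<in> borel_measurable (cyl_algebra p b l m)"
  shows "F \<in> borel_measurable borel_phase"
proof (rule measurableI)
  fix A :: "'a set" assume "A \<in> sets borel"
  from measurable_sets[OF assms this] show "F -` A \<inter> space borel_phase \<in> sets borel_phase"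
    using cyl_algebra_subset_borel by (auto simp: space_cyl_algebra)
qed simp

text \<open>Level sets of a cylinder function are cylinder sets.\<close>

lemma cyl_function_forward:
  fixes F :: "'d phase \<Rightarrow> real"
  assumes F: "F \<in> borel_measurable (cyl m)"
    and "x \<in> rw_space" "x' \<in> rw_space" "forward x = forward x'"
  shows "F ((T ^^ m) x) = F ((T ^^ m) x')"
proof -
  have "coord_determined m (F -` {F ((T ^^ m) x)} \<inter> rw_space)"
    using measurable_sets[OF F, of "{F ((T ^^ m) x)}"] by (intro coord_determined_cyl) (simp add: space_cyl_algebra)
  then have "(T ^^ m) x' \<in> F -` {F ((T ^^ m) x)} \<inter> rw_space"
    using assms(2-4) rw_map_iter_in[of x m] unfolding coord_determined_def by blast
  then show ?thesis by simp
qed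

lemma cyl_function_backward:
  fixes F :: "'d phase \<Rightarrow> real"
  assumes F: "F \<in> borel_measurable (cyl m)"
    and "x \<in> rw_space" "x' \<in> rw_space" "backward x = backward x'"
  shows "F ((rw_inv ^^ m) x) = F ((rw_inv ^^ m) x')"
proof -
  have "coord_determined m (F -` {F ((rw_inv ^^ m) x)} \<inter> rw_space)"
    using measurable_sets[OF F, of "{F ((rw_inv ^^ m) x)}"] by (intro coord_determined_cyl) (simp add: space_cyl_algebra)
  then have "(rw_inv ^^ m) x' \<in> F -` {F ((rw_inv ^^ m) x)} \<inter> rw_space"
    using assms(2-4) rw_inv_iter_in[of x m] unfolding coord_determined_def by blast
  then show ?thesis by simp
qed

abbreviation half_phase :: "((int ^ 'd) \<times> real) measure" where
  "half_phase \<equiv> count_space UNIV \<Otimes>\<^sub>M unit_interval"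

lemma cyl_function_forward_rep:
  fixes F :: "'d phase \<Rightarrow> real"
  assumes F: "F \<in> borel_measurable (cyl m)"
  obtains f where "f \<in> borel_measurable half_phase" "\<And>x. x \<in> rw_space \<Longrightarrow> F ((T ^^ m) x) = f (forward x)"
proof
  \<comment> \<open>Any point of \<open>[0, 1)\<close> could stand for the coordinate that does not matter.\<close>
  define f where "f = (\<lambda>z. F ((T ^^ m) (fst z, snd z, 0)))"
  have "(\<lambda>z. (fst z, snd z, 0)) \<in> half_phase \<rightarrow>\<^sub>M borel_phase"
    unfolding borel_phase_def by (intro measurable_Pair measurable_fst measurable_snd measurable_const) simp
  then show "f \<in> borel_measurable half_phase"
    unfolding f_def
    by (rule measurable_compose) (rule measurable_compose[OF measurable_rw_map_iter borel_measurable_cyl[OF F]])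
  show "F ((T ^^ m) x) = f (forward x)" if "x \<in> rw_space" for x
    unfolding f_def using that
    by (cases x, intro cyl_function_forward[OF F]) (auto simp: forward_def in_rw_space)
qed

lemma cyl_function_backward_rep:
  fixes F :: "'d phase \<Rightarrow> real"
  assumes F: "F \<in> borel_measurable (cyl m)"
  obtains f where "f \<in> borel_measurable half_phase" "\<And>x. x \<in> rw_space \<Longrightarrow> F ((rw_inv ^^ m) x) = f (backward x)"
proof
  define f where "f = (\<lambda>z. F ((rw_inv ^^ m) (fst z, 0, snd z)))"
  have "(\<lambda>z. (fst z, 0, snd z)) \<in> half_phase \<rightarrow>\<^sub>M borel_phase"
    unfolding borel_phase_def by (intro measurable_Pair measurable_fst measurable_snd measurable_const) simp
  then show "f \<in> borel_measurable half_phase"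
    unfolding f_def
    by (rule measurable_compose) (rule measurable_compose[OF measurable_rw_inv_iter borel_measurable_cyl[OF F]])
  show "F ((rw_inv ^^ m) x) = f (backward x)" if "x \<in> rw_space" for x
    unfolding f_def using that
    by (cases x, intro cyl_function_backward[OF F]) (auto simp: backward_def in_rw_space)
qed

lemma cyl_algebra_mono_measurable:
  assumes "F \<in> borel_measurable (cyl m)" "m \<le> m'"
  shows "F \<in> borel_measurable (cyl m')"
proof (rule measurableI)
  fix A :: "'a set" assume "A \<in> sets borel"
  from measurable_sets[OF assms(1) this]
  have "F -` A \<inter> rw_space \<in> sigma_sets rw_space (\<Union>k\<in>{- int m..int m}. pulled_cell_sets p b k)"
    by (simp add: space_cyl_algebra sets_cyl_algebra)
  also have "\<dots> \<subseteq> sigma_sets rw_space (\<Union>k\<in>{- int m'..int m'}. pulled_cell_sets p b k)"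
    using assms(2) by (intro sigma_sets_mono' UN_mono) auto
  finally show "F -` A \<inter> space (cyl m') \<in> sets (cyl m')"
    by (simp add: space_cyl_algebra sets_cyl_algebra)
qed simp

lemma Times_unit_square_cyl:
  "(C :: (int ^ 'd) set) \<times> unit_square \<in> sets (cyl m)"
proof -
  have "C \<times> unit_square = rw_iter p b (- 0) ` (C \<times> unit_square)" by (simp add: rw_iter_def)
  then have "C \<times> unit_square \<in> pulled_cell_sets p b 0"
    unfolding pulled_cell_sets_def using cell_sets_Times by blast
  then show ?thesis unfolding sets_cyl_algebra by (intro sigma_sets.Basic UN_I[of 0]) auto
qed

end

section \<open>Correlations of cylinder functions\<close>

context rw_data
begin

definition cell_mean :: "((int ^ 'd) \<times> real \<Rightarrow> real) \<Rightarrow> int ^ 'd \<Rightarrow> real" where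
  "cell_mean f \<alpha> = (\<integral>y. f (\<alpha>, y) \<partial>unit_interval)"

lemma integral_rw_measure:
  assumes "f \<in> borel_measurable (borel_phase :: 'd phase measure)"
  shows "(\<integral>x. f x \<partial>rw_measure) = (\<integral>x. (f x :: real) \<partial>borel_phase)"
  unfolding rw_measure_eq_completion using assms by (rule integral_completion)

lemma integrable_rw_measure:
  assumes "f \<in> borel_measurable (borel_phase :: 'd phase measure)"
  shows "integrable rw_measure (f :: _ \<Rightarrow> real) \<longleftrightarrow> integrable borel_phase f"
  unfolding rw_measure_eq_completion using assms by (rule integrable_completion)

lemma borel_measurable_rw_measure:
  "f \<in> borel_phase \<rightarrow>\<^sub>M N \<Longrightarrow> f \<in> rw_measure \<rightarrow>\<^sub>M N"
  unfolding rw_measure_eq_completion by (rule measurable_completion)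

lemma measurable_forward: "forward \<in> borel_phase \<rightarrow>\<^sub>M half_phase"
  unfolding forward_def[abs_def] by (intro measurable_Pair measurable_coords)

lemma measurable_backward: "backward \<in> borel_phase \<rightarrow>\<^sub>M half_phase"
  unfolding backward_def[abs_def] by (intro measurable_Pair measurable_coords)

lemma measurable_skew: "skew \<in> half_phase \<rightarrow>\<^sub>M half_phase"
  unfolding skew_def split_beta'
  by (intro measurable_Pair measurable_translate_slot measurable_fst measurable_snd
      measurable_compose[OF measurable_snd measurable_expand])

lemma measurable_skew_iter: "skew ^^ n \<in> half_phase \<rightarrow>\<^sub>M half_phase"
  by (induction n) (auto intro: measurable_comp measurable_skew simp del: o_apply)

lemma skew_in: "z \<in> UNIV \<times> {0..<1} \<Longrightarrow> skew z \<in> UNIV \<times> {0..<1}"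
  by (cases z) (auto simp: skew_def expand_in_unit)

lemma skew_iter_in: "z \<in> UNIV \<times> {0..<1} \<Longrightarrow> (skew ^^ n) z \<in> UNIV \<times> {0..<1}"
  by (induction n) (simp_all add: skew_in del: mem_Times_iff SigmaE)

lemma forward_in: "x \<in> rw_space \<Longrightarrow> forward x \<in> UNIV \<times> {0..<1}"
  by (cases x) (auto simp: forward_def in_rw_space)

lemma measurable_section: "f \<in> borel_measurable half_phase \<Longrightarrow> (\<lambda>y. f (\<alpha>, y)) \<in> borel_measurable unit_interval"
  by (erule measurable_Pair2) simp

lemma cell_mean_bounded:
  assumes "f \<in> borel_measurable half_phase" "\<And>z. z \<in> UNIV \<times> {0..<1} \<Longrightarrow> \<bar>f z\<bar> \<le> C"
  shows "\<bar>cell_mean f \<alpha>\<bar> \<le> C"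
proof -
  have i: "integrable unit_interval (\<lambda>y. f (\<alpha>, y))"
    using assms(2) by (intro unit_interval.integrable_const_bound[where B = C] measurable_section assms(1)) (auto intro!: AE_I2)
  have "\<bar>cell_mean f \<alpha>\<bar> \<le> (\<integral>y. \<bar>f (\<alpha>, y)\<bar> \<partial>unit_interval)"
    unfolding cell_mean_def by (rule integral_abs_bound)
  also have "\<dots> \<le> C"
    using i assms(2) by (intro unit_interval.integral_le_const) (auto intro!: AE_I2)
  finally show ?thesis .
qed

text \<open>This is the Markov property: one step of the map, averaged over a cell, is one step of the
random walk.\<close>

lemma cell_mean_skew:
  assumes f: "f \<in> borel_measurable half_phase" and bd: "\<And>z. z \<in> UNIV \<times> {0..<1} \<Longrightarrow> \<bar>f z\<bar> \<le> C"
  shows "cell_mean (\<lambda>z. f (skew z)) = step_mean p (cell_mean f)"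
proof
  fix \<alpha>
  have m: "(\<lambda>y. f (skew (\<alpha>, y))) \<in> borel_measurable unit_interval"
    using measurable_section[OF measurable_compose[OF measurable_skew f]] .
  have bd': "\<bar>f (skew (\<alpha>, y))\<bar> \<le> C" if "y \<in> {0..<1}" for y
    using that by (intro bd skew_in) auto
  have "cell_mean (\<lambda>z. f (skew z)) \<alpha> = (\<integral>k. (\<integral>u. f (skew (\<alpha>, branch k u)) \<partial>unit_interval) \<partial>index_pmf)"
    unfolding cell_mean_def by (rule integral_branch[OF m bd'])
  also have "\<dots> = (\<integral>k. cell_mean f (\<alpha> + b k) \<partial>index_pmf)"
    unfolding cell_mean_def
    by (intro integral_cong_AE)
      (auto simp: AE_measure_pmf_iff set_index_pmf skew_def slot_branch expand_branch intro!: Bochner_Integration.integral_cong)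
  also have "\<dots> = (\<integral>\<beta>. cell_mean f (\<alpha> + \<beta>) \<partial>measure_pmf (map_pmf b index_pmf))"
    by simp
  finally show "cell_mean (\<lambda>z. f (skew z)) \<alpha> = step_mean p (cell_mean f) \<alpha>"
    by (simp add: map_index_pmf step_mean_def)
qed

lemma cell_mean_skew_iter:
  assumes f: "f \<in> borel_measurable half_phase" and bd: "\<And>z. z \<in> UNIV \<times> {0..<1} \<Longrightarrow> \<bar>f z\<bar> \<le> C"
  shows "cell_mean (\<lambda>z. f ((skew ^^ n) z)) = (step_mean p ^^ n) (cell_mean f)"
proof (induction n)
  case (Suc n)
  have "cell_mean (\<lambda>z. f ((skew ^^ n) (skew z))) = step_mean p (cell_mean (\<lambda>z. f ((skew ^^ n) z)))"
    using bd skew_iter_in by (intro cell_mean_skew[where C = C] measurable_compose[OF measurable_skew_iter f]) blast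
  then show ?case using Suc by (simp add: funpow_swap1)
qed simp

lemma integral_borel_phase:
  assumes "integrable (borel_phase :: 'd phase measure) (f :: _ \<Rightarrow> real)"
  shows "(\<integral>x. f x \<partial>borel_phase) = (\<integral>\<alpha>. (\<integral>y. f (\<alpha>, y) \<partial>(unit_interval \<Otimes>\<^sub>M unit_interval)) \<partial>count_space UNIV)"
    "integrable (count_space UNIV) (\<lambda>\<alpha>. \<integral>y. f (\<alpha>, y) \<partial>(unit_interval \<Otimes>\<^sub>M unit_interval))"
    "integrable (unit_interval \<Otimes>\<^sub>M unit_interval) (\<lambda>y. f (\<alpha>, y))"
  using borel_phase.integral_fst'[of f] borel_phase.integrable_fst'[of f] borel_phase.AE_integrable_fst'[of f] assms
  by (simp_all add: borel_phase_def AE_count_space)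

text \<open>Independence of \<open>y\<^sub>1\<close> and \<open>y\<^sub>2\<close> on each cell, in the form of Fubini's theorem.\<close>

lemma integral_forward_backward:
  assumes \<kappa>: "\<kappa> \<in> borel_measurable half_phase" and bd: "\<And>z. z \<in> UNIV \<times> {0..<1} \<Longrightarrow> \<bar>\<kappa> z\<bar> \<le> C"
    and \<gamma>: "\<gamma> \<in> borel_measurable half_phase" and int: "integrable borel_phase (\<lambda>x. \<gamma> (backward x))"
  shows "integrable borel_phase (\<lambda>x. \<kappa> (forward x) * \<gamma> (backward x))"
    "(\<integral>x. \<kappa> (forward x) * \<gamma> (backward x) \<partial>borel_phase) = (\<integral>\<alpha>. cell_mean \<kappa> \<alpha> * cell_mean \<gamma> \<alpha> \<partial>count_space UNIV)"
    "integrable (count_space UNIV) (\<lambda>\<alpha>. cell_mean \<kappa> \<alpha> * cell_mean \<gamma> \<alpha>)"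
proof -
  have m: "(\<lambda>x. \<kappa> (forward x) * \<gamma> (backward x)) \<in> borel_measurable borel_phase"
    by (intro borel_measurable_times measurable_compose[OF measurable_forward \<kappa>] measurable_compose[OF measurable_backward \<gamma>])
  show i: "integrable borel_phase (\<lambda>x. \<kappa> (forward x) * \<gamma> (backward x))"
  proof (rule Bochner_Integration.integrable_bound[OF integrable_mult_right[OF int, of C] m])
    show "AE x in borel_phase. norm (\<kappa> (forward x) * \<gamma> (backward x)) \<le> norm (C * \<gamma> (backward x))"
    proof (rule AE_I2)
      fix x :: "'d phase" assume "x \<in> space borel_phase"
      then have "\<bar>\<kappa> (forward x)\<bar> \<le> C" by (intro bd forward_in) simp
      then show "norm (\<kappa> (forward x) * \<gamma> (backward x)) \<le> norm (C * \<gamma> (backward x))"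
        by (auto simp: abs_mult intro!: mult_right_mono)
    qed
  qed
  have inner: "(\<integral>y. \<kappa> (forward (\<alpha>, y)) * \<gamma> (backward (\<alpha>, y)) \<partial>(unit_interval \<Otimes>\<^sub>M unit_interval)) = cell_mean \<kappa> \<alpha> * cell_mean \<gamma> \<alpha>" for \<alpha>
  proof -
    have "(\<integral>y. \<kappa> (forward (\<alpha>, y)) * \<gamma> (backward (\<alpha>, y)) \<partial>(unit_interval \<Otimes>\<^sub>M unit_interval))
        = (\<integral>y1. (\<integral>y2. \<kappa> (\<alpha>, y1) * \<gamma> (\<alpha>, y2) \<partial>unit_interval) \<partial>unit_interval)"
      using unit_square.integral_fst'[OF integral_borel_phase(3)[OF i, of \<alpha>]] by (simp add: forward_def backward_def)
    then show ?thesis by (simp add: cell_mean_def)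
  qed
  show "(\<integral>x. \<kappa> (forward x) * \<gamma> (backward x) \<partial>borel_phase) = (\<integral>\<alpha>. cell_mean \<kappa> \<alpha> * cell_mean \<gamma> \<alpha> \<partial>count_space UNIV)"
    "integrable (count_space UNIV) (\<lambda>\<alpha>. cell_mean \<kappa> \<alpha> * cell_mean \<gamma> \<alpha>)"
    using integral_borel_phase(1,2)[OF i] by (simp_all add: inner)
qed

text \<open>Bounds \<open>\<Sum>\<alpha>. (\<Phi>(\<alpha>) - L) \<Gamma>(\<alpha>)\<close>, where \<open>\<Phi>\<close> and \<open>\<Gamma>\<close> are the cell means of
\<open>\<kappa>\<close> and \<open>\<gamma>\<close>, by the supremum of the first factor and the \<open>L\<^sup>1\<close> norm of \<open>\<gamma>\<close>.\<close>

lemma correlation_bound: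
  assumes \<kappa>: "\<kappa> \<in> borel_measurable half_phase" and bd: "\<And>z. z \<in> UNIV \<times> {0..<1} \<Longrightarrow> \<bar>\<kappa> z\<bar> \<le> C"
    and \<gamma>: "\<gamma> \<in> borel_measurable half_phase" and int: "integrable borel_phase (\<lambda>x. \<gamma> (backward x))"
    and close: "\<And>\<alpha>. \<bar>cell_mean \<kappa> \<alpha> - L\<bar> \<le> \<epsilon>"
  shows "\<bar>(\<integral>x. \<kappa> (forward x) * \<gamma> (backward x) \<partial>borel_phase) - L * (\<integral>x. \<gamma> (backward x) \<partial>borel_phase)\<bar>
    \<le> \<epsilon> * (\<integral>x. \<bar>\<gamma> (backward x)\<bar> \<partial>borel_phase)"
proof -
  have one: "(\<lambda>_. 1 :: real) \<in> borel_measurable half_phase" by simp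
  have cm1: "cell_mean (\<lambda>_. 1) \<alpha> = 1" for \<alpha> by (simp add: cell_mean_def unit_interval.prob_space[simplified])
  have int': "integrable borel_phase (\<lambda>x. \<bar>\<gamma> (backward x)\<bar>)" using int by simp
  have \<gamma>': "(\<lambda>z. \<bar>\<gamma> z\<bar>) \<in> borel_measurable half_phase" using \<gamma> by simp
  note K = integral_forward_backward[OF \<kappa> bd \<gamma> int]
  note G = integral_forward_backward[OF one _ \<gamma> int, of 1, simplified cm1, simplified]
  note A = integral_forward_backward[OF one _ \<gamma>' int', of 1, simplified cm1, simplified]
  have "(\<integral>x. \<kappa> (forward x) * \<gamma> (backward x) \<partial>borel_phase) - L * (\<integral>x. \<gamma> (backward x) \<partial>borel_phase)
     = (\<integral>\<alpha>. cell_mean \<kappa> \<alpha> * cell_mean \<gamma> \<alpha> - L * cell_mean \<gamma> \<alpha> \<partial>count_space UNIV)"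
    using K G by (simp add: Bochner_Integration.integral_diff)
  also have "\<bar>\<dots>\<bar> \<le> (\<integral>\<alpha>. \<bar>cell_mean \<kappa> \<alpha> * cell_mean \<gamma> \<alpha> - L * cell_mean \<gamma> \<alpha>\<bar> \<partial>count_space UNIV)"
    by (rule integral_abs_bound)
  also have "\<dots> \<le> (\<integral>\<alpha>. \<epsilon> * cell_mean (\<lambda>z. \<bar>\<gamma> z\<bar>) \<alpha> \<partial>count_space UNIV)"
  proof (rule integral_mono)
    show "integrable (count_space UNIV) (\<lambda>\<alpha>. \<bar>cell_mean \<kappa> \<alpha> * cell_mean \<gamma> \<alpha> - L * cell_mean \<gamma> \<alpha>\<bar>)"
      using K G by (intro integrable_abs Bochner_Integration.integrable_diff) auto
    show "integrable (count_space UNIV) (\<lambda>\<alpha>. \<epsilon> * cell_mean (\<lambda>z. \<bar>\<gamma> z\<bar>) \<alpha>)" using A by simp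
    fix \<alpha>
    have "\<bar>cell_mean \<gamma> \<alpha>\<bar> \<le> cell_mean (\<lambda>z. \<bar>\<gamma> z\<bar>) \<alpha>"
      unfolding cell_mean_def by (rule integral_abs_bound)
    then have "\<bar>cell_mean \<kappa> \<alpha> - L\<bar> * \<bar>cell_mean \<gamma> \<alpha>\<bar> \<le> \<epsilon> * cell_mean (\<lambda>z. \<bar>\<gamma> z\<bar>) \<alpha>"
      using close[of \<alpha>] by (intro mult_mono) auto
    then show "\<bar>cell_mean \<kappa> \<alpha> * cell_mean \<gamma> \<alpha> - L * cell_mean \<gamma> \<alpha>\<bar> \<le> \<epsilon> * cell_mean (\<lambda>z. \<bar>\<gamma> z\<bar>) \<alpha>"
      by (simp add: left_diff_distrib[symmetric] abs_mult)
  qed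
  also have "\<dots> = \<epsilon> * (\<integral>x. \<bar>\<gamma> (backward x)\<bar> \<partial>borel_phase)" using A by simp
  finally show ?thesis .
qed

abbreviation mu :: "('d phase \<Rightarrow> real) \<Rightarrow> real" where
  "mu g \<equiv> \<integral>x. g x \<partial>rw_measure"

abbreviation corr :: "('d phase \<Rightarrow> real) \<Rightarrow> nat \<Rightarrow> ('d phase \<Rightarrow> real) \<Rightarrow> real" where
  "corr F n g \<equiv> \<integral>x. F ((T ^^ n) x) * g x \<partial>rw_measure"

text \<open>By invariance of the measure, the correlation of \<open>F \<circ> T\<^sup>n\<close> and \<open>g\<close> equals that of
\<open>F \<circ> T\<^bsup>n-m\<^esup>\<close> and \<open>g \<circ> T\<^bsup>-m\<^esup>\<close>. The first of these is a function of \<open>(\<alpha>, y\<^sub>1)\<close> whose cell means are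
those of \<open>F \<circ> T\<^sup>m\<close> after \<open>n - 2m\<close> steps of the walk, the second is a function of \<open>(\<alpha>, y\<^sub>2)\<close>.\<close>

lemma cyl_correlation:
  assumes F: "F \<in> borel_measurable (cyl m)" and Fb: "\<And>x. x \<in> rw_space \<Longrightarrow> \<bar>F x\<bar> \<le> C"
    and g: "g \<in> borel_measurable (cyl m)" and gi: "integrable rw_measure g"
    and f: "f \<in> borel_measurable half_phase" "\<And>x. x \<in> rw_space \<Longrightarrow> F ((T ^^ m) x) = f (forward x)"
    and n: "2 * m \<le> n" and close: "\<And>\<alpha>. \<bar>(step_mean p ^^ (n - 2 * m)) (cell_mean f) \<alpha> - L\<bar> \<le> \<epsilon>"
  shows "\<bar>corr F n g - L * mu g\<bar> \<le> \<epsilon> * mu (\<lambda>x. \<bar>g x\<bar>)"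
proof -
  obtain h where h: "h \<in> borel_measurable half_phase" "\<And>x. x \<in> rw_space \<Longrightarrow> g ((rw_inv ^^ m) x) = h (backward x)"
    using cyl_function_backward_rep[OF g] by blast
  define \<kappa> where "\<kappa> = (\<lambda>z. f ((skew ^^ (n - 2 * m)) z))"
  have fb: "\<bar>f z\<bar> \<le> C" if zin: "z \<in> UNIV \<times> {0..<1}" for z
  proof -
    obtain \<alpha> y where z: "z = (\<alpha>, y)" "0 \<le> y" "y < 1" using zin by (cases z) auto
    then have "(\<alpha>, y, 0) \<in> rw_space" by (simp add: in_rw_space)
    then show ?thesis
      using f(2)[of "(\<alpha>, y, 0)"] Fb[OF rw_map_iter_in] z by (metis forward_def fst_conv snd_conv)
  qed
  have \<kappa>m: "\<kappa> \<in> borel_measurable half_phase"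
    unfolding \<kappa>_def by (rule measurable_compose[OF measurable_skew_iter f(1)])
  have \<kappa>b: "\<bar>\<kappa> z\<bar> \<le> C" if "z \<in> UNIV \<times> {0..<1}" for z
    unfolding \<kappa>_def using that by (intro fb skew_iter_in)
  have gB: "g \<in> borel_measurable borel_phase" using g by (rule borel_measurable_cyl)
  have hB: "(\<lambda>x. h (backward x)) \<in> borel_measurable borel_phase"
    by (rule measurable_compose[OF measurable_backward h(1)])
  have kB: "(\<lambda>x. \<kappa> (forward x)) \<in> borel_measurable borel_phase"
    by (rule measurable_compose[OF measurable_forward \<kappa>m])
  have g_back: "h (backward ((T ^^ m) x)) = g x" if "x \<in> rw_space" for x
    using h(2)[OF rw_map_iter_in[OF that, of m]] that by (simp add: rw_inv_iter_rw_map_iter)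
  have F_forw: "\<kappa> (forward ((T ^^ m) x)) = F ((T ^^ n) x)" if "x \<in> rw_space" for x
  proof -
    have "\<kappa> (forward ((T ^^ m) x)) = f (forward ((T ^^ (n - 2 * m)) ((T ^^ m) x)))"
      by (simp add: \<kappa>_def forward_rw_map_iter)
    also have "\<dots> = F ((T ^^ m) ((T ^^ (n - 2 * m)) ((T ^^ m) x)))"
      using that by (intro f(2)[symmetric] rw_map_iter_in)
    also have "(T ^^ m) ((T ^^ (n - 2 * m)) ((T ^^ m) x)) = (T ^^ (m + (n - 2 * m) + m)) x"
      by (simp add: funpow_add)
    also have "m + (n - 2 * m) + m = n" using n by simp
    finally show ?thesis .
  qed
  have hi: "integrable borel_phase (\<lambda>x. h (backward x))"
  proof -
    have "integrable rw_measure (\<lambda>x. h (backward ((T ^^ m) x)))"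
      using gi by (rule Bochner_Integration.integrable_cong[THEN iffD1, rotated 2]) (simp_all add: g_back space_rw_measure)
    then have "integrable (distr rw_measure rw_measure (T ^^ m)) (\<lambda>x. h (backward x))"
      by (simp add: integrable_distr_eq[OF measurable_rw_map_iter_rw borel_measurable_rw_measure[OF hB]])
    then show ?thesis by (simp add: distr_rw_map_iter integrable_rw_measure[OF hB])
  qed
  have pull: "(\<integral>x. u x \<partial>borel_phase) = (\<integral>x. u ((T ^^ m) x) \<partial>rw_measure)" if "u \<in> borel_measurable borel_phase" for u :: "'d phase \<Rightarrow> real"
    using integral_rw_map_iter[OF borel_measurable_rw_measure[OF that], of m] integral_rw_measure[OF that] by simp
  have pull': "(\<integral>x. u x \<partial>borel_phase) = (\<integral>x. v x \<partial>rw_measure)"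
    if "u \<in> borel_measurable borel_phase" "\<And>x. x \<in> rw_space \<Longrightarrow> u ((T ^^ m) x) = v x" for u v :: "'d phase \<Rightarrow> real"
    unfolding pull[OF that(1)] using that(2) by (intro Bochner_Integration.integral_cong) (simp_all add: space_rw_measure)
  have "(\<integral>x. \<kappa> (forward x) * h (backward x) \<partial>borel_phase) = corr F n g"
    by (intro pull' borel_measurable_times kB hB) (simp add: F_forw g_back)
  moreover have "(\<integral>x. h (backward x) \<partial>borel_phase) = mu g"
    by (intro pull' hB g_back)
  moreover have "(\<integral>x. \<bar>h (backward x)\<bar> \<partial>borel_phase) = mu (\<lambda>x. \<bar>g x\<bar>)"
    by (intro pull' borel_measurable_abs hB) (simp add: g_back)
  moreover have "\<bar>cell_mean \<kappa> \<alpha> - L\<bar> \<le> \<epsilon>" for \<alpha>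
    unfolding \<kappa>_def using cell_mean_skew_iter[OF f(1) fb, of "n - 2 * m"] close[of \<alpha>] by simp
  ultimately show ?thesis
    using correlation_bound[OF \<kappa>m \<kappa>b h(1) hi, of L \<epsilon>] by simp
qed

end

section \<open>Averages over boxes\<close>

context rw_data
begin

lemma sets_Times_unit_square: "(C :: (int ^ 'd) set) \<times> unit_square \<in> sets borel_phase"
  using Times_unit_square_cyl[of C 0] cyl_algebra_subset_borel by blast

lemma emeasure_Times_unit_square:
  assumes "finite C" shows "emeasure rw_measure ((C :: (int ^ 'd) set) \<times> unit_square) = card C"
proof -
  have us: "unit_square = space (unit_interval \<Otimes>\<^sub>M unit_interval)"
    by (simp add: space_pair_measure unit_square_def)
  have "emeasure rw_measure (C \<times> unit_square) = emeasure borel_phase (C \<times> unit_square)"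
    unfolding rw_measure_eq_completion using sets_Times_unit_square by simp
  also have "\<dots> = emeasure (count_space UNIV) C * emeasure (unit_interval \<Otimes>\<^sub>M unit_interval) unit_square"
    unfolding borel_phase_def us by (rule unit_square.emeasure_pair_measure_Times) auto
  also have "\<dots> = card C"
    using assms by (simp add: us unit_square.emeasure_space_1)
  finally show ?thesis .
qed

lemma measure_Times_unit_square:
  "finite C \<Longrightarrow> measure rw_measure ((C :: (int ^ 'd) set) \<times> unit_square) = card C"
  by (simp add: measure_def emeasure_Times_unit_square)

lemma indicator_Times_unit_square:
  "x \<in> rw_space \<Longrightarrow> indicator (C \<times> unit_square) x = (indicator C (fst x) :: real)"
  by (cases x) (auto simp: rw_space_def indicator_def)

lemma integrable_indicator_box:
  assumes "finite C"
  shows "integrable rw_measure (indicator ((C :: (int ^ 'd) set) \<times> unit_square) :: _ \<Rightarrow> real)"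
proof (rule integrable_real_indicator)
  show "C \<times> unit_square \<in> sets rw_measure"
    using sets_Times_unit_square[of C] by (simp add: rw_measure_eq_completion)
  show "emeasure rw_measure (C \<times> unit_square) < \<infinity>"
    using assms by (simp add: emeasure_Times_unit_square of_nat_less_top)
qed

lemma set_integral_forward:
  assumes f: "f \<in> borel_measurable half_phase" and bd: "\<And>z. z \<in> UNIV \<times> {0..<1} \<Longrightarrow> \<bar>f z\<bar> \<le> D" and C: "finite C"
  shows "(LINT x:C \<times> unit_square|rw_measure. f (forward x)) = (\<Sum>\<alpha>\<in>C. cell_mean f \<alpha>)"
proof -
  define \<gamma> :: "(int ^ 'd) \<times> real \<Rightarrow> real" where "\<gamma> = (\<lambda>z. indicator C (fst z))"
  have \<gamma>: "\<gamma> \<in> borel_measurable half_phase"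
    unfolding \<gamma>_def by (rule measurable_compose[OF measurable_fst]) simp
  have \<gamma>_eq: "indicator (C \<times> unit_square) x = \<gamma> (backward x)" if "x \<in> rw_space" for x
    using that by (simp add: \<gamma>_def backward_def indicator_Times_unit_square)
  have \<gamma>B: "(\<lambda>x. \<gamma> (backward x)) \<in> borel_measurable borel_phase"
    by (rule measurable_compose[OF measurable_backward \<gamma>])
  have int: "integrable borel_phase (\<lambda>x. \<gamma> (backward x))"
    unfolding integrable_rw_measure[OF \<gamma>B, symmetric]
    using integrable_indicator_box[OF C]
    by (rule Bochner_Integration.integrable_cong[THEN iffD1, rotated 2]) (simp_all add: space_rw_measure \<gamma>_eq)
  have m: "(\<lambda>x. f (forward x) * \<gamma> (backward x)) \<in> borel_measurable borel_phase"
    by (intro borel_measurable_times measurable_compose[OF measurable_forward f] \<gamma>B)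
  have "(LINT x:C \<times> unit_square|rw_measure. f (forward x)) = (\<integral>x. f (forward x) * \<gamma> (backward x) \<partial>rw_measure)"
    unfolding set_lebesgue_integral_def
    by (intro Bochner_Integration.integral_cong) (simp_all add: space_rw_measure \<gamma>_eq)
  also have "\<dots> = (\<integral>\<alpha>. cell_mean f \<alpha> * cell_mean \<gamma> \<alpha> \<partial>count_space UNIV)"
    unfolding integrable_rw_measure[OF m] integral_rw_measure[OF m]
    by (rule integral_forward_backward(2)[OF f bd \<gamma> int])
  also have "cell_mean \<gamma> = indicator C"
    by (simp add: fun_eq_iff cell_mean_def \<gamma>_def unit_interval.prob_space[simplified])
  also have "(\<integral>\<alpha>. cell_mean f \<alpha> * indicator C \<alpha> \<partial>count_space UNIV) = (\<Sum>\<alpha>\<in>C. cell_mean f \<alpha> * indicator C \<alpha>)"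
  proof -
    have fin: "finite {\<alpha>. cell_mean f \<alpha> * indicator C \<alpha> \<noteq> 0}"
      by (rule finite_subset[OF _ C]) (auto simp: indicator_def)
    show ?thesis
      using C by (subst lebesgue_integral_count_space_finite_support)
        (auto simp: fin indicator_def intro!: sum.mono_neutral_left)
  qed
  also have "\<dots> = (\<Sum>\<alpha>\<in>C. cell_mean f \<alpha>)" by (intro sum.cong) auto
  finally show ?thesis .
qed

lemma vol_avg_forward:
  assumes "f \<in> borel_measurable half_phase" "\<And>z. z \<in> UNIV \<times> {0..<1} \<Longrightarrow> \<bar>f z\<bar> \<le> D"
  shows "vol_avg (lattice_box \<gamma> r \<times> unit_square) (\<lambda>x. f (forward x)) = box_mean \<gamma> r (cell_mean f)"
  unfolding vol_avg_def box_mean_def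
  by (simp add: set_integral_forward[OF assms finite_lattice_box] measure_Times_unit_square finite_lattice_box)

lemma set_integral_bounded:
  fixes D :: real
  assumes G: "G \<in> borel_measurable (rw_measure :: 'd phase measure)" and bd: "AE x in rw_measure. \<bar>G x\<bar> \<le> D" and C: "finite C"
  shows "set_integrable rw_measure ((C :: (int ^ 'd) set) \<times> unit_square) G"
    "\<bar>LINT x:(C \<times> unit_square)|rw_measure. G x\<bar> \<le> D * card C"
proof -
  have Cm: "C \<times> unit_square \<in> sets rw_measure" using sets_Times_unit_square[of C] by (simp add: rw_measure_eq_completion)
  note ii = integrable_mult_right[OF integrable_indicator_box[OF C], of D]
  have ae: "AE x in rw_measure. \<bar>indicator (C \<times> unit_square) x * G x\<bar> \<le> D * indicator (C \<times> unit_square) x"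
    using bd by eventually_elim (auto simp: indicator_def)
  show i: "set_integrable rw_measure (C \<times> unit_square) G"
    unfolding set_integrable_def
    by (rule Bochner_Integration.integrable_bound[OF ii]) (use G Cm ae in \<open>auto elim: eventually_mono\<close>)
  have "\<bar>LINT x:(C \<times> unit_square)|rw_measure. G x\<bar> \<le> (\<integral>x. \<bar>indicator (C \<times> unit_square) x * G x\<bar> \<partial>rw_measure)"
    unfolding set_lebesgue_integral_def by (simp add: integral_abs_bound)
  also have "\<dots> \<le> (\<integral>x. D * indicator (C \<times> unit_square) x \<partial>rw_measure)"
    using i ii ae by (intro integral_mono_AE) (auto simp: set_integrable_def)
  also have "\<dots> = D * card C"
    using Cm by (simp add: measure_Times_unit_square[OF C])
  finally show "\<bar>LINT x:(C \<times> unit_square)|rw_measure. G x\<bar> \<le> D * card C" .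
qed

abbreviation leak :: "int ^ 'd \<Rightarrow> nat \<Rightarrow> real" where
  "leak \<gamma> r \<equiv> box_mean \<gamma> r (\<lambda>\<alpha>. 1 - step_mean p (indicator (lattice_box \<gamma> r)) \<alpha>)"

text \<open>Since \<open>T\<close> preserves the measure, the difference of the two integrals over \<open>V\<close> is the integral of
\<open>(1\<^sub>V - 1\<^sub>V \<circ> T) (F \<circ> T)\<close>. The sets \<open>V\<close> and \<open>T\<^bsup>-1\<^esup> V\<close> have equal measure, so their
symmetric difference has twice the measure of the part of \<open>V\<close> that leaves \<open>V\<close> in one step; \<open>leak\<close> is the
measure of that part relative to \<open>V\<close>.\<close>

lemma vol_avg_rw_map:
  assumes F: "F \<in> borel_measurable (borel_phase :: 'd phase measure)" and bd: "\<And>x. x \<in> rw_space \<Longrightarrow> \<bar>F x\<bar> \<le> D"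
  shows "\<bar>vol_avg (lattice_box \<gamma> r \<times> unit_square) (\<lambda>x. F (T x)) - vol_avg (lattice_box \<gamma> r \<times> unit_square) F\<bar>
    \<le> 2 * D * leak \<gamma> r"
proof -
  define B where "B = lattice_box \<gamma> r"
  define V where "V = B \<times> unit_square"
  have B: "finite B" "B \<noteq> {}" by (auto simp: B_def finite_lattice_box lattice_box_nonempty)
  have D: "0 \<le> D"
  proof -
    have "(0, 0, 0) \<in> (rw_space :: 'd phase set)" by (simp add: in_rw_space)
    from bd[OF this] show ?thesis by simp
  qed
  have FT: "(\<lambda>x. F (T x)) \<in> borel_measurable borel_phase" by (rule measurable_compose[OF measurable_rw_map F])
  note Frw = borel_measurable_rw_measure[OF F] and FTrw = borel_measurable_rw_measure[OF FT]
  have VB: "V \<in> sets borel_phase" unfolding V_def by (rule sets_Times_unit_square)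
  then have Vrw: "V \<in> sets rw_measure" by (simp add: rw_measure_eq_completion)
  have iV: "integrable rw_measure (indicator V :: _ \<Rightarrow> real)"
    unfolding V_def by (rule integrable_indicator_box[OF B(1)])
  have iVT: "integrable rw_measure (\<lambda>x. indicator V (T x) :: real)"
    using integrable_rw_map_iter[OF iV, of 1] by simp
  have iVV: "integrable rw_measure (\<lambda>x. indicator V x * indicator V (T x) :: real)"
  proof (rule Bochner_Integration.integrable_bound[OF iV])
    show "(\<lambda>x. indicator V x * indicator V (T x) :: real) \<in> borel_measurable rw_measure"
      using iV iVT by (intro borel_measurable_times borel_measurable_integrable)
  qed (auto intro!: AE_I2 simp: indicator_def)
  have mV: "(\<integral>x. indicator V x \<partial>rw_measure) = real (card B)"
    using Vrw by (simp add: V_def measure_Times_unit_square[OF B(1)])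
  have mVT: "(\<integral>x. indicator V (T x) \<partial>rw_measure) = real (card B)"
    using integral_rw_map_iter[of "indicator V" 1] Vrw mV by simp
  have aeb: "AE x in rw_measure. \<bar>F x\<bar> \<le> D" "AE x in rw_measure. \<bar>F (T x)\<bar> \<le> D"
    by (auto intro!: AE_I2 bd rw_map_in simp only: space_rw_measure)
  note siF = set_integral_bounded(1)[OF Frw aeb(1) B(1), folded V_def, unfolded set_integrable_def]
  note siFT = set_integral_bounded(1)[OF FTrw aeb(2) B(1), folded V_def, unfolded set_integrable_def]
  have siFT': "integrable rw_measure (\<lambda>x. indicator V (T x) * F (T x))"
    using integrable_rw_map_iter[OF siF, of 1] by simp
  have "(LINT x:V|rw_measure. F x) = (\<integral>x. indicator V (T x) * F (T x) \<partial>rw_measure)"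
    unfolding set_lebesgue_integral_def
    using integral_rw_map_iter[of "\<lambda>x. indicator V x * F x" 1] Frw Vrw by simp
  then have "(LINT x:V|rw_measure. F (T x)) - (LINT x:V|rw_measure. F x)
      = (\<integral>x. indicator V x * F (T x) - indicator V (T x) * F (T x) \<partial>rw_measure)"
    using siFT siFT' by (simp add: set_lebesgue_integral_def)
  also have "\<bar>\<dots>\<bar> \<le> (\<integral>x. \<bar>indicator V x * F (T x) - indicator V (T x) * F (T x)\<bar> \<partial>rw_measure)"
    by (rule integral_abs_bound)
  also have "\<dots> \<le> (\<integral>x. D * (indicator V x + indicator V (T x) - 2 * (indicator V x * indicator V (T x))) \<partial>rw_measure)"
  proof (rule integral_mono_AE)
    show "AE x in rw_measure. \<bar>indicator V x * F (T x) - indicator V (T x) * F (T x)\<bar>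
      \<le> D * (indicator V x + indicator V (T x) - 2 * (indicator V x * indicator V (T x)))"
      using aeb(2) by eventually_elim (auto simp: indicator_def D)
    show "integrable rw_measure (\<lambda>x. D * (indicator V x + indicator V (T x) - 2 * (indicator V x * indicator V (T x))))"
      using iV iVT iVV by simp
    show "integrable rw_measure (\<lambda>x. \<bar>indicator V x * F (T x) - indicator V (T x) * F (T x)\<bar>)"
      using siFT siFT' by simp
  qed
  also have "\<dots> = D * (2 * card B - 2 * (\<integral>x. indicator V x * indicator V (T x) \<partial>rw_measure))"
    using iV iVT iVV mV mVT by simp
  also have "(\<integral>x. indicator V x * indicator V (T x) \<partial>rw_measure) = (\<Sum>\<alpha>\<in>B. step_mean p (indicator B) \<alpha>)"
  proof -
    define h :: "(int ^ 'd) \<times> real \<Rightarrow> real" where "h = (\<lambda>z. indicator B (fst z))"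
    have h: "h \<in> borel_measurable half_phase"
      unfolding h_def by (rule measurable_compose[OF measurable_fst]) simp
    have hb: "\<bar>h z\<bar> \<le> 1" for z by (simp add: h_def indicator_def)
    have "cell_mean h = indicator B"
      by (simp add: fun_eq_iff cell_mean_def h_def unit_interval.prob_space[simplified])
    then have cm: "cell_mean (\<lambda>z. h (skew z)) = step_mean p (indicator B)"
      using cell_mean_skew[OF h hb] by simp
    have hT: "h (skew (forward x)) = indicator B (fst (T x))" for x
      by (simp add: h_def forward_rw_map[symmetric]) (simp add: forward_def)
    have "(\<integral>x. indicator V x * indicator V (T x) \<partial>rw_measure) = (LINT x:B \<times> unit_square|rw_measure. h (skew (forward x)))"
      unfolding set_lebesgue_integral_def V_def
      by (intro Bochner_Integration.integral_cong)
        (simp_all add: space_rw_measure indicator_Times_unit_square rw_map_in hT)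
    also have "\<dots> = (\<Sum>\<alpha>\<in>B. step_mean p (indicator B) \<alpha>)"
      using set_integral_forward[OF measurable_compose[OF measurable_skew h] hb B(1)] by (simp add: cm)
    finally show ?thesis .
  qed
  also have "D * (2 * card B - 2 * (\<Sum>\<alpha>\<in>B. step_mean p (indicator B) \<alpha>)) = 2 * D * (\<Sum>\<alpha>\<in>B. 1 - step_mean p (indicator B) \<alpha>)"
    by (simp add: sum_subtractf algebra_simps)
  finally show ?thesis
    unfolding vol_avg_def box_mean_def B_def[symmetric] V_def[symmetric]
    by (simp add: V_def measure_Times_unit_square[OF B(1)] diff_divide_distrib[symmetric] divide_right_mono)
qed

lemma vol_avg_rw_map_iter:
  assumes F: "F \<in> borel_measurable (borel_phase :: 'd phase measure)" and bd: "\<And>x. x \<in> rw_space \<Longrightarrow> \<bar>F x\<bar> \<le> D"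
  shows "\<bar>vol_avg (lattice_box \<gamma> r \<times> unit_square) (\<lambda>x. F ((T ^^ m) x)) - vol_avg (lattice_box \<gamma> r \<times> unit_square) F\<bar>
    \<le> real m * (2 * D * leak \<gamma> r)"
proof (induction m)
  case (Suc m)
  have "(\<lambda>x. F ((T ^^ m) x)) \<in> borel_measurable borel_phase"
    by (rule measurable_compose[OF measurable_rw_map_iter F])
  from vol_avg_rw_map[OF this bd[OF rw_map_iter_in], of \<gamma> r]
  show ?case using Suc by (simp add: funpow_swap1 algebra_simps)
qed simp

text \<open>All but a small part of the step distribution lives on a box of some radius \<open>R\<close>. Such steps
cannot leave the box of radius \<open>r\<close> from a point of the concentric box of radius \<open>r - R\<close>, and the
latter has almost the same cardinality when \<open>r\<close> is large.\<close>

lemma box_mean_leak: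
  assumes "\<epsilon> > 0"
  shows "\<exists>r0. \<forall>r\<ge>r0. \<forall>\<gamma>. leak \<gamma> r \<le> \<epsilon>"
proof -
  have "(\<lambda>R. measure (measure_pmf p) (lattice_box 0 R)) \<longlonglongrightarrow> measure (measure_pmf p) (\<Union>R. lattice_box 0 R)"
  proof (intro measure_pmf.finite_Lim_measure_incseq)
    show "incseq (\<lambda>R. lattice_box (0 :: int ^ 'd) R)" by (simp add: incseq_def lattice_box_mono)
  qed auto
  also have "(\<Union>R. lattice_box 0 R) = (UNIV :: (int ^ 'd) set)"
  proof -
    have "v \<in> lattice_box 0 (\<Sum>i\<in>UNIV. nat \<bar>v $ i\<bar>)" for v :: "int ^ 'd"
    proof -
      have "nat \<bar>v $ i\<bar> \<le> (\<Sum>i\<in>UNIV. nat \<bar>v $ i\<bar>)" for i by (rule member_le_sum) auto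
      then have "\<bar>v $ i\<bar> \<le> int (\<Sum>i\<in>UNIV. nat \<bar>v $ i\<bar>)" for i by (metis nat_le_iff)
      then show ?thesis unfolding lattice_box_def by (auto simp: abs_le_iff minus_le_iff simp del: of_nat_sum)
    qed
    then show ?thesis by blast
  qed
  finally have "\<forall>\<^sub>F R in sequentially. 1 - \<epsilon> / 2 < measure (measure_pmf p) (lattice_box 0 R)"
    using assms by (intro order_tendstoD) auto
  then obtain R where R: "1 - \<epsilon> / 2 < measure (measure_pmf p) (lattice_box 0 R)"
    by (auto simp: eventually_sequentially)
  let ?d = "CARD('d)"
  obtain r1 :: nat where r1: "real ?d * (2 * R) / (\<epsilon> / 2) < real r1" using reals_Archimedean2 by blast
  show ?thesis
  proof (intro exI[of _ "max R r1"] allI impI)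
    fix r :: nat and \<gamma> :: "int ^ 'd" assume r: "max R r1 \<le> r"
    define B where "B = lattice_box \<gamma> r"
    define B' where "B' = lattice_box \<gamma> (r - R)"
    have fin: "finite B" "finite B'" by (auto simp: B_def B'_def finite_lattice_box)
    have sub: "B' \<subseteq> B" unfolding B_def B'_def by (rule lattice_box_mono) simp
    have cB: "card B > 0" by (simp add: B_def card_lattice_box)
    have ind: "\<bar>indicator B x :: real\<bar> \<le> 1" for x by (simp add: indicator_def)
    have sm: "\<bar>step_mean p (indicator B) \<alpha>\<bar> \<le> 1" for \<alpha> by (rule step_mean_bounded[OF ind])
    have sm0: "0 \<le> step_mean p (indicator B) \<alpha>" for \<alpha> unfolding step_mean_def by (intro integral_nonneg_AE) auto
    have inner: "1 - step_mean p (indicator B) \<alpha> \<le> \<epsilon> / 2" if "\<alpha> \<in> B'" for \<alpha>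
    proof -
      have "measure (measure_pmf p) (lattice_box 0 R) = measure_pmf.expectation p (indicator (lattice_box 0 R))" by simp
      also have "\<dots> \<le> step_mean p (indicator B) \<alpha>"
        unfolding step_mean_def
      proof (rule integral_mono)
        show "indicator (lattice_box 0 R) \<beta> \<le> (indicator B (\<alpha> + \<beta>) :: real)" for \<beta>
        proof -
          have "\<alpha> + \<beta> \<in> B" if "\<beta> \<in> lattice_box 0 R"
            using that \<open>\<alpha> \<in> B'\<close> r unfolding B_def B'_def lattice_box_def
            by (simp add: of_nat_diff) (smt (verit))
          then show ?thesis by (auto simp: indicator_def)
        qed
      qed (auto intro!: integrable_pmf_bounded[where C = 1] simp: indicator_def)
      finally show ?thesis using R by simp
    qed
    have "(\<Sum>\<alpha>\<in>B. 1 - step_mean p (indicator B) \<alpha>)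
        = (\<Sum>\<alpha>\<in>B'. 1 - step_mean p (indicator B) \<alpha>) + (\<Sum>\<alpha>\<in>B - B'. 1 - step_mean p (indicator B) \<alpha>)"
      using sum.subset_diff[OF sub fin(1)] by (simp add: add.commute)
    also have "\<dots> \<le> (\<Sum>\<alpha>\<in>B'. \<epsilon> / 2) + (\<Sum>\<alpha>\<in>B - B'. 1)"
      using inner sm0 by (intro add_mono sum_mono) auto
    also have "\<dots> = card B' * (\<epsilon> / 2) + (real (card B) - real (card B'))"
      using fin sub by (simp add: card_Diff_subset of_nat_diff card_mono)
    also have "\<dots> \<le> card B * (\<epsilon> / 2) + (real (card B) - real (card B'))"
      using card_mono[OF fin(1) sub] assms by (intro add_right_mono mult_right_mono) auto
    also have "real (card B) - real (card B') \<le> card B * (\<epsilon> / 2)"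
    proof -
      \<comment> \<open>\<open>1 + x\<close> is the ratio of the side lengths; Bernoulli's inequality bounds the ratio of the volumes.\<close>
      define x where "x = - (2 * real R) / (2 * real r + 1)"
      have x: "- 1 \<le> x" using r by (simp add: x_def field_simps)
      have "real (card B') = (2 * real r + 1 - 2 * real R) ^ ?d"
        using r by (simp add: B'_def card_lattice_box of_nat_diff algebra_simps)
      also have "2 * real r + 1 - 2 * real R = (1 + x) * (2 * real r + 1)"
        by (simp add: x_def field_simps)
      finally have cB': "real (card B') = (1 + x) ^ ?d * real (card B)"
        by (simp add: power_mult_distrib B_def card_lattice_box add.commute)
      have "1 + real ?d * x \<le> (1 + x) ^ ?d" by (rule Bernoulli_inequality[OF x])
      moreover have "- (real ?d * x) \<le> \<epsilon> / 2"
      proof -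
        have "real ?d * (2 * real R) \<le> \<epsilon> / 2 * real r1" using r1 assms by (simp add: field_simps)
        also have "\<dots> \<le> \<epsilon> / 2 * (2 * real r + 1)" using r assms by (intro mult_left_mono) auto
        finally show ?thesis by (simp add: x_def field_simps)
      qed
      ultimately have "1 - (1 + x) ^ ?d \<le> \<epsilon> / 2" by linarith
      then have "(1 - (1 + x) ^ ?d) * card B \<le> \<epsilon> / 2 * card B" by (intro mult_right_mono) auto
      then show ?thesis by (simp add: cB' algebra_simps)
    qed
    finally have "(\<Sum>\<alpha>\<in>B. 1 - step_mean p (indicator B) \<alpha>) \<le> card B * \<epsilon>" by (simp add: algebra_simps)
    then show "leak \<gamma> r \<le> \<epsilon>"
      unfolding box_mean_def B_def[symmetric] using cB by (simp add: field_simps)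
  qed
qed

lemma forward_rep_bounded:
  assumes Fb: "\<And>x. x \<in> rw_space \<Longrightarrow> \<bar>F x\<bar> \<le> D"
    and f: "\<And>x. x \<in> rw_space \<Longrightarrow> F ((T ^^ m) x) = f (forward x)" and z: "z \<in> UNIV \<times> {0..<1}"
  shows "\<bar>f z\<bar> \<le> (D :: real)"
proof -
  have "(fst z, snd z, 0) \<in> rw_space" using z by (cases z) (simp add: in_rw_space)
  then show ?thesis
    using f[of "(fst z, snd z, 0)"] Fb[OF rw_map_iter_in, of "(fst z, snd z, 0)" m] by (simp add: forward_def)
qed

lemma measure_box_ge:
  "real r \<le> measure rw_measure (lattice_box (\<gamma> :: int ^ 'd) r \<times> unit_square)"
proof -
  have "r \<le> (2 * r + 1) ^ 1" by simp
  also have "\<dots> \<le> (2 * r + 1) ^ CARD('d)" by (intro power_increasing) (auto simp: Suc_le_eq)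
  finally show ?thesis
    by (simp add: measure_Times_unit_square finite_lattice_box card_lattice_box del: of_nat_power)
qed

lemma box_in_exh_family: "1 \<le> r \<Longrightarrow> lattice_box \<gamma> r \<times> unit_square \<in> exh_family"
  by (auto simp: exh_family_def)

text \<open>Needed for limits along the exhaustive family to be unique.\<close>

lemma exh_filter_nontrivial: "(exh_filter :: 'd phase set filter) \<noteq> bot"
proof
  assume "(exh_filter :: 'd phase set filter) = bot"
  then have "eventually (\<lambda>V :: 'd phase set. False) exh_filter" by simp
  then obtain M where M: "\<And>V :: 'd phase set. V \<in> exh_family \<Longrightarrow> \<not> M \<le> measure rw_measure V"
    unfolding eventually_exh_filter by auto
  obtain r :: nat where "M < real r" using reals_Archimedean2 by blast
  then have "M \<le> measure rw_measure (lattice_box (0 :: int ^ 'd) (max 1 r) \<times> unit_square)"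
    using measure_box_ge[of "max 1 r" 0] by linarith
  then show False using M[OF box_in_exh_family[of "max 1 r" 0]] by simp
qed

lemma box_mean_cell_mean:
  assumes Fb: "\<And>x. x \<in> rw_space \<Longrightarrow> \<bar>F x\<bar> \<le> D"
    and f: "f \<in> borel_measurable half_phase" "\<And>x. x \<in> rw_space \<Longrightarrow> F ((T ^^ m) x) = f (forward x)"
  shows "box_mean \<gamma> r (cell_mean f) = vol_avg (lattice_box \<gamma> r \<times> unit_square) (\<lambda>x. F ((T ^^ m) x))"
proof -
  have "vol_avg (lattice_box \<gamma> r \<times> unit_square) (\<lambda>x. F ((T ^^ m) x)) = vol_avg (lattice_box \<gamma> r \<times> unit_square) (\<lambda>x. f (forward x))"
    unfolding vol_avg_def set_lebesgue_integral_def
    by (intro arg_cong2[where f = "(/)"] Bochner_Integration.integral_cong refl) (simp add: space_rw_measure f(2))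
  then show ?thesis using vol_avg_forward[OF f(1) forward_rep_bounded[where F = F and f = f and m = m, OF Fb f(2)]] by simp
qed

text \<open>A large box meets two demands at once: the average of \<open>F\<close> over it is close to \<open>L\<close>, wherever
its centre is, and little mass leaves it in \<open>m\<close> steps.\<close>

lemma uniform_box_mean:
  assumes F: "F \<in> borel_measurable (borel_phase :: 'd phase measure)" and Fb: "\<And>x. x \<in> rw_space \<Longrightarrow> \<bar>F x\<bar> \<le> D"
    and lim: "((\<lambda>V. vol_avg V F) \<longlongrightarrow> L) exh_filter"
    and f: "f \<in> borel_measurable half_phase" "\<And>x. x \<in> rw_space \<Longrightarrow> F ((T ^^ m) x) = f (forward x)"
    and "\<epsilon> > 0"
  shows "\<exists>r. \<forall>\<gamma>. \<bar>box_mean \<gamma> r (cell_mean f) - L\<bar> \<le> \<epsilon>"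
proof -
  have D: "0 \<le> D" using Fb[of "(0, 0, 0)"] by (simp add: in_rw_space)
  have "\<forall>\<^sub>F V in exh_filter. dist (vol_avg V F) L < \<epsilon> / 2"
    using lim \<open>\<epsilon> > 0\<close> by (intro tendstoD) auto
  then obtain M where M: "\<And>V. V \<in> exh_family \<Longrightarrow> M \<le> measure rw_measure V \<Longrightarrow> \<bar>vol_avg V F - L\<bar> < \<epsilon> / 2"
    unfolding eventually_exh_filter dist_real_def by blast
  \<comment> \<open>The summand \<open>1\<close> avoids division by zero when \<open>m\<close> or \<open>D\<close> vanishes.\<close>
  define \<delta> where "\<delta> = \<epsilon> / (2 * (real m * (2 * D) + 1))"
  have den: "2 * (real m * (2 * D) + 1) > 0" using D by (simp add: add_nonneg_pos)
  then have "\<delta> > 0" using \<open>\<epsilon> > 0\<close> by (simp add: \<delta>_def)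
  from box_mean_leak[OF this] obtain r0 where r0: "\<And>r \<gamma>. r \<ge> r0 \<Longrightarrow>
      leak \<gamma> r \<le> \<delta>" by blast
  obtain r1 :: nat where r1: "M < real r1" using reals_Archimedean2 by blast
  define r where "r = max 1 (max r0 r1)"
  show ?thesis
  proof (intro exI[of _ r] allI)
    fix \<gamma> :: "int ^ 'd"
    define V where "V = lattice_box \<gamma> r \<times> unit_square"
    have 1: "\<bar>vol_avg V F - L\<bar> < \<epsilon> / 2"
      unfolding V_def
    proof (rule M)
      show "lattice_box \<gamma> r \<times> unit_square \<in> exh_family" by (rule box_in_exh_family) (simp add: r_def)
      have "M \<le> real r" using r1 by (simp add: r_def)
      then show "M \<le> measure rw_measure (lattice_box \<gamma> r \<times> unit_square)" using measure_box_ge[of r \<gamma>] by linarith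
    qed
    have "\<bar>vol_avg V (\<lambda>x. F ((T ^^ m) x)) - vol_avg V F\<bar>
        \<le> real m * (2 * D * leak \<gamma> r)"
      unfolding V_def by (rule vol_avg_rw_map_iter[OF F Fb])
    also have "\<dots> \<le> real m * (2 * D * \<delta>)"
      using D r0[of r \<gamma>] by (intro mult_left_mono) (auto simp: r_def)
    also have "\<dots> \<le> (real m * (2 * D) + 1) * \<delta>" using \<open>\<delta> > 0\<close> by (simp add: algebra_simps)
    also have "\<dots> = \<epsilon> / 2" using den by (simp add: \<delta>_def field_simps)
    finally show "\<bar>box_mean \<gamma> r (cell_mean f) - L\<bar> \<le> \<epsilon>"
      using 1 box_mean_cell_mean[OF Fb f, of \<gamma> r] unfolding V_def by linarith
  qed
qed

end

locale mixing_rw = rw_data p b for p :: "(int ^ ('d::finite)) pmf" and b +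
  fixes a
  assumes a: "a \<in> set_pmf p" and span: "int_span {c - a | c. c \<in> set_pmf p} = UNIV"
begin

lemma cell_mean_uniform_limit:
  assumes F: "F \<in> borel_measurable (borel_phase :: 'd phase measure)" and Fb: "\<And>x. x \<in> rw_space \<Longrightarrow> \<bar>F x\<bar> \<le> D"
    and lim: "((\<lambda>V. vol_avg V F) \<longlongrightarrow> L) exh_filter"
    and f: "f \<in> borel_measurable half_phase" "\<And>x. x \<in> rw_space \<Longrightarrow> F ((T ^^ m) x) = f (forward x)"
    and "\<epsilon> > 0"
  shows "\<exists>N. \<forall>n\<ge>N. \<forall>\<alpha>. \<bar>(step_mean p ^^ n) (cell_mean f) \<alpha> - L\<bar> \<le> \<epsilon>"
  by (rule step_mean_iter_uniform_limit[OF cell_mean_bounded[OF f(1) forward_rep_bounded[where F = F and f = f and m = m, OF Fb f(2)]] a span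
        uniform_box_mean[OF F Fb lim f] \<open>\<epsilon> > 0\<close>])

lemma bounded_cyl_correlation_rate:
  assumes F: "F \<in> borel_measurable (cyl m)" and Fb: "\<And>x. x \<in> rw_space \<Longrightarrow> \<bar>F x\<bar> \<le> D"
    and lim: "((\<lambda>V. vol_avg V F) \<longlongrightarrow> L) exh_filter" and "\<epsilon> > 0"
  shows "\<exists>N. \<forall>n\<ge>N. \<forall>g\<in>local_obs_m p b m.
    \<bar>corr F n g - L * mu g\<bar> \<le> \<epsilon> * mu (\<lambda>x. \<bar>g x\<bar>)"
proof -
  obtain f where f: "f \<in> borel_measurable half_phase" "\<And>x. x \<in> rw_space \<Longrightarrow> F ((T ^^ m) x) = f (forward x)"
    using cyl_function_forward_rep[OF F] by blast
  obtain N where N: "\<And>n \<alpha>. n \<ge> N \<Longrightarrow> \<bar>(step_mean p ^^ n) (cell_mean f) \<alpha> - L\<bar> \<le> \<epsilon>"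
    using cell_mean_uniform_limit[OF borel_measurable_cyl[OF F] Fb lim f \<open>\<epsilon> > 0\<close>] by blast
  show ?thesis
  proof (intro exI[of _ "N + 2 * m"] allI impI ballI)
    fix n g assume n: "N + 2 * m \<le> n" and g: "g \<in> local_obs_m p b m"
    then show "\<bar>corr F n g - L * mu g\<bar> \<le> \<epsilon> * mu (\<lambda>x. \<bar>g x\<bar>)"
      by (intro cyl_correlation[OF F Fb _ _ f] N) (auto simp: local_obs_m_def L1_class_def)
  qed
qed

end

context rw_data
begin

lemma Linf_bound:
  fixes F :: "'d phase \<Rightarrow> real"
  assumes "Linf_norm F < \<infinity>"
  obtains D where "0 \<le> D" "AE x in rw_measure. \<bar>F x\<bar> \<le> D"
proof -
  have ae: "AE x in rw_measure. ereal \<bar>F x\<bar> \<le> Linf_norm F"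
    unfolding Linf_norm_def by (rule esssup_AE)
  show ?thesis
  proof (cases "Linf_norm F")
    case (real r)
    then have "AE x in rw_measure. \<bar>F x\<bar> \<le> max 0 r" using ae by (auto elim: eventually_mono)
    then show ?thesis using that[of "max 0 r"] by simp
  next
    case MInf
    then have "AE x in rw_measure. \<bar>F x\<bar> \<le> 0" using ae by (auto elim: eventually_mono)
    then show ?thesis using that[of 0] by simp
  qed (use assms in simp)
qed

text \<open>Truncation gives a representative of an \<open>L\<^sup>\<infinity>\<close> class that is bounded everywhere, while it keeps
measurability for every \<open>\<sigma>\<close>-algebra and periodicity.\<close>

definition clip :: "real \<Rightarrow> ('d phase \<Rightarrow> real) \<Rightarrow> 'd phase \<Rightarrow> real" where
  "clip D F = (\<lambda>x. max (- D) (min D (F x)))"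

lemma clip_bounded: "0 \<le> D \<Longrightarrow> \<bar>clip D F x\<bar> \<le> D"
  by (auto simp: clip_def)

lemma clip_measurable: "F \<in> borel_measurable M \<Longrightarrow> clip D F \<in> borel_measurable M"
  unfolding clip_def by (intro borel_measurable_max borel_measurable_min) auto

lemma clip_AE:
  assumes "AE x in rw_measure. \<bar>F x\<bar> \<le> D" shows "AE x in rw_measure. F x = clip D F x"
  using assms by eventually_elim (auto simp: clip_def)

lemma borel_measurable_cyl_rw:
  "F \<in> borel_measurable (cyl_algebra p b l m) \<Longrightarrow> F \<in> borel_measurable rw_measure"
  by (intro borel_measurable_rw_measure borel_measurable_cyl)

lemma exh_family_measurable: "V \<in> exh_family \<Longrightarrow> (V :: 'd phase set) \<in> sets rw_measure"
  using sets_Times_unit_square by (auto simp: exh_family_def rw_measure_eq_completion)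

lemma vol_avg_cong_AE:
  assumes "AE x in rw_measure. F x = G x" "F \<in> borel_measurable rw_measure" "G \<in> borel_measurable rw_measure"
    "V \<in> sets (rw_measure :: 'd phase measure)"
  shows "vol_avg V F = vol_avg V G"
proof -
  have "(LINT x:V|rw_measure. F x) = (LINT x:V|rw_measure. G x)"
    unfolding set_lebesgue_integral_def using assms
    by (intro integral_cong_AE) (auto elim: eventually_mono)
  then show ?thesis by (simp add: vol_avg_def)
qed

lemma inf_avg_eqI: "((\<lambda>V. vol_avg V F) \<longlongrightarrow> L) (exh_filter :: 'd phase set filter) \<Longrightarrow> inf_avg F = L"
  unfolding inf_avg_def by (rule tendsto_Lim[OF exh_filter_nontrivial])

lemma inf_avg_tendsto:
  "inf_avg_exists (F :: 'd phase \<Rightarrow> real) \<Longrightarrow> ((\<lambda>V. vol_avg V F) \<longlongrightarrow> inf_avg F) exh_filter"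
  using inf_avg_eqI by (auto simp: inf_avg_exists_def)

lemma tendsto_vol_avg_cong_AE:
  assumes "AE x in rw_measure. F x = G x" "F \<in> borel_measurable rw_measure" "G \<in> borel_measurable rw_measure"
    and lim: "((\<lambda>V. vol_avg V F) \<longlongrightarrow> L) (exh_filter :: 'd phase set filter)"
  shows "((\<lambda>V. vol_avg V G) \<longlongrightarrow> L) exh_filter"
proof (rule Lim_transform_eventually[OF lim])
  show "\<forall>\<^sub>F V in exh_filter. vol_avg V F = vol_avg V G"
    unfolding eventually_exh_filter
    by (intro exI[of _ 1] conjI ballI impI vol_avg_cong_AE[OF assms(1-3)] exh_family_measurable) simp_all
qed

lemma integral_correlation_cong_AE:
  assumes "AE x in rw_measure. F x = G x" "F \<in> borel_measurable rw_measure" "G \<in> borel_measurable rw_measure"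
    and g: "g \<in> borel_measurable (rw_measure :: 'd phase measure)"
  shows "corr F n g = (\<integral>x. (G ((T ^^ n) x) * g x :: real) \<partial>rw_measure)"
proof (rule integral_cong_AE)
  show "AE x in rw_measure. F ((T ^^ n) x) * g x = G ((T ^^ n) x) * g x"
    using AE_rw_map_iter[OF assms(1), of n] by eventually_elim simp
qed (intro borel_measurable_times measurable_compose[OF measurable_rw_map_iter_rw] assms)+

lemma global_obs_mE:
  assumes "F \<in> global_obs_m p b m"
  obtains D F' where "0 \<le> D" "F' = clip D F" "F' \<in> borel_measurable (cyl m)" "\<And>x. \<bar>F' x\<bar> \<le> D"
    "AE x in rw_measure. F x = F' x" "((\<lambda>V. vol_avg V F') \<longlongrightarrow> inf_avg F) exh_filter"
    "F \<in> borel_measurable (cyl m)"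
proof -
  have F: "F \<in> borel_measurable (cyl m)" "Linf_norm F < \<infinity>" "inf_avg_exists F"
    using assms by (auto simp: global_obs_m_def Linf_class_def)
  obtain D where D: "0 \<le> D" "AE x in rw_measure. \<bar>F x\<bar> \<le> D" using Linf_bound[OF F(2)] by blast
  note ae = clip_AE[OF D(2)] and m = clip_measurable[OF F(1), of D]
  show ?thesis
    by (rule that[OF D(1) refl m clip_bounded[OF D(1)] ae _ F(1)])
      (rule tendsto_vol_avg_cong_AE[OF ae borel_measurable_cyl_rw[OF F(1)] borel_measurable_cyl_rw[OF m] inf_avg_tendsto[OF F(3)]])
qed

end

context mixing_rw
begin

text \<open>The quantitative form of (a). It also controls the averages over the sets \<open>V\<close> in (c),
because \<open>N\<close> does not depend on \<open>g\<close>.\<close>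

lemma cyl_correlation_rate:
  assumes F: "F \<in> global_obs_m p b m" and "\<epsilon> > 0"
  shows "\<exists>N. \<forall>n\<ge>N. \<forall>g\<in>local_obs_m p b m.
    \<bar>corr F n g - inf_avg F * mu g\<bar> \<le> \<epsilon> * mu (\<lambda>x. \<bar>g x\<bar>)"
proof -
  obtain D F' where "0 \<le> D" "F' = clip D F" and F': "F' \<in> borel_measurable (cyl m)" "\<And>x. \<bar>F' x\<bar> \<le> D"
    "AE x in rw_measure. F x = F' x" "((\<lambda>V. vol_avg V F') \<longlongrightarrow> inf_avg F) exh_filter"
    and Fm: "F \<in> borel_measurable (cyl m)"
    by (rule global_obs_mE[OF F]) (rule that)
  have "corr F n g = corr F' n g"
    if "g \<in> local_obs_m p b m" for g n
    using that by (intro integral_correlation_cong_AE F'(3) borel_measurable_cyl_rw[OF Fm] borel_measurable_cyl_rw[OF F'(1)])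
      (auto simp: local_obs_m_def L1_class_def)
  then show ?thesis
    using bounded_cyl_correlation_rate[OF F'(1,2,4) \<open>\<epsilon> > 0\<close>] by simp
qed

end

section \<open>Equidistribution on arbitrary integrable functions\<close>

text \<open>Weak convergence of \<open>\<kappa> n\<close> to the constant \<open>L\<close>, tested against one function.\<close>

definition averages_to :: "'a measure \<Rightarrow> (nat \<Rightarrow> 'a \<Rightarrow> real) \<Rightarrow> real \<Rightarrow> ('a \<Rightarrow> real) \<Rightarrow> bool" where
  "averages_to M \<kappa> L h \<longleftrightarrow> integrable M h \<and> (\<lambda>n. \<integral>x. \<kappa> n x * h x \<partial>M) \<longlonglongrightarrow> L * (\<integral>x. h x \<partial>M)"

lemma integrable_bounded_mult:
  fixes h \<kappa> :: "'a \<Rightarrow> real"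
  assumes "integrable M h" "\<kappa> \<in> borel_measurable M" "\<And>x. x \<in> space M \<Longrightarrow> \<bar>\<kappa> x\<bar> \<le> D"
  shows "integrable M (\<lambda>x. \<kappa> x * h x)"
proof (rule Bochner_Integration.integrable_bound[OF integrable_mult_right[OF assms(1), of D]])
  show "AE x in M. norm (\<kappa> x * h x) \<le> norm (D * h x)"
  proof (rule AE_I2)
    fix x assume "x \<in> space M"
    from assms(3)[OF this] show "norm (\<kappa> x * h x) \<le> norm (D * h x)"
      by (auto simp: abs_mult intro!: mult_right_mono)
  qed
qed (use assms in simp)

text \<open>The functionals \<open>h \<mapsto> \<integral>\<kappa> n * h\<close> are equicontinuous in \<open>L\<^sup>1\<close> because the
\<open>\<kappa> n\<close> are uniformly bounded, so the set of good test functions is closed.\<close>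

lemma averages_to_closure:
  assumes \<kappa>: "\<And>n. \<kappa> n \<in> borel_measurable M" and bd: "\<And>n x. x \<in> space M \<Longrightarrow> \<bar>\<kappa> n x\<bar> \<le> D"
    and h: "\<And>k. averages_to M \<kappa> L (h k)" and g: "integrable M g" and u: "integrable M u"
    and lim: "\<And>x. x \<in> space M \<Longrightarrow> (\<lambda>k. h k x) \<longlonglongrightarrow> g x"
    and dom: "\<And>k x. x \<in> space M \<Longrightarrow> \<bar>h k x\<bar> \<le> u x"
  shows "averages_to M \<kappa> L g"
proof -
  have hi: "integrable M (h k)" for k using h by (simp add: averages_to_def)
  have "(\<lambda>k. \<integral>x. \<bar>h k x - g x\<bar> \<partial>M) \<longlonglongrightarrow> (\<integral>x. 0 \<partial>M)"
  proof (rule integral_dominated_convergence[where w = "\<lambda>x. u x + \<bar>g x\<bar>"])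
    show "AE x in M. (\<lambda>k. \<bar>h k x - g x\<bar>) \<longlonglongrightarrow> 0"
      using lim by (auto intro!: AE_I2 tendsto_rabs_zero simp: LIM_zero_iff)
    show "AE x in M. norm \<bar>h k x - g x\<bar> \<le> u x + \<bar>g x\<bar>" for k
    proof (rule AE_I2)
      fix x assume "x \<in> space M"
      from dom[OF this, of k] show "norm \<bar>h k x - g x\<bar> \<le> u x + \<bar>g x\<bar>" by simp
    qed
  qed (use hi g u in auto)
  then have small: "(\<lambda>k. \<integral>x. \<bar>h k x - g x\<bar> \<partial>M) \<longlonglongrightarrow> 0" by simp
  have "(\<lambda>n. \<integral>x. \<kappa> n x * g x \<partial>M) \<longlonglongrightarrow> L * (\<integral>x. g x \<partial>M)"
  proof (rule LIMSEQ_I)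
    fix r :: real assume r: "r > 0"
    define E where "E = \<bar>D\<bar> + \<bar>L\<bar> + 1"
    have E: "E > 0" by (simp add: E_def)
    have "\<forall>\<^sub>F k in sequentially. (\<integral>x. \<bar>h k x - g x\<bar> \<partial>M) < r / 2 / E"
      using small r E by (intro order_tendstoD) auto
    then obtain k where k: "(\<integral>x. \<bar>h k x - g x\<bar> \<partial>M) < r / 2 / E"
      by (auto simp: eventually_sequentially)
    have "(\<lambda>n. \<integral>x. \<kappa> n x * h k x \<partial>M) \<longlonglongrightarrow> L * (\<integral>x. h k x \<partial>M)"
      using h[of k] by (simp add: averages_to_def)
    from LIMSEQ_D[OF this half_gt_zero[OF r]]
    obtain N where N: "\<And>n. n \<ge> N \<Longrightarrow> \<bar>(\<integral>x. \<kappa> n x * h k x \<partial>M) - L * (\<integral>x. h k x \<partial>M)\<bar> < r / 2"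
      by auto
    have "norm ((\<integral>x. \<kappa> n x * g x \<partial>M) - L * (\<integral>x. g x \<partial>M)) < r" if n: "n \<ge> N" for n
    proof -
      have diff: "integrable M (\<lambda>x. (L - \<kappa> n x) * (h k x - g x))"
      proof (rule integrable_bounded_mult)
        show "\<bar>L - \<kappa> n x\<bar> \<le> \<bar>L\<bar> + D" if "x \<in> space M" for x using bd[OF that, of n] by linarith
      qed (use hi g \<kappa> in auto)
      have i1: "integrable M (\<lambda>x. \<kappa> n x * h k x)" "integrable M (\<lambda>x. \<kappa> n x * g x)"
        using integrable_bounded_mult[OF hi \<kappa> bd] integrable_bounded_mult[OF g \<kappa> bd] by auto
      have "(\<integral>x. \<kappa> n x * g x \<partial>M) - L * (\<integral>x. g x \<partial>M)
          = ((\<integral>x. \<kappa> n x * h k x \<partial>M) - L * (\<integral>x. h k x \<partial>M)) + (\<integral>x. (L - \<kappa> n x) * (h k x - g x) \<partial>M)"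
        using i1 hi g by (simp add: algebra_simps)
      moreover have "\<bar>\<integral>x. (L - \<kappa> n x) * (h k x - g x) \<partial>M\<bar> \<le> (\<integral>x. \<bar>(L - \<kappa> n x) * (h k x - g x)\<bar> \<partial>M)"
        by (rule integral_abs_bound)
      moreover have "\<dots> \<le> (\<integral>x. E * \<bar>h k x - g x\<bar> \<partial>M)"
      proof (rule integral_mono)
        fix x assume x: "x \<in> space M"
        have "\<bar>L - \<kappa> n x\<bar> \<le> E" using bd[OF x, of n] by (simp add: E_def)
        then show "\<bar>(L - \<kappa> n x) * (h k x - g x)\<bar> \<le> E * \<bar>h k x - g x\<bar>"
          by (auto simp: abs_mult intro!: mult_right_mono)
      qed (use diff hi g in auto)
      moreover have "(\<integral>x. E * \<bar>h k x - g x\<bar> \<partial>M) < r / 2"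
        using k E by (simp add: field_simps)
      ultimately show ?thesis using N[OF n] by (simp only: real_norm_def)
    qed
    then show "\<exists>N. \<forall>n\<ge>N. norm ((\<integral>x. \<kappa> n x * g x \<partial>M) - L * (\<integral>x. g x \<partial>M)) < r" by blast
  qed
  then show ?thesis using g by (simp add: averages_to_def)
qed

lemma averages_to_add:
  assumes \<kappa>: "\<And>n. \<kappa> n \<in> borel_measurable M" and bd: "\<And>n x. x \<in> space M \<Longrightarrow> \<bar>\<kappa> n x\<bar> \<le> D"
    and "averages_to M \<kappa> L g" "averages_to M \<kappa> L h"
  shows "averages_to M \<kappa> L (\<lambda>x. g x + h x)"
proof -
  have i: "integrable M g" "integrable M h" and l: "(\<lambda>n. \<integral>x. \<kappa> n x * g x \<partial>M) \<longlonglongrightarrow> L * (\<integral>x. g x \<partial>M)"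
    "(\<lambda>n. \<integral>x. \<kappa> n x * h x \<partial>M) \<longlonglongrightarrow> L * (\<integral>x. h x \<partial>M)"
    using assms(3,4) by (auto simp: averages_to_def)
  have "(\<integral>x. \<kappa> n x * (g x + h x) \<partial>M) = (\<integral>x. \<kappa> n x * g x \<partial>M) + (\<integral>x. \<kappa> n x * h x \<partial>M)" for n
    using integrable_bounded_mult[OF i(1) \<kappa> bd, of n] integrable_bounded_mult[OF i(2) \<kappa> bd, of n]
    by (simp add: distrib_left)
  then show ?thesis using i tendsto_add[OF l] by (simp add: averages_to_def distrib_left)
qed

lemma averages_to_cmult:
  assumes "averages_to M \<kappa> L h" shows "averages_to M \<kappa> L (\<lambda>x. c * h x)"
proof -
  have "(\<lambda>n. c * (\<integral>x. \<kappa> n x * h x \<partial>M)) \<longlonglongrightarrow> c * (L * (\<integral>x. h x \<partial>M))"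
    using assms by (intro tendsto_mult_left) (simp add: averages_to_def)
  then show ?thesis using assms by (simp add: averages_to_def algebra_simps)
qed

lemma averages_to_sum:
  fixes k :: nat
  assumes \<kappa>: "\<And>n. \<kappa> n \<in> borel_measurable M" and bd: "\<And>n x. x \<in> space M \<Longrightarrow> \<bar>\<kappa> n x\<bar> \<le> D"
    and "\<And>i. i < k \<Longrightarrow> averages_to M \<kappa> L (h i)"
  shows "averages_to M \<kappa> L (\<lambda>x. \<Sum>i<k. h i x)"
  using assms(3)
proof (induction k)
  case 0
  show ?case by (simp add: averages_to_def)
next
  case (Suc k)
  then show ?case using averages_to_add[OF \<kappa> bd, where L = L and g = "\<lambda>x. \<Sum>i<k. h i x" and h = "h k"] by simp
qed

text \<open>Initial segments are stable under intersection and generate the Borel sets, so Dynkin's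
lemma gives all indicators, and \<open>L\<^sup>1\<close> closure gives all integrable functions.\<close>

lemma averages_to_unit_interval:
  assumes \<kappa>: "\<And>n. \<kappa> n \<in> borel_measurable unit_interval"
    and bd: "\<And>n x. x \<in> {0..<1} \<Longrightarrow> \<bar>\<kappa> n x\<bar> \<le> D"
    and init: "\<And>s. 0 \<le> s \<Longrightarrow> s \<le> 1 \<Longrightarrow> averages_to unit_interval \<kappa> L (indicator {..<s})"
    and h: "integrable unit_interval h"
  shows "averages_to unit_interval \<kappa> L h"
proof -
  let ?P = "averages_to unit_interval \<kappa> L"
  have bd': "\<And>n x. x \<in> space unit_interval \<Longrightarrow> \<bar>\<kappa> n x\<bar> \<le> D" using bd by simp
  note closure = averages_to_closure[where \<kappa> = \<kappa> and M = unit_interval, OF \<kappa> bd'] and add = averages_to_add[where \<kappa> = \<kappa> and M = unit_interval, OF \<kappa> bd'] and sums = averages_to_sum[where \<kappa> = \<kappa> and M = unit_interval, OF \<kappa> bd']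
  have cong: "?P g" if "?P h" "\<And>x. x \<in> {0..<1} \<Longrightarrow> g x = h x" for g h
  proof -
    have "integrable unit_interval g \<longleftrightarrow> integrable unit_interval h"
      by (intro Bochner_Integration.integrable_cong) (auto simp: that(2))
    moreover have "(\<integral>x. \<kappa> n x * g x \<partial>unit_interval) = (\<integral>x. \<kappa> n x * h x \<partial>unit_interval)" for n
      by (intro Bochner_Integration.integral_cong) (auto simp: that(2))
    moreover have "(\<integral>x. g x \<partial>unit_interval) = (\<integral>x. h x \<partial>unit_interval)"
      by (intro Bochner_Integration.integral_cong) (auto simp: that(2))
    ultimately show ?thesis using that(1) by (simp add: averages_to_def)
  qed
  have indi: "integrable unit_interval (indicator A :: real \<Rightarrow> real)" if "A \<in> sets borel" for A
    using that by (intro unit_interval.integrable_const_bound[where B = 1] measurable_restrict_space1) auto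
  have one: "?P (\<lambda>_. 1)" by (rule cong[OF init[of 1]]) auto
  have borel: "?P (indicator A)" if "A \<in> sigma_sets UNIV (range lessThan)" for A :: "real set"
  proof -
    have "Int_stable (range (lessThan :: real \<Rightarrow> real set))"
    proof (rule Int_stableI_image)
      show "\<exists>c\<in>UNIV. {..<a} \<inter> {..<b} = {..<c}" for a b :: real
        by (rule bexI[of _ "min a b"]) auto
    qed
    moreover have "range (lessThan :: real \<Rightarrow> real set) \<subseteq> Pow UNIV" by simp
    ultimately show ?thesis using that
    proof (induction rule: sigma_sets_induct_disjoint)
      case (basic A)
      then obtain s where A: "A = {..<s}" by auto
      show ?case by (rule cong[OF init[of "min 1 (max 0 s)"]]) (auto simp: A indicator_def)
    next
      case empty
      show ?case by (simp add: averages_to_def)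
    next
      case (compl A)
      have "?P (\<lambda>x. 1 + - 1 * indicator A x)"
        by (intro add one averages_to_cmult compl(2))
      then show ?case by (rule cong) (auto simp: indicator_def)
    next
      case (union A)
      have Ab: "A i \<in> sets borel" for i using union(2) by (auto simp: borel_Iio)
      have part: "(\<Sum>i<k. indicator (A i) x) = (indicator (\<Union>i<k. A i) x :: real)" for k x
        using union(1) by (intro indicator_UN_disjoint[symmetric]) (auto simp: disjoint_family_on_def)
      show ?case
      proof (rule closure[where h = "\<lambda>k x. \<Sum>i<k. indicator (A i) x" and u = "\<lambda>_. 1"])
        show "?P (\<lambda>x. \<Sum>i<k. indicator (A i) x)" for k using union(3) by (intro sums)
        show "integrable unit_interval (indicator (\<Union>i. A i) :: real \<Rightarrow> real)" using Ab by (intro indi) auto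
        show "(\<lambda>k. \<Sum>i<k. indicator (A i) x) \<longlonglongrightarrow> (indicator (\<Union>i. A i) x :: real)" for x
          unfolding part by (rule LIMSEQ_indicator_UN)
        show "\<bar>\<Sum>i<k. indicator (A i) x\<bar> \<le> (1 :: real)" for k x unfolding part by (simp add: indicator_def)
        show "integrable unit_interval (\<lambda>_. 1 :: real)" by (rule unit_interval.integrable_const)
      qed simp_all
    qed
  qed
  show ?thesis
    using h
  proof (induction rule: integrable_induct)
    case (base A c)
    then obtain A' where A': "A' \<in> sets borel" "A = {0..<1} \<inter> A'" by (auto simp: sets_restrict_space)
    then have "?P (indicator A')" using borel[of A'] by (simp add: borel_Iio)
    from averages_to_cmult[OF this, of c] show ?case
      by (rule cong) (auto simp: A' indicator_def)
  next
    case (add f g)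
    then show ?case by (intro averages_to_add[where \<kappa> = \<kappa> and M = unit_interval, OF \<kappa> bd'])
  next
    case (lim f s)
    show ?case
    proof (rule closure[where h = s and u = "\<lambda>x. 2 * \<bar>f x\<bar>"])
      show "integrable unit_interval f" by fact
      show "integrable unit_interval (\<lambda>x. 2 * \<bar>f x\<bar>)" using \<open>integrable unit_interval f\<close> by simp
      show "?P (s k)" for k by fact
      show "(\<lambda>k. s k x) \<longlonglongrightarrow> f x" if "x \<in> space unit_interval" for x using that lim by blast
      show "\<bar>s k x\<bar> \<le> 2 * \<bar>f x\<bar>" if "x \<in> space unit_interval" for k x
        using that lim(3)[of x k] by simp
    qed assumption
  qed
qed

context rw_data
begin

definition part_mean :: "((int ^ 'd) \<times> real \<Rightarrow> real) \<Rightarrow> real \<Rightarrow> int ^ 'd \<Rightarrow> real" where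
  "part_mean f s \<alpha> = (\<integral>y. f (\<alpha>, y) * indicator {..<s} y \<partial>unit_interval)"

text \<open>The length of the initial segment \<open>{..<s}\<close>, seen in the coordinate of the \<open>k\<close>-th branch. It
is \<open>1\<close> for branches to the left of \<open>s\<close>, \<open>0\<close> for those to the right, and strictly between for at most
one branch.\<close>

definition sub_slot :: "real \<Rightarrow> nat \<Rightarrow> real" where
  "sub_slot s k = min 1 (max 0 ((s - q (k - 1)) / w k))"

lemma sub_slot_bounds: "0 \<le> sub_slot s k" "sub_slot s k \<le> 1"
  by (auto simp: sub_slot_def)

lemma branch_less_iff:
  assumes "k \<in> index_set p" "0 \<le> u" "u < 1"
  shows "branch k u < s \<longleftrightarrow> u < sub_slot s k"
proof -
  have w: "w k > 0" using assms(1) by (rule w_pos)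
  have "u < sub_slot s k \<longleftrightarrow> u < (s - q (k - 1)) / w k"
    unfolding sub_slot_def using assms(2,3) by linarith
  then show ?thesis using w by (simp add: branch_def field_simps)
qed

lemma part_mean_one: "0 \<le> s \<Longrightarrow> s \<le> 1 \<Longrightarrow> part_mean (\<lambda>_. 1) s \<alpha> = s"
proof -
  assume s: "0 \<le> s" "s \<le> 1"
  have "part_mean (\<lambda>_. 1) s \<alpha> = measure unit_interval ({..<s} \<inter> {0..<1})"
    by (simp add: part_mean_def)
  also have "{..<s} \<inter> {0..<1} = {0..<s}" using s by auto
  also have "measure unit_interval {0..<s} = s" using s by (subst measure_restrict_space) auto
  finally show ?thesis .
qed

lemma part_mean_bounded:
  assumes "f \<in> borel_measurable half_phase" "\<And>z. z \<in> UNIV \<times> {0..<1} \<Longrightarrow> \<bar>f z\<bar> \<le> D"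
  shows "\<bar>part_mean f s \<alpha>\<bar> \<le> D"
proof -
  have "\<bar>cell_mean (\<lambda>z. f z * indicator {..<s} (snd z)) \<alpha>\<bar> \<le> D"
  proof (rule cell_mean_bounded)
    show "(\<lambda>z. f z * indicator {..<s} (snd z)) \<in> borel_measurable half_phase"
      using assms(1) by (intro borel_measurable_times measurable_compose[OF measurable_snd] measurable_restrict_space1) auto
    show "\<bar>f z * indicator {..<s} (snd z)\<bar> \<le> D" if "z \<in> UNIV \<times> {0..<1}" for z
      using assms(2)[OF that] by (auto simp: indicator_def)
  qed
  then show ?thesis by (simp add: cell_mean_def part_mean_def)
qed

lemma part_mean_skew:
  assumes f: "f \<in> borel_measurable half_phase" and bd: "\<And>z. z \<in> UNIV \<times> {0..<1} \<Longrightarrow> \<bar>f z\<bar> \<le> D"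
  shows "part_mean (\<lambda>z. f (skew z)) s \<alpha> = (\<integral>k. part_mean f (sub_slot s k) (\<alpha> + b k) \<partial>index_pmf)"
proof -
  have m: "(\<lambda>y. f (skew (\<alpha>, y)) * indicator {..<s} y) \<in> borel_measurable unit_interval"
    by (intro borel_measurable_times measurable_section[OF measurable_compose[OF measurable_skew f]] measurable_restrict_space1) auto
  have bd': "\<bar>f (skew (\<alpha>, y)) * indicator {..<s} y\<bar> \<le> D" if "y \<in> {0..<1}" for y
    using bd[OF skew_in, of "(\<alpha>, y)"] that by (auto simp: indicator_def)
  have "part_mean (\<lambda>z. f (skew z)) s \<alpha> = (\<integral>k. (\<integral>u. f (skew (\<alpha>, branch k u)) * indicator {..<s} (branch k u) \<partial>unit_interval) \<partial>index_pmf)"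
    unfolding part_mean_def by (rule integral_branch[OF m bd'])
  also have "\<dots> = (\<integral>k. part_mean f (sub_slot s k) (\<alpha> + b k) \<partial>index_pmf)"
    unfolding part_mean_def
    by (intro integral_cong_AE)
      (auto simp: AE_measure_pmf_iff set_index_pmf skew_def slot_branch expand_branch branch_less_iff indicator_def
        intro!: Bochner_Integration.integral_cong)
  finally show ?thesis .
qed

text \<open>Branches that lie entirely in the segment contribute the error \<open>\<epsilon>\<close> of whole cells, and
branches outside contribute nothing. Only the branch that is cut by \<open>s\<close> inherits the error \<open>\<delta>\<close>
for segments, and its weight is at most \<open>\<rho>\<close>.\<close>

lemma part_mean_contraction:
  assumes f: "f \<in> borel_measurable half_phase" and bd: "\<And>z. z \<in> UNIV \<times> {0..<1} \<Longrightarrow> \<bar>f z\<bar> \<le> D"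
    and \<rho>: "\<And>k. pmf index_pmf k \<le> \<rho>"
    and cell: "\<And>\<alpha>. \<bar>cell_mean f \<alpha> - L\<bar> \<le> \<epsilon>"
    and part: "\<And>\<alpha> s. 0 \<le> s \<Longrightarrow> s \<le> 1 \<Longrightarrow> \<bar>part_mean f s \<alpha> - s * L\<bar> \<le> \<delta>"
    and s: "0 \<le> s" "s \<le> 1"
  shows "\<bar>part_mean (\<lambda>z. f (skew z)) s \<alpha> - s * L\<bar> \<le> \<epsilon> + \<rho> * \<delta>"
proof -
  have \<epsilon>: "0 \<le> \<epsilon>" using cell[of 0] by linarith
  have \<delta>: "0 \<le> \<delta>" using part[of 0 0] by linarith
  have one: "(\<lambda>_. 1 :: real) \<in> borel_measurable half_phase" by simp
  have s_eq: "s = (\<integral>k. sub_slot s k \<partial>index_pmf)"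
    using part_mean_skew[OF one, of 1 s \<alpha>] part_mean_one[OF s] by (simp add: part_mean_one sub_slot_bounds)
  have i1: "integrable index_pmf (\<lambda>k. part_mean f (sub_slot s k) (\<alpha> + b k))"
    by (rule integrable_pmf_bounded[OF part_mean_bounded[OF f bd]])
  have i2: "integrable index_pmf (\<lambda>k. sub_slot s k)"
    by (rule integrable_pmf_bounded[where C = 1]) (use sub_slot_bounds[of s] in simp)
  have i3: "integrable index_pmf (\<lambda>k. indicator {slot p b s} k * \<delta>)"
    by (rule integrable_pmf_bounded[where C = \<delta>]) (use \<delta> in \<open>simp add: indicator_def\<close>)
  have "part_mean (\<lambda>z. f (skew z)) s \<alpha> - s * L
      = (\<integral>k. part_mean f (sub_slot s k) (\<alpha> + b k) - sub_slot s k * L \<partial>index_pmf)"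
    using i1 i2 s_eq by (simp add: part_mean_skew[OF f bd])
  also have "\<bar>\<dots>\<bar> \<le> (\<integral>k. \<bar>part_mean f (sub_slot s k) (\<alpha> + b k) - sub_slot s k * L\<bar> \<partial>index_pmf)"
    by (rule integral_abs_bound)
  also have "\<dots> \<le> (\<integral>k. \<epsilon> + indicator {slot p b s} k * \<delta> \<partial>index_pmf)"
  proof (rule integral_mono_AE)
    show "AE k in index_pmf. \<bar>part_mean f (sub_slot s k) (\<alpha> + b k) - sub_slot s k * L\<bar> \<le> \<epsilon> + indicator {slot p b s} k * \<delta>"
      unfolding AE_measure_pmf_iff set_index_pmf
    proof
      fix k assume k: "k \<in> index_set p"
      consider "sub_slot s k = 0" | "sub_slot s k = 1" | "0 < sub_slot s k" "sub_slot s k < 1"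
        using sub_slot_bounds[of s k] by linarith
      then show "\<bar>part_mean f (sub_slot s k) (\<alpha> + b k) - sub_slot s k * L\<bar> \<le> \<epsilon> + indicator {slot p b s} k * \<delta>"
      proof cases
        case 1
        have "part_mean f 0 (\<alpha> + b k) = (\<integral>y. 0 \<partial>unit_interval)"
          unfolding part_mean_def by (intro Bochner_Integration.integral_cong) auto
        then show ?thesis using 1 \<epsilon> \<delta> by simp
      next
        case 2
        have "part_mean f 1 (\<alpha> + b k) = cell_mean f (\<alpha> + b k)"
          unfolding part_mean_def cell_mean_def by (intro Bochner_Integration.integral_cong) auto
        then show ?thesis using 2 cell[of "\<alpha> + b k"] \<delta> by (simp add: add_increasing2)
      next
        case 3
        then have "0 < (s - q (k - 1)) / w k" "(s - q (k - 1)) / w k < 1"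
          by (auto simp: sub_slot_def min_def max_def split: if_splits)
        then have "q (k - 1) \<le> s" "s < q k" using w_pos[OF k] by (auto simp: q_step[OF k] field_simps)
        then have "slot p b s = k" using k by (intro slot_eqI)
        then show ?thesis
          using part[of "sub_slot s k" "\<alpha> + b k"] sub_slot_bounds[of s k] \<epsilon> by simp
      qed
    qed
  qed (use i1 i2 i3 in auto)
  also have "\<dots> = \<epsilon> + pmf index_pmf (slot p b s) * \<delta>"
    using i3 by (simp add: measure_pmf_single)
  also have "\<dots> \<le> \<epsilon> + \<rho> * \<delta>" using \<rho> \<delta> by (intro add_left_mono mult_right_mono)
  finally show ?thesis .
qed

end

context mixing_rw
begin

text \<open>The spanning condition forces the walk to have at least two different steps, so no single step
has probability \<open>1\<close>, and the weights stay away from \<open>1\<close> since they sum to \<open>1\<close>.\<close>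

lemma pmf_index_bound: obtains \<rho> where "0 \<le> \<rho>" "\<rho> < 1" "\<And>k. pmf index_pmf k \<le> \<rho>"
proof -
  have "\<exists>c\<in>set_pmf p. c \<noteq> a"
  proof (rule ccontr)
    assume "\<not> ?thesis"
    then have "{c - a | c. c \<in> set_pmf p} \<subseteq> {0}" by auto
    then have "int_span {c - a | c. c \<in> set_pmf p} \<subseteq> {0}"
      unfolding int_span_def
      by (rule module.span_minimal[OF module_int_vec])
        (simp add: module.subspace_def[OF module_int_vec])
    \<comment> \<open>The index type is nonempty, so the lattice is not trivial.\<close>
    then have "(\<chi> i. (1 :: int)) \<in> ({0} :: (int ^ 'd) set)" using span by auto
    then show False by (simp add: vec_eq_iff)
  qed
  then obtain c where c: "c \<in> set_pmf p" "c \<noteq> a" by blast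
  obtain ka kc where k: "ka \<in> index_set p" "kc \<in> index_set p" "b ka = a" "b kc = c"
    using a c(1) b_image by (metis imageE)
  then have "ka \<noteq> kc" using c(2) by auto
  define \<rho> where "\<rho> = 1 - min (pmf index_pmf ka) (pmf index_pmf kc)"
  have two: "pmf index_pmf i + pmf index_pmf j \<le> 1" if "i \<noteq> j" for i j
  proof -
    have "measure (measure_pmf index_pmf) {i, j} = pmf index_pmf i + pmf index_pmf j"
      using that by (simp add: measure_measure_pmf_finite)
    then show ?thesis using measure_pmf.prob_le_1[of index_pmf "{i, j}"] by simp
  qed
  show ?thesis
  proof (rule that)
    show "0 \<le> \<rho>" using pmf_le_1[of index_pmf ka] by (simp add: \<rho>_def min_def)
    show "\<rho> < 1" using w_pos[OF k(1)] w_pos[OF k(2)] pmf_index[OF k(1)] pmf_index[OF k(2)] by (simp add: \<rho>_def)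
    show "pmf index_pmf i \<le> \<rho>" for i
      using two[of i ka] two[of i kc] \<open>ka \<noteq> kc\<close> by (cases "i = ka") (auto simp: \<rho>_def min_def)
  qed
qed

text \<open>Once the error for whole cells is at most \<open>(1 - \<rho>) \<epsilon> / 2\<close>, iterating the contraction
\<open>\<delta> \<mapsto> (1 - \<rho>) \<epsilon> / 2 + \<rho> \<delta>\<close> brings the error for segments below \<open>\<epsilon> / 2\<close> plus a geometrically
decaying term.\<close>

lemma part_mean_uniform_limit:
  assumes f: "f \<in> borel_measurable half_phase" and bd: "\<And>z. z \<in> UNIV \<times> {0..<1} \<Longrightarrow> \<bar>f z\<bar> \<le> D"
    and cell: "\<And>\<epsilon>. \<epsilon> > 0 \<Longrightarrow> \<exists>N. \<forall>n\<ge>N. \<forall>\<alpha>. \<bar>(step_mean p ^^ n) (cell_mean f) \<alpha> - L\<bar> \<le> \<epsilon>"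
    and "\<epsilon> > 0"
  shows "\<exists>N. \<forall>n\<ge>N. \<forall>\<alpha> s. 0 \<le> s \<longrightarrow> s \<le> 1 \<longrightarrow> \<bar>part_mean (\<lambda>z. f ((skew ^^ n) z)) s \<alpha> - s * L\<bar> \<le> \<epsilon>"
proof -
  obtain \<rho> where \<rho>: "0 \<le> \<rho>" "\<rho> < 1" "\<And>k. pmf index_pmf k \<le> \<rho>" using pmf_index_bound by blast
  define \<eta> where "\<eta> = (1 - \<rho>) * (\<epsilon> / 2)"
  have "\<eta> > 0" using \<rho> \<open>\<epsilon> > 0\<close> by (simp add: \<eta>_def)
  from cell[OF this] obtain N where N: "\<And>n \<alpha>. n \<ge> N \<Longrightarrow> \<bar>(step_mean p ^^ n) (cell_mean f) \<alpha> - L\<bar> \<le> \<eta>" by blast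
  define E where "E = \<bar>D\<bar> + \<bar>L\<bar>"
  let ?f = "\<lambda>n z. f ((skew ^^ n) z)"
  have fm: "?f n \<in> borel_measurable half_phase" for n by (rule measurable_compose[OF measurable_skew_iter f])
  have fb: "\<bar>?f n z\<bar> \<le> D" if "z \<in> UNIV \<times> {0..<1}" for n z using that by (intro bd skew_iter_in)
  have cm: "cell_mean (?f n) = (step_mean p ^^ n) (cell_mean f)" for n
    by (rule cell_mean_skew_iter[OF f bd])
  have step: "\<bar>part_mean (?f (N + i)) s \<alpha> - s * L\<bar> \<le> \<epsilon> / 2 + \<rho> ^ i * E" if "0 \<le> s" "s \<le> 1" for i s \<alpha>
    using that
  proof (induction i arbitrary: s \<alpha>)
    case 0
    have "\<bar>part_mean (?f N) s \<alpha>\<bar> \<le> \<bar>D\<bar>" 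
      by (rule order.trans[OF part_mean_bounded[OF fm fb] abs_ge_self])
    moreover have "\<bar>s * L\<bar> \<le> \<bar>L\<bar>" using 0 by (simp add: abs_mult mult_left_le_one_le)
    ultimately show ?case using \<open>\<epsilon> > 0\<close> by (simp add: E_def)
  next
    case (Suc i)
    have "\<bar>part_mean (\<lambda>z. ?f (N + i) (skew z)) s \<alpha> - s * L\<bar> \<le> \<eta> + \<rho> * (\<epsilon> / 2 + \<rho> ^ i * E)"
    proof (rule part_mean_contraction[OF fm fb \<rho>(3) _ Suc.IH Suc.prems])
      show "\<bar>cell_mean (?f (N + i)) \<alpha> - L\<bar> \<le> \<eta>" for \<alpha>
        using N[of "N + i" \<alpha>] cm by simp
    qed
    also have "\<dots> = \<epsilon> / 2 + \<rho> ^ Suc i * E" by (simp add: \<eta>_def field_simps)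
    finally show ?case by (simp add: funpow_swap1)
  qed
  have "(\<lambda>i. \<rho> ^ i * E) \<longlonglongrightarrow> 0"
    using \<rho> by (intro tendsto_mult_left_zero LIMSEQ_realpow_zero)
  then have "\<forall>\<^sub>F i in sequentially. \<rho> ^ i * E < \<epsilon> / 2" using \<open>\<epsilon> > 0\<close> by (intro order_tendstoD) auto
  then obtain I where I: "\<And>i. i \<ge> I \<Longrightarrow> \<rho> ^ i * E < \<epsilon> / 2" by (auto simp: eventually_sequentially)
  show ?thesis
  proof (intro exI[of _ "N + I"] allI impI)
    fix n \<alpha> and s :: real assume n: "N + I \<le> n" and s: "0 \<le> s" "s \<le> 1"
    have "n = N + (n - N)" using n by simp
    then have "\<bar>part_mean (?f n) s \<alpha> - s * L\<bar> \<le> \<epsilon> / 2 + \<rho> ^ (n - N) * E"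
      using step[OF s, of "n - N" \<alpha>] by simp
    also have "I \<le> n - N" using n by simp
    then have "\<epsilon> / 2 + \<rho> ^ (n - N) * E \<le> \<epsilon>" using I[of "n - N"] by linarith
    finally show "\<bar>part_mean (?f n) s \<alpha> - s * L\<bar> \<le> \<epsilon>" .
  qed
qed

text \<open>Integrating out \<open>y\<^sub>2\<close> leaves, on each cell, an integrable function of \<open>y\<^sub>1\<close> to which the
previous results apply; the cells are summed up by dominated convergence.\<close>

lemma forward_averages:
  assumes f: "f \<in> borel_measurable half_phase" and bd: "\<And>z. z \<in> UNIV \<times> {0..<1} \<Longrightarrow> \<bar>f z\<bar> \<le> D"
    and cell: "\<And>\<epsilon>. \<epsilon> > 0 \<Longrightarrow> \<exists>N. \<forall>n\<ge>N. \<forall>\<alpha>. \<bar>(step_mean p ^^ n) (cell_mean f) \<alpha> - L\<bar> \<le> \<epsilon>"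
    and g: "g \<in> borel_measurable borel_phase" "integrable borel_phase g"
  shows "(\<lambda>n. \<integral>x. f ((skew ^^ n) (forward x)) * g x \<partial>borel_phase) \<longlonglongrightarrow> L * (\<integral>x. g x \<partial>borel_phase)"
proof -
  let ?f = "\<lambda>n z. f ((skew ^^ n) z)"
  let ?U = "unit_interval \<Otimes>\<^sub>M unit_interval"
  have fm: "?f n \<in> borel_measurable half_phase" for n by (rule measurable_compose[OF measurable_skew_iter f])
  have fb: "\<bar>?f n z\<bar> \<le> D" if "z \<in> UNIV \<times> {0..<1}" for n z using that by (intro bd skew_iter_in)
  have slice: "averages_to unit_interval (\<lambda>n y. ?f n (\<alpha>, y)) L h" if "integrable unit_interval h" for \<alpha> h
  proof (rule averages_to_unit_interval[OF measurable_section[OF fm] _ _ that])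
    show "\<bar>?f n (\<alpha>, y)\<bar> \<le> D" if "y \<in> {0..<1}" for n y using that by (intro fb) auto
    fix s :: real assume s: "0 \<le> s" "s \<le> 1"
    have "(\<lambda>n. part_mean (?f n) s \<alpha>) \<longlonglongrightarrow> s * L"
    proof (rule LIMSEQ_I)
      fix r :: real assume "r > 0"
      then have "r / 2 > 0" by simp
      from part_mean_uniform_limit[OF f bd cell this] obtain N where
        "\<And>n. n \<ge> N \<Longrightarrow> \<bar>part_mean (?f n) s \<alpha> - s * L\<bar> \<le> r / 2" using s by blast
      then show "\<exists>N. \<forall>n\<ge>N. norm (part_mean (?f n) s \<alpha> - s * L) < r" using \<open>r > 0\<close> by fastforce
    qed
    moreover have "(\<integral>y. indicator {..<s} y \<partial>unit_interval) = s"
      using part_mean_one[OF s] by (simp add: part_mean_def)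
    moreover have "integrable unit_interval (indicator {..<s} :: real \<Rightarrow> real)"
      by (intro unit_interval.integrable_const_bound[where B = 1] measurable_restrict_space1) auto
    ultimately show "averages_to unit_interval (\<lambda>n y. ?f n (\<alpha>, y)) L (indicator {..<s})"
      by (simp add: averages_to_def part_mean_def mult.commute)
  qed
  note gi = integral_borel_phase[OF g(2)]
  have gabs: "integrable borel_phase (\<lambda>x. \<bar>g x\<bar>)" using g(2) by simp
  define w where "w = (\<lambda>\<alpha>. \<integral>y. \<bar>g (\<alpha>, y)\<bar> \<partial>?U)"
  define G where "G = (\<lambda>\<alpha> y1. \<integral>y2. g (\<alpha>, y1, y2) \<partial>unit_interval)"
  have fg: "integrable borel_phase (\<lambda>x. ?f n (forward x) * g x)" for n
    using g(2) measurable_compose[OF measurable_forward fm]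
    by (rule integrable_bounded_mult[where D = D]) (use fb forward_in in simp)
  have G_int: "integrable unit_interval (G \<alpha>)" and G_total: "(\<integral>y. G \<alpha> y \<partial>unit_interval) = (\<integral>y. g (\<alpha>, y) \<partial>?U)" for \<alpha>
    using unit_square.integrable_fst'[OF gi(3)] unit_square.integral_fst'[OF gi(3)] by (simp_all add: G_def)
  have inner: "(\<integral>y. ?f n (forward (\<alpha>, y)) * g (\<alpha>, y) \<partial>?U) = (\<integral>y. ?f n (\<alpha>, y) * G \<alpha> y \<partial>unit_interval)" for n \<alpha>
    using unit_square.integral_fst'[OF integral_borel_phase(3)[OF fg[of n], of \<alpha>]] by (simp add: forward_def G_def)
  have "(\<lambda>n. \<integral>\<alpha>. (\<integral>y. ?f n (forward (\<alpha>, y)) * g (\<alpha>, y) \<partial>?U) \<partial>count_space UNIV)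
      \<longlonglongrightarrow> (\<integral>\<alpha>. L * (\<integral>y. g (\<alpha>, y) \<partial>?U) \<partial>count_space UNIV)"
  proof (rule integral_dominated_convergence[where w = "\<lambda>\<alpha>. D * w \<alpha>"])
    show "integrable (count_space UNIV) (\<lambda>\<alpha>. D * w \<alpha>)"
      unfolding w_def using integral_borel_phase(2)[OF gabs] by simp
    show "AE \<alpha> in count_space UNIV. (\<lambda>n. \<integral>y. ?f n (forward (\<alpha>, y)) * g (\<alpha>, y) \<partial>?U) \<longlonglongrightarrow> L * (\<integral>y. g (\<alpha>, y) \<partial>?U)"
      using slice[OF G_int] unfolding inner G_total[symmetric] averages_to_def by (simp add: AE_count_space)
    show "AE \<alpha> in count_space UNIV. norm (\<integral>y. ?f n (forward (\<alpha>, y)) * g (\<alpha>, y) \<partial>?U) \<le> D * w \<alpha>" for n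
      unfolding AE_count_space
    proof
      fix \<alpha> :: "int ^ 'd"
      have "\<bar>\<integral>y. ?f n (forward (\<alpha>, y)) * g (\<alpha>, y) \<partial>?U\<bar> \<le> (\<integral>y. \<bar>?f n (forward (\<alpha>, y)) * g (\<alpha>, y)\<bar> \<partial>?U)"
        by (rule integral_abs_bound)
      also have "\<dots> \<le> (\<integral>y. D * \<bar>g (\<alpha>, y)\<bar> \<partial>?U)"
      proof (rule integral_mono)
        show "integrable ?U (\<lambda>y. \<bar>?f n (forward (\<alpha>, y)) * g (\<alpha>, y)\<bar>)" using integral_borel_phase(3)[OF fg] by simp
        show "integrable ?U (\<lambda>y. D * \<bar>g (\<alpha>, y)\<bar>)" using gi(3) by simp
        fix y assume "y \<in> space ?U"
        then have "(\<alpha>, y) \<in> rw_space" by (auto simp: space_pair_measure rw_space_def unit_square_def)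
        from fb[OF forward_in[OF this]] show "\<bar>?f n (forward (\<alpha>, y)) * g (\<alpha>, y)\<bar> \<le> D * \<bar>g (\<alpha>, y)\<bar>"
          by (auto simp: abs_mult intro!: mult_right_mono)
      qed
      finally show "norm (\<integral>y. ?f n (forward (\<alpha>, y)) * g (\<alpha>, y) \<partial>?U) \<le> D * w \<alpha>" by (simp add: w_def)
    qed
  qed auto
  then show ?thesis by (simp add: integral_borel_phase(1)[OF fg] gi(1))
qed

lemma cyl_local_mixing:
  assumes F: "F \<in> global_obs_m p b m" and g: "integrable (rw_measure :: 'd phase measure) g"
  shows "(\<lambda>n. corr F n g) \<longlonglongrightarrow> inf_avg F * mu g"
proof -
  obtain D F' where "0 \<le> D" "F' = clip D F" and F': "F' \<in> borel_measurable (cyl m)" "\<And>x. \<bar>F' x\<bar> \<le> D"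
    "AE x in rw_measure. F x = F' x" "((\<lambda>V. vol_avg V F') \<longlongrightarrow> inf_avg F) exh_filter"
    and Fm: "F \<in> borel_measurable (cyl m)"
    by (rule global_obs_mE[OF F]) (rule that)
  obtain f where f: "f \<in> borel_measurable half_phase" "\<And>x. x \<in> rw_space \<Longrightarrow> F' ((T ^^ m) x) = f (forward x)"
    using cyl_function_forward_rep[OF F'(1)] by blast
  have fb: "\<bar>f z\<bar> \<le> D" if "z \<in> UNIV \<times> {0..<1}" for z
    by (rule forward_rep_bounded[where F = F' and m = m, OF F'(2) f(2) that])
  have gm: "g \<in> borel_measurable rw_measure" using g by simp
  then obtain g' where g': "g' \<in> borel_measurable borel_phase" "AE x in borel_phase. g x = g' x"
    unfolding rw_measure_eq_completion using completion_ex_borel_measurable_real by blast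
  have gg': "AE x in rw_measure. g x = g' x"
    unfolding rw_measure_eq_completion using g'(2) by (rule AE_completion)
  have g'm: "g' \<in> borel_measurable rw_measure" by (rule borel_measurable_rw_measure[OF g'(1)])
  have g'i: "integrable borel_phase g'"
    unfolding integrable_rw_measure[OF g'(1), symmetric] using integrable_cong_AE[OF gm g'm gg'] g by simp
  have g_eq: "mu g = (\<integral>x. g' x \<partial>borel_phase)"
    unfolding integral_rw_measure[OF g'(1), symmetric] by (rule integral_cong_AE[OF gm g'm gg'])
  have F'm: "F' \<in> borel_measurable rw_measure" using F'(1) by (rule borel_measurable_cyl_rw)
  have eq: "(\<integral>x. F ((T ^^ (n + m)) x) * g x \<partial>rw_measure) = (\<integral>x. f ((skew ^^ n) (forward x)) * g' x \<partial>borel_phase)" for n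
  proof -
    have m1: "(\<lambda>x. f ((skew ^^ n) (forward x)) * g' x) \<in> borel_measurable borel_phase"
      by (intro borel_measurable_times g'(1) measurable_compose[OF measurable_forward measurable_compose[OF measurable_skew_iter f(1)]])
    have "(\<integral>x. F ((T ^^ (n + m)) x) * g x \<partial>rw_measure) = (\<integral>x. F' ((T ^^ (n + m)) x) * g x \<partial>rw_measure)"
      by (rule integral_correlation_cong_AE[OF F'(3) borel_measurable_cyl_rw[OF Fm] F'm gm])
    also have "\<dots> = (\<integral>x. f ((skew ^^ n) (forward x)) * g' x \<partial>rw_measure)"
    proof (rule integral_cong_AE)
      show "(\<lambda>x. F' ((T ^^ (n + m)) x) * g x) \<in> borel_measurable rw_measure"
        by (intro borel_measurable_times measurable_compose[OF measurable_rw_map_iter_rw F'm] gm)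
      show "(\<lambda>x. f ((skew ^^ n) (forward x)) * g' x) \<in> borel_measurable rw_measure"
        by (rule borel_measurable_rw_measure[OF m1])
      have "F' ((T ^^ (n + m)) x) = f ((skew ^^ n) (forward x))" if "x \<in> rw_space" for x
      proof -
        have "(T ^^ (n + m)) x = (T ^^ m) ((T ^^ n) x)" by (simp add: add.commute[of n] funpow_add)
        then show ?thesis using f(2)[OF rw_map_iter_in[OF that, of n]] by (simp add: forward_rw_map_iter)
      qed
      then have "AE x in rw_measure. F' ((T ^^ (n + m)) x) = f ((skew ^^ n) (forward x))"
        by (intro AE_I2) (simp add: space_rw_measure)
      then show "AE x in rw_measure. F' ((T ^^ (n + m)) x) * g x = f ((skew ^^ n) (forward x)) * g' x"
        using gg' by eventually_elim simp
    qed
    also have "\<dots> = (\<integral>x. f ((skew ^^ n) (forward x)) * g' x \<partial>borel_phase)"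
      by (rule integral_rw_measure[OF m1])
    finally show ?thesis .
  qed
  have "(\<lambda>n. \<integral>x. F ((T ^^ (n + m)) x) * g x \<partial>rw_measure) \<longlonglongrightarrow> inf_avg F * mu g"
    unfolding eq g_eq
    by (rule forward_averages[OF f(1) fb _ g'(1) g'i], assumption)
      (rule cell_mean_uniform_limit[OF borel_measurable_cyl[OF F'(1)] F'(2) F'(4) f])
  then show ?thesis by (rule LIMSEQ_offset)
qed

end

section \<open>Global observables as uniform limits of cylinder observables\<close>

context rw_data
begin

lemma global_obs_m_mono: "m \<le> m' \<Longrightarrow> F \<in> global_obs_m p b m \<Longrightarrow> F \<in> global_obs_m p b m'"
  by (auto simp: global_obs_m_def Linf_class_def intro: cyl_algebra_mono_measurable)

lemma global_obs_m_measurable: "F \<in> global_obs_m p b m \<Longrightarrow> F \<in> borel_measurable rw_measure"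
  by (auto simp: global_obs_m_def Linf_class_def intro: borel_measurable_cyl_rw)

lemma global_obs_m_tendsto: "F \<in> global_obs_m p b m \<Longrightarrow> ((\<lambda>V. vol_avg V F) \<longlongrightarrow> inf_avg F) exh_filter"
  by (auto simp: global_obs_m_def intro: inf_avg_tendsto)

lemma global_obs_m_Linf: "F \<in> global_obs_m p b m \<Longrightarrow> Linf_norm F < \<infinity>"
  by (auto simp: global_obs_m_def Linf_class_def)

lemma exh_familyE:
  assumes "(V :: 'd phase set) \<in> exh_family"
  obtains C where "finite C" "C \<noteq> {}" "V = C \<times> unit_square" "measure rw_measure V = card C" "measure rw_measure V > 0"
proof -
  obtain \<gamma> r where V: "V = lattice_box \<gamma> r \<times> unit_square" using assms by (auto simp: exh_family_def)
  have "finite (lattice_box \<gamma> r)" "lattice_box \<gamma> r \<noteq> {}" by (auto simp: finite_lattice_box lattice_box_nonempty)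
  then show ?thesis
    using that[of "lattice_box \<gamma> r"] V by (simp add: measure_Times_unit_square card_gt_0_iff)
qed

lemma vol_avg_diff_le:
  assumes V: "(V :: 'd phase set) \<in> exh_family" and F: "F \<in> borel_measurable rw_measure" and H: "H \<in> borel_measurable rw_measure"
    and bd: "AE x in rw_measure. \<bar>F x\<bar> \<le> D" "AE x in rw_measure. \<bar>H x\<bar> \<le> D'"
    and close: "AE x in rw_measure. \<bar>F x - H x\<bar> \<le> e"
  shows "\<bar>vol_avg V F - vol_avg V H\<bar> \<le> e"
proof -
  obtain C where C: "finite C" "V = C \<times> unit_square" "measure rw_measure V = card C" "measure rw_measure V > 0"
    using exh_familyE[OF V] by metis
  have "(LINT x:V|rw_measure. F x) - (LINT x:V|rw_measure. H x) = (LINT x:V|rw_measure. F x - H x)"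
    unfolding C(2) by (rule set_integral_diff(2)[symmetric]) (rule set_integral_bounded(1)[OF F bd(1) C(1)] set_integral_bounded(1)[OF H bd(2) C(1)])+
  also have "\<bar>\<dots>\<bar> \<le> e * card C"
    unfolding C(2) using F H by (intro set_integral_bounded(2) close C(1)) auto
  finally have "\<bar>(LINT x:V|rw_measure. F x) - (LINT x:V|rw_measure. H x)\<bar> \<le> e * measure rw_measure V"
    by (simp add: C(3))
  then show ?thesis
    using C(4) by (simp add: vol_avg_def diff_divide_distrib[symmetric] pos_divide_le_eq)
qed

lemma inf_avg_diff_le:
  assumes F: "F \<in> borel_measurable rw_measure" and H: "H \<in> borel_measurable rw_measure"
    and bd: "Linf_norm F < \<infinity>" "Linf_norm (H :: 'd phase \<Rightarrow> real) < \<infinity>"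
    and close: "AE x in rw_measure. \<bar>F x - H x\<bar> \<le> e"
    and lim: "((\<lambda>V. vol_avg V F) \<longlongrightarrow> K) exh_filter" "((\<lambda>V. vol_avg V H) \<longlongrightarrow> L) exh_filter"
  shows "\<bar>K - L\<bar> \<le> e"
proof (rule tendsto_upperbound)
  show "((\<lambda>V. \<bar>vol_avg V F - vol_avg V H\<bar>) \<longlongrightarrow> \<bar>K - L\<bar>) exh_filter"
    using lim by (intro tendsto_rabs tendsto_diff)
  obtain D where D: "AE x in rw_measure. \<bar>F x\<bar> \<le> D" by (rule Linf_bound[OF bd(1)])
  obtain D' where D': "AE x in rw_measure. \<bar>H x\<bar> \<le> D'" by (rule Linf_bound[OF bd(2)])
  show "\<forall>\<^sub>F V in exh_filter. \<bar>vol_avg V F - vol_avg V H\<bar> \<le> e"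
    unfolding eventually_exh_filter
    by (intro exI[of _ 1] conjI ballI impI vol_avg_diff_le[OF _ F H D D' close]) simp_all
qed (rule exh_filter_nontrivial)

lemma global_obs_approx:
  assumes F: "F \<in> global_obs p b" and "\<epsilon> > 0"
  obtains m H where "H \<in> global_obs_m p b m" "AE x in rw_measure. \<bar>F x - H x\<bar> \<le> \<epsilon>"
proof -
  obtain m H where H: "H \<in> global_obs_m p b m" "Linf_norm (\<lambda>x. F x - H x) < ereal \<epsilon>"
    using F \<open>\<epsilon> > 0\<close> unfolding global_obs_def by blast
  have "AE x in rw_measure. ereal \<bar>F x - H x\<bar> \<le> Linf_norm (\<lambda>x. F x - H x)"
    unfolding Linf_norm_def by (rule esssup_AE)
  then have "AE x in rw_measure. \<bar>F x - H x\<bar> \<le> \<epsilon>"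
  proof eventually_elim
    fix x assume "ereal \<bar>F x - H x\<bar> \<le> Linf_norm (\<lambda>x. F x - H x)"
    also have "\<dots> < ereal \<epsilon>" by (rule H(2))
    finally show "\<bar>F x - H x\<bar> \<le> \<epsilon>" by simp
  qed
  then show ?thesis using H(1) that by blast
qed

lemma global_obsD:
  assumes "F \<in> global_obs p b" shows "F \<in> borel_measurable rw_measure" "Linf_norm F < \<infinity>"
  using assms by (auto simp: global_obs_def Linf_class_def)

text \<open>The averages of a sequence of approximating cylinder observables form a Cauchy sequence, since
an average is bounded by the \<open>L\<^sup>\<infinity>\<close> norm; its limit is the average of \<open>F\<close>.\<close>

lemma global_obs_tendsto:
  assumes F: "F \<in> global_obs p b"
  shows "((\<lambda>V. vol_avg V F) \<longlongrightarrow> inf_avg F) exh_filter"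
proof -
  note Fm = global_obsD[OF F]
  have "\<exists>H. (\<exists>m. H \<in> global_obs_m p b m) \<and> (AE x in rw_measure. \<bar>F x - H x\<bar> \<le> inverse (real (Suc i)))" for i
  proof -
    have "inverse (real (Suc i)) > 0" by simp
    from global_obs_approx[OF F this] show ?thesis by blast
  qed
  then obtain H where H0: "\<And>i. \<exists>m. H i \<in> global_obs_m p b m"
    and close: "\<And>i. AE x in rw_measure. \<bar>F x - H i x\<bar> \<le> inverse (real (Suc i))"
    using choice[of "\<lambda>i H. (\<exists>m. H \<in> global_obs_m p b m) \<and> (AE x in rw_measure. \<bar>F x - H x\<bar> \<le> inverse (real (Suc i)))"] by blast
  obtain m where H: "\<And>i. H i \<in> global_obs_m p b (m i)" using choice[of "\<lambda>i m. H i \<in> global_obs_m p b m"] H0 by blast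
  note Hm = global_obs_m_measurable[OF H] and HL = global_obs_m_Linf[OF H] and Ht = global_obs_m_tendsto[OF H]
  define L where "L = (\<lambda>i. inf_avg (H i))"
  have LL: "\<bar>L i - L j\<bar> \<le> inverse (real (Suc i)) + inverse (real (Suc j))" for i j
    unfolding L_def
  proof (rule inf_avg_diff_le[OF Hm Hm HL HL _ Ht Ht])
    show "AE x in rw_measure. \<bar>H i x - H j x\<bar> \<le> inverse (real (Suc i)) + inverse (real (Suc j))"
      using close[of i] close[of j] by eventually_elim linarith
  qed
  have "Cauchy L"
  proof (rule metric_CauchyI)
    fix e :: real assume "e > 0"
    then obtain N where N: "inverse (real (Suc N)) < e / 2" using reals_Archimedean[of "e / 2"] by auto
    have "dist (L i) (L j) < e" if "i \<ge> N" "j \<ge> N" for i j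
    proof -
      have "inverse (real (Suc i)) \<le> inverse (real (Suc N))" "inverse (real (Suc j)) \<le> inverse (real (Suc N))"
        using that by (auto intro!: le_imp_inverse_le)
      then show ?thesis using LL[of i j] N unfolding dist_real_def by linarith
    qed
    then show "\<exists>M. \<forall>i\<ge>M. \<forall>j\<ge>M. dist (L i) (L j) < e" by blast
  qed
  then obtain l where l: "L \<longlonglongrightarrow> l" using Cauchy_convergent convergent_def by blast
  obtain D where D: "AE x in rw_measure. \<bar>F x\<bar> \<le> D" by (rule Linf_bound[OF Fm(2)])
  have "((\<lambda>V. vol_avg V F) \<longlongrightarrow> l) exh_filter"
  proof (rule tendstoI)
    fix e :: real assume e: "e > 0"
    have "\<forall>\<^sub>F i in sequentially. dist (L i) l < e / 3" using l e by (intro tendstoD) auto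
    moreover have "\<forall>\<^sub>F i in sequentially. inverse (real (Suc i)) < e / 3"
      using LIMSEQ_inverse_real_of_nat e by (intro order_tendstoD) auto
    ultimately have "\<forall>\<^sub>F i in sequentially. dist (L i) l < e / 3 \<and> inverse (real (Suc i)) < e / 3" by (rule eventually_conj)
    then obtain i where i: "dist (L i) l < e / 3" "inverse (real (Suc i)) < e / 3" by (auto simp: eventually_sequentially)
    obtain D' where D': "AE x in rw_measure. \<bar>H i x\<bar> \<le> D'" by (rule Linf_bound[OF HL])
    have "\<forall>\<^sub>F V in exh_filter. dist (vol_avg V (H i)) (L i) < e / 3" unfolding L_def using Ht e by (intro tendstoD) auto
    moreover have "\<forall>\<^sub>F V in exh_filter. \<bar>vol_avg V F - vol_avg V (H i)\<bar> \<le> inverse (real (Suc i))"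
      unfolding eventually_exh_filter
      by (intro exI[of _ 1] conjI ballI impI vol_avg_diff_le[OF _ Fm(1) Hm D D' close]) simp_all
    ultimately show "\<forall>\<^sub>F V in exh_filter. dist (vol_avg V F) l < e"
    proof eventually_elim
      fix V :: "'d phase set"
      assume "dist (vol_avg V (H i)) (L i) < e / 3" "\<bar>vol_avg V F - vol_avg V (H i)\<bar> \<le> inverse (real (Suc i))"
      then show "dist (vol_avg V F) l < e" using i unfolding dist_real_def by linarith
    qed
  qed
  then show ?thesis using inf_avg_eqI by blast
qed

lemma integrable_correlation:
  fixes F g :: "'d phase \<Rightarrow> real"
  assumes F: "F \<in> borel_measurable rw_measure" "AE x in rw_measure. \<bar>F x\<bar> \<le> D" and g: "integrable (rw_measure :: 'd phase measure) g"
  shows "integrable rw_measure (\<lambda>x. F ((T ^^ n) x) * g x)"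
proof (rule Bochner_Integration.integrable_bound[OF integrable_mult_right[OF g, of D]])
  show "(\<lambda>x. F ((T ^^ n) x) * g x) \<in> borel_measurable rw_measure"
    using g by (intro borel_measurable_times measurable_compose[OF measurable_rw_map_iter_rw F(1)]) auto
  show "AE x in rw_measure. norm (F ((T ^^ n) x) * g x) \<le> norm (D * g x)"
    using AE_rw_map_iter[OF F(2), of n] by eventually_elim (auto simp: abs_mult intro!: mult_right_mono)
qed

lemma correlation_diff_le:
  fixes F H g :: "'d phase \<Rightarrow> real"
  assumes F: "F \<in> borel_measurable rw_measure" "AE x in rw_measure. \<bar>F x\<bar> \<le> D"
    and H: "H \<in> borel_measurable rw_measure" "AE x in rw_measure. \<bar>H x\<bar> \<le> D'"
    and close: "AE x in rw_measure. \<bar>F x - H x\<bar> \<le> e" and g: "integrable (rw_measure :: 'd phase measure) g"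
  shows "\<bar>corr F n g - corr H n g\<bar> \<le> e * mu (\<lambda>x. \<bar>g x\<bar>)"
proof -
  note iF = integrable_correlation[OF F g, of n] and iH = integrable_correlation[OF H g, of n]
  have "corr F n g - corr H n g
      = (\<integral>x. F ((T ^^ n) x) * g x - H ((T ^^ n) x) * g x \<partial>rw_measure)"
    using iF iH by simp
  also have "\<bar>\<dots>\<bar> \<le> (\<integral>x. \<bar>F ((T ^^ n) x) * g x - H ((T ^^ n) x) * g x\<bar> \<partial>rw_measure)"
    by (rule integral_abs_bound)
  also have "\<dots> \<le> (\<integral>x. e * \<bar>g x\<bar> \<partial>rw_measure)"
  proof (rule integral_mono_AE)
    show "AE x in rw_measure. \<bar>F ((T ^^ n) x) * g x - H ((T ^^ n) x) * g x\<bar> \<le> e * \<bar>g x\<bar>"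
      using AE_rw_map_iter[OF close, of n]
      by eventually_elim (auto simp: left_diff_distrib[symmetric] abs_mult intro!: mult_right_mono)
  qed (use iF iH g in auto)
  finally show ?thesis by simp
qed

lemma cyl_restrict_local:
  fixes G :: "'d phase \<Rightarrow> real"
  assumes G: "G \<in> global_obs_m p b m" and V: "V \<in> exh_family"
  shows "(\<lambda>x. indicator V x * G x) \<in> local_obs_m p b m"
proof -
  obtain C where C: "finite C" "V = C \<times> unit_square" using exh_familyE[OF V] by metis
  obtain D where D: "AE x in rw_measure. \<bar>G x\<bar> \<le> D" by (rule Linf_bound[OF global_obs_m_Linf[OF G]])
  have "(\<lambda>x. indicator V x * G x) \<in> borel_measurable (cyl m)"
    using G Times_unit_square_cyl[of C m] unfolding C(2)
    by (intro borel_measurable_times borel_measurable_indicator) (auto simp: global_obs_m_def Linf_class_def)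
  moreover have "integrable rw_measure (\<lambda>x. indicator V x * G x)"
    using set_integral_bounded(1)[OF global_obs_m_measurable[OF G] D C(1)] by (simp add: set_integrable_def C(2))
  ultimately show ?thesis by (simp add: local_obs_m_def L1_class_def)
qed

lemma vol_avg_correlation:
  "vol_avg V (\<lambda>x. F ((T ^^ n) x) * G x) = (\<integral>x. F ((T ^^ n) x) * (indicator V x * G x) \<partial>rw_measure) / measure rw_measure V"
  "vol_avg V G = (\<integral>x. indicator V x * G x \<partial>rw_measure) / measure (rw_measure :: 'd phase measure) V"
  by (simp_all add: vol_avg_def set_lebesgue_integral_def mult.left_commute)

text \<open>Tests the correlation bound on \<open>g = 1\<^sub>V G\<close>.\<close>

lemma cyl_vol_avg_correlation:
  assumes G: "G \<in> global_obs_m p b m" and V: "V \<in> exh_family" and D: "AE x in rw_measure. \<bar>G x\<bar> \<le> D" "0 \<le> \<epsilon>"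
    and corr: "\<And>g. g \<in> local_obs_m p b m \<Longrightarrow>
      \<bar>corr F n g - L * mu g\<bar> \<le> \<epsilon> * mu (\<lambda>x. \<bar>g x\<bar>)"
  shows "\<bar>vol_avg V (\<lambda>x. F ((T ^^ n) x) * G x) - L * vol_avg V G\<bar> \<le> \<epsilon> * D"
proof -
  obtain C where C: "finite C" "V = C \<times> unit_square" "measure rw_measure V = card C" "measure rw_measure V > 0"
    using exh_familyE[OF V] by metis
  let ?g = "\<lambda>x. indicator V x * G x"
  have Gm: "(\<lambda>x. \<bar>G x\<bar>) \<in> borel_measurable rw_measure" using global_obs_m_measurable[OF G] by simp
  have "(\<integral>x. \<bar>?g x\<bar> \<partial>rw_measure) = (LINT x:V|rw_measure. \<bar>G x\<bar>)"
    by (simp add: set_lebesgue_integral_def abs_mult)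
  also have "\<dots> \<le> D * card C"
    using set_integral_bounded(2)[OF Gm _ C(1), of D] D(1) unfolding C(2) by simp
  finally have abs: "(\<integral>x. \<bar>?g x\<bar> \<partial>rw_measure) \<le> D * measure rw_measure V" by (simp add: C(3))
  have "\<bar>vol_avg V (\<lambda>x. F ((T ^^ n) x) * G x) - L * vol_avg V G\<bar>
      = \<bar>(\<integral>x. F ((T ^^ n) x) * ?g x \<partial>rw_measure) - L * (\<integral>x. ?g x \<partial>rw_measure)\<bar> / measure rw_measure V"
    using C(4) by (simp add: vol_avg_correlation diff_divide_distrib[symmetric] abs_divide)
  also have "\<dots> \<le> \<epsilon> * (\<integral>x. \<bar>?g x\<bar> \<partial>rw_measure) / measure rw_measure V"
    using C(4) corr[OF cyl_restrict_local[OF G V]] by (intro divide_right_mono) auto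
  also have "\<dots> \<le> \<epsilon> * (D * measure rw_measure V) / measure rw_measure V"
    using abs C(4) D(2) by (intro divide_right_mono mult_left_mono) auto
  also have "\<dots> = \<epsilon> * D" using C(4) by simp
  finally show ?thesis .
qed

text \<open>For periodic \<open>F\<close> the values of \<open>F \<circ> T\<^sup>m\<close> do not depend on the cell, because \<open>T\<close> acts on
\<open>(y\<^sub>1, y\<^sub>2)\<close> independently of \<open>\<alpha>\<close>. The cell means are then constant, hence equal to the average of
\<open>F\<close> and fixed by the step operator, and the correlation bound holds with \<open>\<epsilon> = 0\<close>.\<close>

lemma periodic_cyl_correlation:
  assumes F: "F \<in> global_obs_m p b m" and per: "lattice_periodic F" and n: "2 * m \<le> n"
    and g: "g \<in> local_obs_m p b m"
  shows "corr F n g = inf_avg F * mu g"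
proof -
  obtain D F' where "0 \<le> D" and clip: "F' = clip D F" and F': "F' \<in> borel_measurable (cyl m)" "\<And>x. \<bar>F' x\<bar> \<le> D"
    "AE x in rw_measure. F x = F' x" "((\<lambda>V. vol_avg V F') \<longlongrightarrow> inf_avg F) exh_filter"
    and Fm: "F \<in> borel_measurable (cyl m)"
    by (rule global_obs_mE[OF F]) (rule that)
  have gm: "g \<in> borel_measurable (cyl m)" and gi: "integrable rw_measure g"
    using g by (auto simp: local_obs_m_def L1_class_def)
  obtain f where f: "f \<in> borel_measurable half_phase" "\<And>x. x \<in> rw_space \<Longrightarrow> F' ((T ^^ m) x) = f (forward x)"
    using cyl_function_forward_rep[OF F'(1)] by blast
  have snd_iter: "snd ((T ^^ k) (\<alpha>, y)) = snd ((T ^^ k) (0, y))" for k \<alpha> y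
    by (induction k) (auto simp: prod_eq_iff rw_map_coords)
  have per': "F' (\<alpha>, y) = F' (0, y)" if "y \<in> unit_square" for \<alpha> y
    using per that unfolding lattice_periodic_def clip clip_def by metis
  have f_per: "f (\<alpha>, y) = f (0, y)" if "y \<in> {0..<1}" for \<alpha> y
  proof -
    have in_space: "(\<beta>, y, 0) \<in> rw_space" for \<beta> :: "int ^ 'd" using that by (simp add: in_rw_space)
    have f_eq: "f (\<beta>, y) = F' (0, snd ((T ^^ m) (0, y, 0)))" for \<beta>
    proof -
      have "f (\<beta>, y) = F' ((T ^^ m) (\<beta>, y, 0))" using f(2)[OF in_space[of \<beta>]] by (simp add: forward_def)
      also have "\<dots> = F' (fst ((T ^^ m) (\<beta>, y, 0)), snd ((T ^^ m) (\<beta>, y, 0)))" by simp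
      also have "\<dots> = F' (0, snd ((T ^^ m) (\<beta>, y, 0)))"
        using rw_map_iter_in[OF in_space[of \<beta>], of m] by (intro per') (auto simp: rw_space_def)
      finally show ?thesis using snd_iter[of m \<beta> "(y, 0)"] by simp
    qed
    then show ?thesis by metis
  qed
  define c where "c = cell_mean f 0"
  have cm: "cell_mean f = (\<lambda>_. c)"
    unfolding c_def cell_mean_def fun_eq_iff by (auto intro!: Bochner_Integration.integral_cong f_per)
  have "\<bar>c - inf_avg F\<bar> \<le> e" if e: "e > 0" for e
  proof -
    obtain r where "\<bar>box_mean 0 r (cell_mean f) - inf_avg F\<bar> \<le> e"
      using uniform_box_mean[OF borel_measurable_cyl[OF F'(1)] F'(2) F'(4) f e] by blast
    moreover have "box_mean 0 r (cell_mean f) = c"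
      unfolding cm box_mean_def by (simp add: card_lattice_box)
    ultimately show ?thesis by simp
  qed
  then have c: "c = inf_avg F" by (metis abs_le_zero_iff dense_ge eq_iff_diff_eq_0)
  have "\<bar>corr F' n g - inf_avg F * mu g\<bar> \<le> 0 * mu (\<lambda>x. \<bar>g x\<bar>)"
    by (rule cyl_correlation[OF F'(1,2) gm gi f n]; simp add: cm step_mean_iter_const c)
  moreover have "corr F n g = corr F' n g"
    using gi by (intro integral_correlation_cong_AE F'(3) borel_measurable_cyl_rw[OF Fm] borel_measurable_cyl_rw[OF F'(1)]) auto
  ultimately show ?thesis by simp
qed

end

section \<open>Infinite-volume mixing\<close>

context mixing_rw
begin

text \<open>The supremum is over a nonempty set of nonnegative numbers, so it is nonnegative; the indicator
of a single cell serves as the element.\<close>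

lemma global_local_cyl_mixing:
  assumes F: "F \<in> global_obs_m p b m"
  shows "(\<lambda>n. SUP g \<in> {g \<in> local_obs_m p b m. \<not> ae_zero g}.
           ereal (1 / (LINT x|rw_measure. \<bar>g x\<bar>) *
             \<bar>(LINT x|rw_measure. F ((T ^^ n) x) * g x)
                - inf_avg F * (LINT x|rw_measure. g x)\<bar>)) \<longlonglongrightarrow> 0"
    (is "(\<lambda>n. SUP g \<in> ?S. ?v n g) \<longlonglongrightarrow> 0")
proof (rule order_tendstoI)
  have "indicator (lattice_box 0 0 \<times> unit_square) \<in> ?S"
  proof -
    let ?V = "lattice_box 0 0 \<times> unit_square :: 'd phase set"
    have fin: "finite (lattice_box 0 0 :: (int ^ 'd) set)" by (rule finite_lattice_box)
    have Vs: "?V \<in> sets rw_measure"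
      using sets_Times_unit_square[of "lattice_box 0 0"] by (simp add: rw_measure_eq_completion)
    have "indicator ?V \<in> borel_measurable (cyl m)"
      by (intro borel_measurable_indicator Times_unit_square_cyl)
    moreover have "\<not> ae_zero (indicator ?V)"
    proof
      assume "ae_zero (indicator ?V)"
      then have "(\<integral>x. indicat_real ?V x \<partial>rw_measure) = (\<integral>x. 0 \<partial>(rw_measure :: 'd phase measure))"
        unfolding ae_zero_def using integrable_indicator_box[OF fin] by (intro integral_cong_AE) auto
      moreover have "(\<integral>x. indicat_real ?V x \<partial>rw_measure) = measure rw_measure ?V"
        using Vs by simp
      ultimately show False by (simp add: measure_Times_unit_square fin card_lattice_box)
    qed
    ultimately show ?thesis
      using integrable_indicator_box[OF fin] by (simp add: local_obs_m_def L1_class_def)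
  qed
  then have "?v n (indicator (lattice_box 0 0 \<times> unit_square)) \<le> (SUP g \<in> ?S. ?v n g)" for n
    by (rule SUP_upper)
  moreover have "0 \<le> ?v n (indicator (lattice_box 0 0 \<times> unit_square))" for n by simp
  ultimately have nonneg: "0 \<le> (SUP g \<in> ?S. ?v n g)" for n by (rule order.trans[rotated])
  show "\<forall>\<^sub>F n in sequentially. y < (SUP g \<in> ?S. ?v n g)" if "y < 0" for y
    by (intro always_eventually allI less_le_trans[OF that nonneg])
  fix y :: ereal assume "0 < y"
  then obtain e where e: "0 < ereal e" "ereal e < y" using ereal_dense2[of 0 y] by blast
  then have "0 < e" by simp
  from cyl_correlation_rate[OF F this] obtain N where N: "\<And>n g. n \<ge> N \<Longrightarrow> g \<in> local_obs_m p b m \<Longrightarrow>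
    \<bar>corr F n g - inf_avg F * mu g\<bar> \<le> e * mu (\<lambda>x. \<bar>g x\<bar>)"
    by blast
  have "(SUP g \<in> ?S. ?v n g) < y" if "n \<ge> N" for n
  proof -
    have "(SUP g \<in> ?S. ?v n g) \<le> ereal e"
    proof (rule SUP_least)
      fix g assume "g \<in> ?S"
      then have le: "\<bar>corr F n g - inf_avg F * mu g\<bar> \<le> e * mu (\<lambda>x. \<bar>g x\<bar>)"
        using N[OF that] by blast
      have "0 \<le> mu (\<lambda>x. \<bar>g x\<bar>)" by simp
      then consider "mu (\<lambda>x. \<bar>g x\<bar>) = 0" | "0 < mu (\<lambda>x. \<bar>g x\<bar>)" by linarith
      then show "?v n g \<le> ereal e"
        by cases (use le e(1) in \<open>simp_all add: pos_divide_le_eq\<close>)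
    qed
    then show ?thesis using e(2) by simp
  qed
  then show "\<forall>\<^sub>F n in sequentially. (SUP g \<in> ?S. ?v n g) < y" by (auto simp: eventually_sequentially)
qed

lemma global_local_mixing:
  assumes F: "F \<in> global_obs p b" and g: "integrable (rw_measure :: 'd phase measure) g"
  shows "(\<lambda>n. corr F n g) \<longlonglongrightarrow> inf_avg F * mu g"
proof (rule LIMSEQ_I)
  fix r :: real assume r: "r > 0"
  define I where "I = mu (\<lambda>x. \<bar>g x\<bar>)"
  have I: "0 \<le> I" by (simp add: I_def)
  define e where "e = r / (3 * (I + 1))"
  have e: "e > 0" "e * I \<le> r / 3" using r I by (auto simp: e_def field_simps)
  obtain m H where H: "H \<in> global_obs_m p b m" "AE x in rw_measure. \<bar>F x - H x\<bar> \<le> e"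
    using global_obs_approx[OF F e(1)] by blast
  note Fm = global_obsD[OF F] and Hm = global_obs_m_measurable[OF H(1)] and HL = global_obs_m_Linf[OF H(1)]
  obtain D where D: "AE x in rw_measure. \<bar>F x\<bar> \<le> D" by (rule Linf_bound[OF Fm(2)])
  obtain D' where D': "AE x in rw_measure. \<bar>H x\<bar> \<le> D'" by (rule Linf_bound[OF HL])
  have avg: "\<bar>inf_avg F - inf_avg H\<bar> \<le> e"
    by (rule inf_avg_diff_le[OF Fm(1) Hm Fm(2) HL H(2) global_obs_tendsto[OF F] global_obs_m_tendsto[OF H(1)]])
  have gI: "\<bar>\<integral>x. g x \<partial>rw_measure\<bar> \<le> I" unfolding I_def by (rule integral_abs_bound)
  have "\<bar>inf_avg H * mu g - inf_avg F * mu g\<bar> \<le> e * I"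
    using avg gI e(1) by (simp add: left_diff_distrib[symmetric] abs_mult abs_minus_commute mult_mono)
  note avg' = order.trans[OF this e(2)]
  have corr: "\<bar>corr F n g - corr H n g\<bar> \<le> r / 3" for n
    by (rule order.trans[OF correlation_diff_le[OF Fm(1) D Hm D' H(2) g] e(2)[unfolded I_def]])
  obtain N where N: "\<And>n. n \<ge> N \<Longrightarrow> \<bar>corr H n g - inf_avg H * mu g\<bar> < r / 3"
    using LIMSEQ_D[OF cyl_local_mixing[OF H(1) g], of "r / 3"] r by auto
  have "norm (corr F n g - inf_avg F * mu g) < r" if "n \<ge> N" for n
    unfolding real_norm_def using N[OF that] corr[of n] avg' by linarith
  then show "\<exists>N. \<forall>n\<ge>N. norm (corr F n g - inf_avg F * mu g) < r"
    by blast
qed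

text \<open>After replacing \<open>F\<close> and \<open>G\<close> by cylinder observables at distance \<open>e\<close>, four errors remain:
the replacement in the average of the product, the correlation bound, the convergence of the average of \<open>HG\<close> over
\<open>V\<close>, and the replacement in the product of the averages. With \<open>e \<le> 1\<close> they add up to at most \<open>e * K\<close>.\<close>

lemma global_global_mixing:
  assumes F: "F \<in> global_obs p b" and G: "G \<in> global_obs p b" and \<epsilon>: "\<epsilon> > 0"
  shows "\<exists>M>0. \<forall>n. \<forall>V \<in> exh_family. real n \<ge> M \<longrightarrow> measure rw_measure V \<ge> M \<longrightarrow>
            \<bar>vol_avg V (\<lambda>x. F ((T ^^ n) x) * G x) - inf_avg F * inf_avg G\<bar> < \<epsilon>"
proof -
  note Fm = global_obsD[OF F] and Gm = global_obsD[OF G]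
  obtain DF where DF: "0 \<le> DF" "AE x in rw_measure. \<bar>F x\<bar> \<le> DF" by (rule Linf_bound[OF Fm(2)])
  obtain DG where DG: "0 \<le> DG" "AE x in rw_measure. \<bar>G x\<bar> \<le> DG" by (rule Linf_bound[OF Gm(2)])
  define aF where "aF = \<bar>inf_avg F\<bar>"
  define aG where "aG = \<bar>inf_avg G\<bar>"
  define K where "K = 2 * DG + DF + 2 + (2 * aF + aG + 2)"
  have K: "K > 0" using DF(1) DG(1) by (simp add: K_def aF_def aG_def add_nonneg_pos)
  define e where "e = min 1 (\<epsilon> / (2 * K))"
  have e: "0 < e" "e \<le> 1" using \<epsilon> K by (auto simp: e_def)
  have eK: "e * K < \<epsilon>"
  proof -
    have "e * K \<le> \<epsilon> / (2 * K) * K" using K by (intro mult_right_mono) (auto simp: e_def)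
    then show ?thesis using K \<epsilon> by simp
  qed
  obtain mF HF where HF0: "HF \<in> global_obs_m p b mF" "AE x in rw_measure. \<bar>F x - HF x\<bar> \<le> e"
    using global_obs_approx[OF F e(1)] by blast
  obtain mG HG where HG0: "HG \<in> global_obs_m p b mG" "AE x in rw_measure. \<bar>G x - HG x\<bar> \<le> e"
    using global_obs_approx[OF G e(1)] by blast
  define m where "m = max mF mG"
  have HF: "HF \<in> global_obs_m p b m" and HG: "HG \<in> global_obs_m p b m"
    using HF0(1) HG0(1) by (auto simp: m_def intro: global_obs_m_mono[rotated])
  note HFm = global_obs_m_measurable[OF HF] and HGm = global_obs_m_measurable[OF HG]
  have DHF: "AE x in rw_measure. \<bar>HF x\<bar> \<le> DF + e" using DF(2) HF0(2) by eventually_elim linarith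
  have DHG: "AE x in rw_measure. \<bar>HG x\<bar> \<le> DG + e" using DG(2) HG0(2) by eventually_elim linarith
  have avF: "\<bar>inf_avg F - inf_avg HF\<bar> \<le> e"
    by (rule inf_avg_diff_le[OF Fm(1) HFm Fm(2) global_obs_m_Linf[OF HF] HF0(2) global_obs_tendsto[OF F] global_obs_m_tendsto[OF HF]])
  have avG: "\<bar>inf_avg G - inf_avg HG\<bar> \<le> e"
    by (rule inf_avg_diff_le[OF Gm(1) HGm Gm(2) global_obs_m_Linf[OF HG] HG0(2) global_obs_tendsto[OF G] global_obs_m_tendsto[OF HG]])
  obtain N where N: "\<And>n g. n \<ge> N \<Longrightarrow> g \<in> local_obs_m p b m \<Longrightarrow>
    \<bar>corr HF n g - inf_avg HF * mu g\<bar> \<le> e * mu (\<lambda>x. \<bar>g x\<bar>)"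
    using cyl_correlation_rate[OF HF e(1)] by blast
  have "\<forall>\<^sub>F V in exh_filter. dist (vol_avg V HG) (inf_avg HG) < e"
    using global_obs_m_tendsto[OF HG] e(1) by (rule tendstoD)
  then obtain M where M: "\<And>V. V \<in> exh_family \<Longrightarrow> M \<le> measure rw_measure V \<Longrightarrow> \<bar>vol_avg V HG - inf_avg HG\<bar> < e"
    unfolding eventually_exh_filter dist_real_def by blast
  show ?thesis
  proof (intro exI[of _ "max 1 (max M (real N))"] conjI allI ballI impI)
    fix n and V :: "'d phase set"
    assume V: "V \<in> exh_family" and n: "max 1 (max M (real N)) \<le> real n" and VM: "max 1 (max M (real N)) \<le> measure rw_measure V"
    let ?A = "vol_avg V (\<lambda>x. F ((T ^^ n) x) * G x)" and ?B = "vol_avg V (\<lambda>x. HF ((T ^^ n) x) * HG x)"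
    have 1: "\<bar>?A - ?B\<bar> \<le> e * DG + (DF + e) * e"
    proof (rule vol_avg_diff_le[OF V])
      show "(\<lambda>x. F ((T ^^ n) x) * G x) \<in> borel_measurable rw_measure" "(\<lambda>x. HF ((T ^^ n) x) * HG x) \<in> borel_measurable rw_measure"
        by (intro borel_measurable_times measurable_compose[OF measurable_rw_map_iter_rw] Fm Gm HFm HGm)+
      show "AE x in rw_measure. \<bar>F ((T ^^ n) x) * G x\<bar> \<le> DF * DG"
        using AE_rw_map_iter[OF DF(2), of n] DG(2) by eventually_elim (auto simp: abs_mult intro!: mult_mono DF)
      show "AE x in rw_measure. \<bar>HF ((T ^^ n) x) * HG x\<bar> \<le> (DF + e) * (DG + e)"
        using AE_rw_map_iter[OF DHF, of n] DHG
        by eventually_elim (use DF(1) e(1) in \<open>auto simp: abs_mult intro!: mult_mono\<close>)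
      show "AE x in rw_measure. \<bar>F ((T ^^ n) x) * G x - HF ((T ^^ n) x) * HG x\<bar> \<le> e * DG + (DF + e) * e"
        using AE_rw_map_iter[OF HF0(2), of n] AE_rw_map_iter[OF DHF, of n] HG0(2) DG(2)
      proof eventually_elim
        fix x assume a: "\<bar>F ((T ^^ n) x) - HF ((T ^^ n) x)\<bar> \<le> e" "\<bar>HF ((T ^^ n) x)\<bar> \<le> DF + e" "\<bar>G x - HG x\<bar> \<le> e" "\<bar>G x\<bar> \<le> DG"
        have "F ((T ^^ n) x) * G x - HF ((T ^^ n) x) * HG x
            = (F ((T ^^ n) x) - HF ((T ^^ n) x)) * G x + HF ((T ^^ n) x) * (G x - HG x)" by (simp add: algebra_simps)
        also have "\<bar>\<dots>\<bar> \<le> \<bar>F ((T ^^ n) x) - HF ((T ^^ n) x)\<bar> * \<bar>G x\<bar> + \<bar>HF ((T ^^ n) x)\<bar> * \<bar>G x - HG x\<bar>"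
          by (simp add: abs_mult[symmetric] abs_triangle_ineq)
        also have "\<dots> \<le> e * DG + (DF + e) * e"
          using a e(1) DF(1) by (intro add_mono mult_mono) auto
        finally show "\<bar>F ((T ^^ n) x) * G x - HF ((T ^^ n) x) * HG x\<bar> \<le> e * DG + (DF + e) * e" .
      qed
    qed
    have 2: "\<bar>?B - inf_avg HF * vol_avg V HG\<bar> \<le> e * (DG + e)"
      by (rule cyl_vol_avg_correlation[OF HG V DHG]) (use e(1) N n in auto)
    have V3: "\<bar>vol_avg V HG - inf_avg HG\<bar> \<le> e" using M[OF V] VM by simp
    have aHF: "\<bar>inf_avg HF\<bar> \<le> aF + 1" and aHG: "\<bar>inf_avg HG\<bar> \<le> aG + 1"
      using avF avG e(2) by (simp_all only: aF_def aG_def)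
    have 3: "\<bar>inf_avg HF * vol_avg V HG - inf_avg HF * inf_avg HG\<bar> \<le> (aF + 1) * e"
      using V3 aHF e(1) by (simp add: right_diff_distrib[symmetric] abs_mult mult_mono)
    have 4: "\<bar>inf_avg HF * inf_avg HG - inf_avg F * inf_avg G\<bar> \<le> e * (aG + 1) + aF * e"
    proof -
      have "inf_avg HF * inf_avg HG - inf_avg F * inf_avg G
          = (inf_avg HF - inf_avg F) * inf_avg HG + inf_avg F * (inf_avg HG - inf_avg G)" by (simp add: algebra_simps)
      also have "\<bar>\<dots>\<bar> \<le> \<bar>inf_avg HF - inf_avg F\<bar> * \<bar>inf_avg HG\<bar> + \<bar>inf_avg F\<bar> * \<bar>inf_avg HG - inf_avg G\<bar>"
        by (simp add: abs_mult[symmetric] abs_triangle_ineq)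
      also have "\<dots> \<le> e * (aG + 1) + aF * e"
        using avF avG aHG e(1) by (intro add_mono mult_mono) (auto simp: aF_def abs_minus_commute)
      finally show ?thesis .
    qed
    have "e * DG + (DF + e) * e + e * (DG + e) + (aF + 1) * e + (e * (aG + 1) + aF * e) = e * (2 * DG + DF + 2 * e + (2 * aF + aG + 2))"
      by (simp add: algebra_simps)
    also have "\<dots> \<le> e * K" using e by (intro mult_left_mono) (auto simp: K_def)
    finally show "\<bar>?A - inf_avg F * inf_avg G\<bar> < \<epsilon>"
      using 1 2 3 4 eK by linarith
  qed simp
qed

end

context rw_data
begin

lemma periodic_global_global_mixing:
  assumes F: "F \<in> global_obs_m p b m" and G: "G \<in> global_obs_m p b m" and per: "lattice_periodic F"
  shows "\<forall>\<^sub>F n in sequentially. inf_avg_exists (\<lambda>x. F ((T ^^ n) x) * G x)"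
    "(\<lambda>n. inf_avg (\<lambda>x. F ((T ^^ n) x) * G x)) \<longlonglongrightarrow> inf_avg F * inf_avg G"
proof -
  have lim: "((\<lambda>V. vol_avg V (\<lambda>x. F ((T ^^ n) x) * G x)) \<longlongrightarrow> inf_avg F * inf_avg G) exh_filter" if n: "n \<ge> 2 * m" for n
  proof (rule Lim_transform_eventually)
    show "((\<lambda>V. inf_avg F * vol_avg V G) \<longlongrightarrow> inf_avg F * inf_avg G) exh_filter"
      by (rule tendsto_mult_left[OF global_obs_m_tendsto[OF G]])
    have "inf_avg F * vol_avg V G = vol_avg V (\<lambda>x. F ((T ^^ n) x) * G x)" if "V \<in> exh_family" for V
      unfolding vol_avg_correlation using periodic_cyl_correlation[OF F per n cyl_restrict_local[OF G that]] by simp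
    then show "\<forall>\<^sub>F V in exh_filter. inf_avg F * vol_avg V G = vol_avg V (\<lambda>x. F ((T ^^ n) x) * G x)"
      unfolding eventually_exh_filter by (intro exI[of _ 1]) auto
  qed
  then show "\<forall>\<^sub>F n in sequentially. inf_avg_exists (\<lambda>x. F ((T ^^ n) x) * G x)"
    unfolding eventually_sequentially inf_avg_exists_def by blast
  have "\<forall>\<^sub>F n in sequentially. inf_avg F * inf_avg G = inf_avg (\<lambda>x. F ((T ^^ n) x) * G x)"
    unfolding eventually_sequentially using inf_avg_eqI[OF lim] by metis
  then show "(\<lambda>n. inf_avg (\<lambda>x. F ((T ^^ n) x) * G x)) \<longlonglongrightarrow> inf_avg F * inf_avg G"
    by (rule Lim_transform_eventually[OF tendsto_const])
qed

end

theorem theorem4p6: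
  fixes p :: "(int ^ ('d::finite)) pmf" and b :: "nat \<Rightarrow> int ^ 'd" and j' :: nat and \<nu> :: nat
  assumes enum: "bij_betw b (index_set p) (set_pmf p)"
    and nu: "\<nu> = max 2 (CARD('d) div 2 + 1)"
    and moment: "(\<lambda>\<beta>. lattice_norm \<beta> ^ \<nu> * pmf p \<beta>) summable_on UNIV"
    and j': "j' \<in> index_set p"
    and span: "int_span {b j - b j' | j. j \<in> index_set p} = UNIV"
  shows
    "(\<forall>m. \<forall>F \<in> global_obs_m p b m.
        (\<lambda>n. SUP g \<in> {g \<in> local_obs_m p b m. \<not> ae_zero g}.
           ereal (1 / (LINT x|rw_measure. \<bar>g x\<bar>) *
             \<bar>(LINT x|rw_measure. F ((rw_map p b ^^ n) x) * g x)
                - inf_avg F * (LINT x|rw_measure. g x)\<bar>)) \<longlonglongrightarrow> 0)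
     \<and> (\<forall>F \<in> global_obs p b. \<forall>g \<in> local_obs.
          (\<lambda>n. LINT x|rw_measure. F ((rw_map p b ^^ n) x) * g x)
             \<longlonglongrightarrow> inf_avg F * (LINT x|rw_measure. g x)
          \<and> ((LINT x|rw_measure. g x) = 0 \<longrightarrow>
              (\<lambda>n. LINT x|rw_measure. F ((rw_map p b ^^ n) x) * g x) \<longlonglongrightarrow> 0))
     \<and> (\<forall>F \<in> global_obs p b. \<forall>G \<in> global_obs p b. \<forall>\<epsilon>>0. \<exists>M>0. \<forall>n. \<forall>V \<in> exh_family.
          real n \<ge> M \<longrightarrow> measure rw_measure V \<ge> M \<longrightarrow>
            \<bar>vol_avg V (\<lambda>x. F ((rw_map p b ^^ n) x) * G x) - inf_avg F * inf_avg G\<bar> < \<epsilon>)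
     \<and> (\<forall>m. \<forall>F \<in> global_obs_m p b m. \<forall>G \<in> global_obs_m p b m. lattice_periodic F \<longrightarrow>
          (\<forall>\<^sub>F n in sequentially. inf_avg_exists (\<lambda>x. F ((rw_map p b ^^ n) x) * G x))
          \<and> (\<lambda>n. inf_avg (\<lambda>x. F ((rw_map p b ^^ n) x) * G x)) \<longlonglongrightarrow> inf_avg F * inf_avg G)"
proof -
  interpret rw_data p b by unfold_locales (rule enum)
  have "{b j - b j' | j. j \<in> index_set p} = {c - b j' | c. c \<in> set_pmf p}"
    unfolding b_image[symmetric] by blast
  with span have "int_span {c - b j' | c. c \<in> set_pmf p} = UNIV" by simp
  moreover have "b j' \<in> set_pmf p" using b_image j' by blast
  ultimately interpret mixing_rw p b "b j'" by unfold_locales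
  have local: "(\<lambda>n. LINT x|rw_measure. F ((T ^^ n) x) * g x) \<longlonglongrightarrow> inf_avg F * (LINT x|rw_measure. g x)"
    if "F \<in> global_obs p b" "g \<in> local_obs" for F g
    using that by (intro global_local_mixing) (simp_all add: local_obs_def L1_class_def)
  have zero: "(\<lambda>n. LINT x|rw_measure. F ((T ^^ n) x) * g x) \<longlonglongrightarrow> 0"
    if "F \<in> global_obs p b" "g \<in> local_obs" "(LINT x|rw_measure. g x) = 0" for F g
    using local[OF that(1,2)] that(3) by simp
  show ?thesis
    by (intro conjI allI ballI impI global_local_cyl_mixing global_global_mixing periodic_global_global_mixing local zero)
qed

end
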